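(* Let $p(y|x,s_1,s_2)$ be a memoryless channel with finite alphabets $\mathcal X,\mathcal Y,\mathcal S_1,\mathcal S_2$ and states $(S_{1,i},S_{2,i})$ i.i.d. $\sim p(s_1,s_2)$, and let $R_1',R_2'\ge0$. Consider the channel coding problem in which the encoder knows $S_1^n$ and a rate-$R_2'$ description of $S_2^n$, and the decoder knows $S_2^n$ and a rate-$R_1'$ description of $S_1^n$, and let $C_{12}^*$ be its capacity. Then $$C_{12}^*\ \ge\ \max\; I(U;Y,S_2|V_1,V_2)-I(U;S_1|V_1,V_2),$$ where the maximum is over all $p(v_1|s_1)\,p(v_2|s_2)\,p(u|s_1,v_1,v_2)\,p(x|u,s_1,v_1,v_2)$ such that $$R_1'\ge I(V_1;S_1)-I(V_1;Y,S_2,V_2),\qquad R_2'\ge I(V_2;S_2)-I(V_2;S_1),$$ $U,V_1,V_2$ being auxiliary random variables with finite alphabets and the joint law of $(S_1,S_2,V_1,V_2,U,X,Y)$ being the product of $p(s_1,s_2)$, the listed conditional distributions and $p(y|x,s_1,s_2)$.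
   Context: Notation: $x^n=(x_1,\dots,x_n)$; $I(\cdot;\cdot)$ is mutual information (logarithms to base 2). The channel is memoryless: $p(y_i|x^i,s_1^i,s_2^i,y^{i-1})=p(y_i|x_i,s_{1,i},s_{2,i})$. The message $W$ is uniform on $\{1,\dots,2^{nR}\}$ and independent of the states. An $(n,2^{nR},2^{nR_1'},2^{nR_2'})$ code consists of three encoding maps $f_{v1}:\mathcal S_1^n\to\{1,\dots,2^{nR_1'}\}$, $f_{v2}:\mathcal S_2^n\to\{1,\dots,2^{nR_2'}\}$, $f:\{1,\dots,2^{nR}\}\times\mathcal S_1^n\times\{1,\dots,2^{nR_2'}\}\to\mathcal X^n$, and a decoding map $g:\mathcal Y^n\times\mathcal S_2^n\times\{1,\dots,2^{nR_1'}\}\to\{1,\dots,2^{nR}\}$. Thus $X^n=f(W,S_1^n,f_{v2}(S_2^n))$ and $\hat W=g(Y^n,S_2^n,f_{v1}(S_1^n))$. $(R,R_1',R_2')$ is achievable if there is a sequence of such codes with average error probability $P_e^{(n)}=2^{-nR}\sum_w\Pr\{\hat W\ne W|W=w\}\to0$ as $n\to\infty$; $C_{12}^*$ is the supremum of all $R$ such that $(R,R_1',R_2')$ is achievable. *)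

theory Defs
  imports "HOL-Probability.Probability" "HOL-Library.Monad_Syntax"
begin

section \<open>Mutual information of random variables on a discrete sample space\<close>

text \<open>The library's (conditional) mutual information, in bits. The sample space of
  \<^term>\<open>measure_pmf J\<close> is the whole type, so the image measures are those of the library's
  notation for finite-valued random variables.\<close>

definition mut_info :: "'a pmf \<Rightarrow> ('a \<Rightarrow> 'b) \<Rightarrow> ('a \<Rightarrow> 'c) \<Rightarrow> real" where
  "mut_info J A B =
     prob_space.mutual_information (measure_pmf J) 2
       (count_space (range A)) (count_space (range B)) A B"

definition cond_mut_info ::
    "'a pmf \<Rightarrow> ('a \<Rightarrow> 'b) \<Rightarrow> ('a \<Rightarrow> 'c) \<Rightarrow> ('a \<Rightarrow> 'd) \<Rightarrow> real" where
  "cond_mut_info J A B C =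
     prob_space.conditional_mutual_information (measure_pmf J) 2
       (count_space (range A)) (count_space (range B)) (count_space (range C)) A B C"


section \<open>Codes and capacity\<close>

text \<open>Sequences of length \<open>n\<close> are extensional functions on \<open>{..<n}\<close>; the index set
  \<open>{1, \<dots>, 2^(n R)}\<close> is read as \<open>{1, \<dots>, \<lfloor>2^(n R)\<rfloor>}\<close>.\<close>

abbreviation seqs :: "nat \<Rightarrow> (nat \<Rightarrow> 'a) set" where
  "seqs n \<equiv> {..<n} \<rightarrow>\<^sub>E UNIV"

definition num_indices :: "nat \<Rightarrow> real \<Rightarrow> nat" where
  "num_indices n R = nat \<lfloor>2 powr (real n * R)\<rfloor>"

record ('s1, 's2, 'x, 'y) channel_code =
  desc1 :: "(nat \<Rightarrow> 's1) \<Rightarrow> nat"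
  desc2 :: "(nat \<Rightarrow> 's2) \<Rightarrow> nat"
  enc :: "nat \<Rightarrow> (nat \<Rightarrow> 's1) \<Rightarrow> nat \<Rightarrow> nat \<Rightarrow> 'x"
  dec :: "(nat \<Rightarrow> 'y) \<Rightarrow> (nat \<Rightarrow> 's2) \<Rightarrow> nat \<Rightarrow> nat"

definition is_code ::
    "nat \<Rightarrow> real \<Rightarrow> real \<Rightarrow> real \<Rightarrow> ('s1, 's2, 'x, 'y) channel_code \<Rightarrow> bool" where
  "is_code n R R1 R2 c \<longleftrightarrow>
     desc1 c \<in> seqs n \<rightarrow> {1..num_indices n R1} \<and>
     desc2 c \<in> seqs n \<rightarrow> {1..num_indices n R2} \<and>
     enc c \<in> {1..num_indices n R} \<rightarrow> seqs n \<rightarrow> {1..num_indices n R2} \<rightarrow> seqs n \<and>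
     dec c \<in> seqs n \<rightarrow> seqs n \<rightarrow> {1..num_indices n R1} \<rightarrow> {1..num_indices n R}"

text \<open>Conditional law of the decoded message given that message \<open>w\<close> is sent.\<close>

definition decoded_law ::
    "('s1 \<times> 's2) pmf \<Rightarrow> ('x \<Rightarrow> 's1 \<Rightarrow> 's2 \<Rightarrow> 'y pmf) \<Rightarrow> nat \<Rightarrow>
      ('s1, 's2, 'x, 'y) channel_code \<Rightarrow> nat \<Rightarrow> nat pmf" where
  "decoded_law pS pY n c w = do {
     s \<leftarrow> Pi_pmf {..<n} undefined (\<lambda>_. pS);
     let s1 = restrict (\<lambda>i. fst (s i)) {..<n};
     let s2 = restrict (\<lambda>i. snd (s i)) {..<n};
     let x = enc c w s1 (desc2 c s2);
     y \<leftarrow> Pi_pmf {..<n} undefined (\<lambda>i. pY (x i) (s1 i) (s2 i));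
     return_pmf (dec c y s2 (desc1 c s1))
   }"

definition error_prob ::
    "('s1 \<times> 's2) pmf \<Rightarrow> ('x \<Rightarrow> 's1 \<Rightarrow> 's2 \<Rightarrow> 'y pmf) \<Rightarrow> nat \<Rightarrow> real \<Rightarrow>
      ('s1, 's2, 'x, 'y) channel_code \<Rightarrow> real" where
  "error_prob pS pY n R c =
     (\<Sum>w = 1..num_indices n R. measure_pmf.prob (decoded_law pS pY n c w) {w'. w' \<noteq> w})
       / real (num_indices n R)"

definition achievable ::
    "('s1 \<times> 's2) pmf \<Rightarrow> ('x \<Rightarrow> 's1 \<Rightarrow> 's2 \<Rightarrow> 'y pmf) \<Rightarrow> real \<Rightarrow> real \<Rightarrow> real \<Rightarrow> bool" where
  "achievable pS pY R R1 R2 \<longleftrightarrow>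
     (\<exists>c. (\<forall>n. is_code n R R1 R2 (c n)) \<and> (\<lambda>n. error_prob pS pY n R (c n)) \<longlonglongrightarrow> 0)"

definition capacity ::
    "('s1 \<times> 's2) pmf \<Rightarrow> ('x \<Rightarrow> 's1 \<Rightarrow> 's2 \<Rightarrow> 'y pmf) \<Rightarrow> real \<Rightarrow> real \<Rightarrow> ereal" where
  "capacity pS pY R1 R2 = Sup {ereal R | R. achievable pS pY R R1 R2}"


section \<open>Single-letter quantities\<close>

definition joint_law ::
    "('s1 \<times> 's2) pmf \<Rightarrow> ('x \<Rightarrow> 's1 \<Rightarrow> 's2 \<Rightarrow> 'y pmf) \<Rightarrow>
      ('s1 \<Rightarrow> 'v1 pmf) \<Rightarrow> ('s2 \<Rightarrow> 'v2 pmf) \<Rightarrow>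
      ('s1 \<Rightarrow> 'v1 \<Rightarrow> 'v2 \<Rightarrow> 'u pmf) \<Rightarrow> ('u \<Rightarrow> 's1 \<Rightarrow> 'v1 \<Rightarrow> 'v2 \<Rightarrow> 'x pmf) \<Rightarrow>
      ('s1 \<times> 's2 \<times> 'v1 \<times> 'v2 \<times> 'u \<times> 'x \<times> 'y) pmf" where
  "joint_law pS pY pV1 pV2 pU pX = do {
     (s1, s2) \<leftarrow> pS;
     v1 \<leftarrow> pV1 s1;
     v2 \<leftarrow> pV2 s2;
     u \<leftarrow> pU s1 v1 v2;
     x \<leftarrow> pX u s1 v1 v2;
     y \<leftarrow> pY x s1 s2;
     return_pmf (s1, s2, v1, v2, u, x, y)
   }"

abbreviation S1 :: "'s1 \<times> 's2 \<times> 'v1 \<times> 'v2 \<times> 'u \<times> 'x \<times> 'y \<Rightarrow> 's1" where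
  "S1 \<equiv> \<lambda>(s1, s2, v1, v2, u, x, y). s1"
abbreviation S2 :: "'s1 \<times> 's2 \<times> 'v1 \<times> 'v2 \<times> 'u \<times> 'x \<times> 'y \<Rightarrow> 's2" where
  "S2 \<equiv> \<lambda>(s1, s2, v1, v2, u, x, y). s2"
abbreviation V1 :: "'s1 \<times> 's2 \<times> 'v1 \<times> 'v2 \<times> 'u \<times> 'x \<times> 'y \<Rightarrow> 'v1" where
  "V1 \<equiv> \<lambda>(s1, s2, v1, v2, u, x, y). v1"
abbreviation V2 :: "'s1 \<times> 's2 \<times> 'v1 \<times> 'v2 \<times> 'u \<times> 'x \<times> 'y \<Rightarrow> 'v2" where
  "V2 \<equiv> \<lambda>(s1, s2, v1, v2, u, x, y). v2"
abbreviation U :: "'s1 \<times> 's2 \<times> 'v1 \<times> 'v2 \<times> 'u \<times> 'x \<times> 'y \<Rightarrow> 'u" where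
  "U \<equiv> \<lambda>(s1, s2, v1, v2, u, x, y). u"
abbreviation Y :: "'s1 \<times> 's2 \<times> 'v1 \<times> 'v2 \<times> 'u \<times> 'x \<times> 'y \<Rightarrow> 'y" where
  "Y \<equiv> \<lambda>(s1, s2, v1, v2, u, x, y). y"

text \<open>The set of laws over which the bound is maximised, for given auxiliary alphabets
  \<^typ>\<open>'v1\<close>, \<^typ>\<open>'v2\<close>, \<^typ>\<open>'u\<close>.\<close>

definition feasible_laws ::
    "('s1 \<times> 's2) pmf \<Rightarrow> ('x \<Rightarrow> 's1 \<Rightarrow> 's2 \<Rightarrow> 'y pmf) \<Rightarrow> real \<Rightarrow> real \<Rightarrow>
      ('s1 \<times> 's2 \<times> 'v1 \<times> 'v2 \<times> 'u \<times> 'x \<times> 'y) pmf set" where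
  "feasible_laws pS pY R1 R2 =
     {J. (\<exists>pV1 pV2 pU pX. J = joint_law pS pY pV1 pV2 pU pX) \<and>
         R1 \<ge> mut_info J V1 S1 - mut_info J V1 (\<lambda>\<omega>. (Y \<omega>, S2 \<omega>, V2 \<omega>)) \<and>
         R2 \<ge> mut_info J V2 S2 - mut_info J V2 S1}"

definition rate_bound :: "('s1 \<times> 's2 \<times> 'v1 \<times> 'v2 \<times> 'u \<times> 'x \<times> 'y) pmf \<Rightarrow> real" where
  "rate_bound J =
     cond_mut_info J U (\<lambda>\<omega>. (Y \<omega>, S2 \<omega>)) (\<lambda>\<omega>. (V1 \<omega>, V2 \<omega>))
     - cond_mut_info J U S1 (\<lambda>\<omega>. (V1 \<omega>, V2 \<omega>))"

end

theory Submission
  imports Defs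
begin

text \<open>
  All random choices of the code are exponential races: given independent standard exponential
  clocks \<open>E v\<close>, the law \<open>p\<close> selects the \<open>v\<close> with the least \<open>E v / p v\<close>. The selection has law
  \<open>p\<close>, and two laws \<open>p\<close>, \<open>q\<close> running on the same clocks disagree, given that \<open>p\<close> selects
  \<open>v\<close>, with probability at most \<open>p v / (p v + q v)\<close> (Li and Anantharam's Poisson matching lemma).
  One race on \<open>V\<^sub>2\<close> and its bins transmits \<open>V\<^sub>2\<close> to the encoder, one on \<open>V\<^sub>1\<close> and its bins
  transmits \<open>V\<^sub>1\<close> to the decoder, and one on \<open>U\<close> and the messages carries the message, each
  receiver using its posterior law in place of the sender's. The error is thus bounded by three
  expectations of likelihood ratios, which factorise over the letters and decay exponentially by
  Chernoff's bound; the exponents are exactly the three information differences of the theorem.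

  Binding constraints are handled separately. If a description rate is positive, coding over a
  fraction \<open>\<gamma> < 1\<close> of the block makes its constraint strict. If \<open>R\<^sub>2' = 0\<close>, the constraint
  forces \<open>p(v\<^sub>2|s\<^sub>1) = p(v\<^sub>2|s\<^sub>2)\<close>, so encoder and decoder run the same race and never disagree. If
  \<open>R\<^sub>1' = 0\<close>, replacing \<open>(V\<^sub>1, U)\<close> by a constant and the pair \<open>(V\<^sub>1, U)\<close> does not
  decrease the rate.
\<close>

section \<open>Exponential races and matching\<close>

text \<open>The guess laws depend on the channel output, which itself depends on what the races
  selected, so a bound for two fixed laws does not suffice. Each error event is therefore averaged
  over its own race in a setting where the output depends on that race through the selected element
  alone. This holds for the input that an encoder with the true \<open>v2\<close> would send; the
  difference from the actual input is charged to the failure of the race on \<open>v2\<close>.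

  Guess laws stay arbitrary until the end. A race fails with exponent governed by the expected
  logarithm of a ratio such as \<open>p(v1|s1) / p(v1|y,s2,v2)\<close>, and for posteriors this
  expectation is the information difference.

  Exponential decay needs a strict inequality, while the rate constraints are weak. Using a fraction
  \<gamma> of the letters multiplies the information cost by \<gamma> and leaves the description
  rate as it is. This gains nothing when the rate is zero, whence the separate treatment of zero
  rates.\<close>

abbreviation exp_clock :: "real measure" where
  "exp_clock \<equiv> density lborel (exponential_density 1)"

lemma prob_space_exp_clock: "prob_space exp_clock"
  by (rule prob_space_exponential_density) simp

lemma emeasure_exp_clock_greater:
  assumes "t \<ge> 0"
  shows "emeasure exp_clock {t<..} = ennreal (exp (- t))"
proof -
  interpret D: prob_space exp_clock by (rule prob_space_exp_clock)
  have "distributed exp_clock lborel (\<lambda>x. x) (exponential_density 1)"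
    by (auto simp: distributed_def distr_id2)
  from D.exponential_distributedD_gt[OF this assms] show ?thesis
    by (simp add: D.emeasure_eq_measure greaterThan_def)
qed

lemma AE_exp_clock_nonneg: "AE t in exp_clock. t \<ge> 0"
  by (subst AE_density) (auto simp: exponential_density_def intro!: AE_I2 split: if_splits)

lemma nn_integral_exp_clock_exp:
  assumes "C \<ge> 0"
  shows "(\<integral>\<^sup>+t. ennreal (exp (- (C * t))) \<partial>exp_clock) = ennreal (1 / (1 + C))"
proof -
  interpret P: prob_space "density lborel (exponential_density (1 + C))"
    by (rule prob_space_exponential_density) (use assms in simp)
  have "(\<integral>\<^sup>+t. ennreal (exp (- (C * t))) \<partial>exp_clock) =
      (\<integral>\<^sup>+t. ennreal (exponential_density 1 t) * ennreal (exp (- (C * t))) \<partial>lborel)"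
    by (subst nn_integral_density) auto
  also have "\<dots> = (\<integral>\<^sup>+t. ennreal (1 / (1 + C)) * ennreal (exponential_density (1 + C) t) \<partial>lborel)"
  proof (rule nn_integral_cong)
    fix t :: real
    have "exponential_density 1 t * exp (- (C * t)) = 1 / (1 + C) * exponential_density (1 + C) t"
      using assms by (simp add: exponential_density_def exp_add[symmetric] field_simps)
    then show "ennreal (exponential_density 1 t) * ennreal (exp (- (C * t))) =
        ennreal (1 / (1 + C)) * ennreal (exponential_density (1 + C) t)"
      using assms by (simp add: ennreal_mult[symmetric] exponential_density_nonneg)
  qed
  also have "\<dots> = ennreal (1 / (1 + C)) * (\<integral>\<^sup>+t. ennreal (exponential_density (1 + C) t) \<partial>lborel)"
    by (subst nn_integral_cmult) auto
  also have "(\<integral>\<^sup>+t. ennreal (exponential_density (1 + C) t) \<partial>lborel) = 1"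
    using P.emeasure_space_1 by (simp add: emeasure_density)
  finally show ?thesis by simp
qed

text \<open>Given \<open>E u = t\<close>, each other clock independently exceeds
  \<open>c v * t\<close> with probability \<open>exp (- (c v * t))\<close>, so the answer is the
  Laplace transform of a unit exponential at the sum of the \<open>c v\<close>. The weights are free
  so that the lemma serves one law (ratios of its masses) as well as two laws at once (the larger of
  two ratios).\<close>

lemma exp_race:
  fixes c :: "'a \<Rightarrow> real"
  assumes A: "finite A" "u \<in> A" and c: "\<And>v. c v \<ge> 0"
  shows "measure (Pi\<^sub>M A (\<lambda>_. exp_clock)) {E \<in> space (Pi\<^sub>M A (\<lambda>_. exp_clock)). \<forall>v\<in>A - {u}. c v * E u < E v}
     = 1 / (1 + (\<Sum>v\<in>A - {u}. c v))"
proof -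
  define I where "I = A - {u}"
  have I: "finite I" "u \<notin> I" and A_eq: "A = insert u I"
    using A by (auto simp: I_def)
  interpret E: prob_space exp_clock by (rule prob_space_exp_clock)
  interpret product_prob_space "\<lambda>_::'a. exp_clock" by standard
  interpret product_sigma_finite "\<lambda>_::'a. exp_clock" by standard
  let ?P = "\<lambda>A. Pi\<^sub>M A (\<lambda>_::'a. exp_clock)"
  interpret PA: prob_space "?P A" by (rule prob_space_PiM) (rule prob_space_exp_clock)
  let ?W = "{E \<in> space (?P A). \<forall>v\<in>I. c v * E u < E v}"
  have [measurable]: "?W \<in> sets (?P A)"
    using I unfolding A_eq by measurable
  have "emeasure (?P A) ?W = (\<integral>\<^sup>+E. indicator ?W E \<partial>?P A)" by simp
  also have "\<dots> = (\<integral>\<^sup>+t. \<integral>\<^sup>+E. indicator ?W (E(u := t)) \<partial>?P I \<partial>exp_clock)"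
    unfolding A_eq using \<open>?W \<in> sets (?P A)\<close> unfolding A_eq
    by (intro product_nn_integral_insert_rev[OF I] borel_measurable_indicator)
  also have "\<dots> = (\<integral>\<^sup>+t. ennreal (exp (- (sum c I * t))) \<partial>exp_clock)"
  proof (rule nn_integral_cong_AE, use AE_exp_clock_nonneg in eventually_elim)
    fix t :: real assume t: "t \<ge> 0"
    have "(\<integral>\<^sup>+E. indicator ?W (E(u := t)) \<partial>?P I) = (\<integral>\<^sup>+E. indicator (Pi\<^sub>E I (\<lambda>v. {c v * t<..})) E \<partial>?P I)"
      using I by (intro nn_integral_cong) (auto simp: A_eq space_PiM PiE_iff extensional_def split: split_indicator)
    also have "\<dots> = emeasure (?P I) (Pi\<^sub>E I (\<lambda>v. {c v * t<..}))"
      using I by (intro nn_integral_indicator sets_PiM_I_finite) auto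
    also have "\<dots> = (\<Prod>v\<in>I. emeasure exp_clock {c v * t<..})"
      using I by (intro emeasure_PiM) auto
    also have "\<dots> = (\<Prod>v\<in>I. ennreal (exp (- (c v * t))))"
      using c t by (intro prod.cong emeasure_exp_clock_greater) auto
    also have "\<dots> = ennreal (exp (- (sum c I * t)))"
      using I by (simp add: prod_ennreal exp_sum[symmetric] sum_negf sum_distrib_right)
    finally show "(\<integral>\<^sup>+E. indicator ?W (E(u := t)) \<partial>?P I) = ennreal (exp (- (sum c I * t)))" .
  qed
  also have "\<dots> = ennreal (1 / (1 + sum c I))"
    using c by (intro nn_integral_exp_clock_exp sum_nonneg) auto
  finally show ?thesis
    using c by (simp add: PA.emeasure_eq_measure I_def[symmetric] sum_nonneg)
qed

text \<open>The bridge from continuous clocks to discrete choices: an image measure carried by a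
  finite set consists of atoms, hence is a pmf. After the construction of matchings the clocks no
  longer occur.\<close>

lemma pmf_of_finite_range_map:
  assumes "prob_space M" and f: "f \<in> measurable M (count_space UNIV)" and fin: "finite (f ` space M)"
  obtains F where "\<And>X. measure_pmf.prob F X = measure M (f -` X \<inter> space M)"
proof -
  interpret M: prob_space M by fact
  interpret D: prob_space "distr M (count_space UNIV) f" using f by (rule M.prob_space_distr)
  have "AE x in distr M (count_space UNIV) f. x \<in> f ` space M"
    by (subst AE_distr_iff) (use f in auto)
  then have "AE x in distr M (count_space UNIV) f. measure (distr M (count_space UNIV) f) {x} \<noteq> 0"
    using fin by (subst D.AE_support_countable) (auto intro: countable_finite)
  then have "measure_pmf (Abs_pmf (distr M (count_space UNIV) f)) = distr M (count_space UNIV) f"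
    by (intro Abs_pmf_inverse) (auto intro: D.prob_space_axioms)
  then have "measure_pmf.prob (Abs_pmf (distr M (count_space UNIV) f)) X = measure M (f -` X \<inter> space M)" for X
    using f by (simp add: measure_distr)
  then show ?thesis by (rule that)
qed

text \<open>A choice function \<open>f\<close> is the outcome of one race, read off for every law at
  once; \<open>F\<close> is thus the randomness shared by all parties. The bound is the conditional
  disagreement probability multiplied by \<open>pmf p u\<close>, which avoids conditioning on a
  possibly null event.\<close>

definition is_matching :: "'a pmf set \<Rightarrow> ('a pmf \<Rightarrow> 'a) pmf \<Rightarrow> bool" where
  "is_matching K F \<longleftrightarrow> (\<forall>p\<in>K. map_pmf (\<lambda>f. f p) F = p) \<and>
     (\<forall>p\<in>K. \<forall>q\<in>K. \<forall>u. measure_pmf.prob F {f. f p = u \<and> f q \<noteq> u} \<le> pmf p u * (pmf p u / (pmf p u + pmf q u)))"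

lemma exists_matching:
  fixes K :: "'a pmf set"
  assumes finK: "finite K" and finp: "\<And>p. p \<in> K \<Longrightarrow> finite (set_pmf p)"
  obtains F where "is_matching K F"
proof -
  define A where "A = (\<Union>p\<in>K. set_pmf p)"
  have A: "finite A" and supp: "\<And>p. p \<in> K \<Longrightarrow> set_pmf p \<subseteq> A" using finK finp by (auto simp: A_def)
  let ?M = "Pi\<^sub>M A (\<lambda>_. exp_clock)"
  interpret M: prob_space ?M by (rule prob_space_PiM) (rule prob_space_exp_clock)
  \<comment> \<open>Cross-multiplied form of \<open>E u / pmf p u < E v / pmf p v\<close>, so that
    vanishing masses cause no division. Strictness makes the winner unique; a tie has no
    winner.\<close>
  define win :: "'a pmf \<Rightarrow> ('a \<Rightarrow> real) \<Rightarrow> 'a \<Rightarrow> bool" where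
    "win p E u \<longleftrightarrow> u \<in> A \<and> pmf p u > 0 \<and> (\<forall>v\<in>A - {u}. pmf p v * E u < pmf p u * E v)" for p E u
  define a0 :: 'a where "a0 = undefined"
  define sel where "sel p E = (if \<exists>u. win p E u then (THE u. win p E u) else a0)" for p E
  have win_unique: "u = v" if "win p E u" "win p E v" for p E u v
  proof (rule ccontr)
    assume "u \<noteq> v"
    with that have "pmf p v * E u < pmf p u * E v" "pmf p u * E v < pmf p v * E u"
      by (auto simp: win_def)
    then show False by simp
  qed
  have sel_win: "sel p E = u" if "win p E u" for p E u
    using that win_unique unfolding sel_def by (metis the_equality)
  have sel_cases: "win p E (sel p E) \<or> (sel p E = a0 \<and> (\<forall>u\<in>A. \<not> win p E u))" for p E
  proof (cases "\<exists>u. win p E u")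
    case True
    then show ?thesis using sel_win by auto
  next
    case False
    then show ?thesis by (simp add: sel_def)
  qed
  have win_A: "u \<in> A" if "win p E u" for p E u
    using that by (simp add: win_def)
  have win_meas [measurable]: "{E \<in> space ?M. win p E u} \<in> sets ?M" for p u
  proof (cases "u \<in> A")
    case True
    have comp: "(\<lambda>E. E v) \<in> borel_measurable ?M" if "v \<in> A" for v
      using measurable_component_singleton[OF that, of "\<lambda>_. exp_clock"] by simp
    have "{E \<in> space ?M. pmf p v * E u < pmf p u * E v} \<in> sets ?M" if "v \<in> A" for v
      using comp[OF that] comp[OF True] by (intro borel_measurable_less borel_measurable_times) auto
    then have "{E \<in> space ?M. \<forall>v\<in>A - {u}. pmf p v * E u < pmf p u * E v} \<in> sets ?M"
      using A by (intro sets.sets_Collect_finite_All) auto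
    then show ?thesis using True by (cases "pmf p u > 0") (simp_all add: win_def)
  next
    case False
    then show ?thesis by (simp add: win_def)
  qed
  have prob_win: "M.prob {E \<in> space ?M. win p E u} = pmf p u" if p: "p \<in> K" for p u
  proof (cases "u \<in> A \<and> pmf p u > 0")
    case True
    have "{E \<in> space ?M. win p E u} = {E \<in> space ?M. \<forall>v\<in>A - {u}. (pmf p v / pmf p u) * E u < E v}"
      using True by (auto simp: win_def field_simps)
    also have "M.prob \<dots> = 1 / (1 + (\<Sum>v\<in>A - {u}. pmf p v / pmf p u))"
      using True A by (intro exp_race) auto
    also have "(\<Sum>v\<in>A - {u}. pmf p v / pmf p u) = (1 - pmf p u) / pmf p u"
      using sum_pmf_eq_1[OF A supp[OF p]] True A
      by (simp add: sum_divide_distrib[symmetric] sum_diff1)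
    also have "1 / (1 + (1 - pmf p u) / pmf p u) = pmf p u"
      using True by (simp add: field_simps)
    finally show ?thesis .
  next
    case False
    then have "pmf p u = 0"
      using supp[OF p] by (metis less_eq_real_def pmf_nonneg pmf_positive_iff subsetD)
    then show ?thesis by (simp add: win_def)
  qed
  have prob_win2: "M.prob {E \<in> space ?M. win p E u \<and> win q E u} \<ge> pmf p u * pmf q u / (pmf p u + pmf q u)"
    if p: "p \<in> K" and q: "q \<in> K" for p q u
  proof (cases "u \<in> A \<and> pmf p u > 0 \<and> pmf q u > 0")
    case True
    \<comment> \<open>With these weights \<open>u\<close> wins under both laws at once. Bounding the
      maximum by the sum bounds the denominator by \<open>1 / pmf p u + 1 / pmf q u - 1\<close>, and
      dropping the \<open>- 1\<close> gives the symmetric quotient.\<close>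
    let ?c = "\<lambda>v. max (pmf p v / pmf p u) (pmf q v / pmf q u)"
    have sum_other: "(\<Sum>v\<in>A - {u}. pmf r v / pmf r u) = (1 - pmf r u) / pmf r u"
      if "r \<in> K" "pmf r u > 0" for r
      using sum_pmf_eq_1[OF A supp[OF that(1)]] True A that
      by (simp add: sum_divide_distrib[symmetric] sum_diff1)
    have "(\<Sum>v\<in>A - {u}. ?c v) \<le> (\<Sum>v\<in>A - {u}. pmf p v / pmf p u + pmf q v / pmf q u)"
      by (intro sum_mono) simp
    also have "\<dots> = (1 - pmf p u) / pmf p u + (1 - pmf q u) / pmf q u"
      using sum_other[OF p] sum_other[OF q] True by (simp add: sum.distrib)
    finally have le: "1 + (\<Sum>v\<in>A - {u}. ?c v) \<le> 1 + (1 - pmf p u) / pmf p u + (1 - pmf q u) / pmf q u"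
      by simp
    have "pmf p u * pmf q u / (pmf p u + pmf q u) = 1 / ((pmf p u + pmf q u) / (pmf p u * pmf q u))"
      by simp
    also have "\<dots> \<le> 1 / (1 + (\<Sum>v\<in>A - {u}. ?c v))"
    proof (rule divide_left_mono)
      have "1 + (1 - pmf p u) / pmf p u + (1 - pmf q u) / pmf q u \<le> (pmf p u + pmf q u) / (pmf p u * pmf q u)"
        using True by (simp add: field_simps)
      with le show "1 + (\<Sum>v\<in>A - {u}. ?c v) \<le> (pmf p u + pmf q u) / (pmf p u * pmf q u)" by linarith
      have "(\<Sum>v\<in>A - {u}. ?c v) \<ge> 0" by (intro sum_nonneg) (auto simp: le_max_iff_disj)
      then show "0 < (pmf p u + pmf q u) / (pmf p u * pmf q u) * (1 + (\<Sum>v\<in>A - {u}. ?c v))"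
        using True by (intro mult_pos_pos divide_pos_pos) auto
    qed simp
    also have "\<dots> = M.prob {E \<in> space ?M. \<forall>v\<in>A - {u}. ?c v * E u < E v}"
      using True A by (intro exp_race[symmetric]) (auto simp: le_max_iff_disj)
    also have "\<dots> \<le> M.prob {E \<in> space ?M. win p E u \<and> win q E u}"
    proof (rule M.finite_measure_mono_AE)
      show "{E \<in> space ?M. win p E u \<and> win q E u} \<in> sets ?M" by measurable
      \<comment> \<open>Passing from the larger ratio to each single one multiplies by
        \<open>E u\<close>, whose sign is known only almost surely, since the clock measure lives on
        all reals.\<close>
      have "AE E in ?M. E u \<ge> 0"
        using True by (intro AE_PiM_component prob_space_exp_clock AE_exp_clock_nonneg) auto
      then show "AE E in ?M. E \<in> {E \<in> space ?M. \<forall>v\<in>A - {u}. ?c v * E u < E v} \<longrightarrow>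
          E \<in> {E \<in> space ?M. win p E u \<and> win q E u}"
      proof eventually_elim
        case (elim E)
        have "pmf r v * E u < pmf r u * E v"
          if "?c v * E u < E v" "pmf r v / pmf r u \<le> ?c v" "pmf r u > 0" for r v
        proof -
          have "(pmf r v / pmf r u) * E u \<le> ?c v * E u"
            using that elim by (intro mult_right_mono)
          with that(1) have "(pmf r v / pmf r u) * E u < E v" by linarith
          with that(3) show ?thesis by (simp add: field_simps)
        qed
        then show ?case using True by (auto simp: win_def)
      qed
    qed
    finally show ?thesis .
  next
    case False
    then have "pmf p u = 0 \<or> pmf q u = 0"
      using supp[OF p] by (metis less_eq_real_def pmf_nonneg pmf_positive_iff subsetD)
    then show ?thesis by auto
  qed
  \<comment> \<open>Winning events of distinct elements are disjoint and their probabilities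
    \<open>pmf p u\<close> sum to one, so ties are negligible.\<close>
  have ae_win: "AE E in ?M. \<exists>u. win p E u" if p: "p \<in> K" for p
  proof -
    have "M.prob (\<Union>u\<in>A. {E \<in> space ?M. win p E u}) = (\<Sum>u\<in>A. M.prob {E \<in> space ?M. win p E u})"
      using A by (intro M.finite_measure_finite_Union) (auto simp: disjoint_family_on_def dest: win_unique)
    also have "\<dots> = 1" using sum_pmf_eq_1[OF A supp[OF p]] by (simp add: prob_win p)
    finally have "AE E in ?M. E \<in> (\<Union>u\<in>A. {E \<in> space ?M. win p E u})"
      using A by (subst (asm) M.prob_eq_1) auto
    then show ?thesis by eventually_elim auto
  qed
  have sel_meas: "{E \<in> space ?M. sel p E = u} \<in> sets ?M" for p u
  proof -
    have "{E \<in> space ?M. sel p E = u} = {E \<in> space ?M. win p E u} \<union> {E \<in> space ?M. u = a0 \<and> (\<forall>v\<in>A. \<not> win p E v)}"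
      using sel_cases[of p] sel_win[of p] win_A[of p] by blast
    also have "\<dots> \<in> sets ?M" using A by measurable
    finally show ?thesis .
  qed
  \<comment> \<open>A fixed value outside \<open>K\<close> gives the random choice function a finite
    range.\<close>
  define h where "h E = (\<lambda>p. if p \<in> K then sel p E else undefined)" for E
  have sel_range: "sel p E \<in> insert a0 A" for p E
    using sel_cases[of p E] win_A by auto
  have h_range: "h ` space ?M \<subseteq> K \<rightarrow>\<^sub>E insert a0 A"
    unfolding h_def PiE_iff extensional_def image_subset_iff using sel_range by (simp del: insert_iff)
  have fin_range: "finite (h ` space ?M)"
    by (rule finite_subset[OF h_range]) (use finK A in \<open>auto intro!: finite_PiE\<close>)
  have h_meas: "h \<in> measurable ?M (count_space UNIV)"
  proof -
    have "h \<in> measurable ?M (count_space (h ` space ?M))"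
    proof (subst measurable_count_space_eq2[OF fin_range], intro conjI ballI)
      fix g assume "g \<in> h ` space ?M"
      then have "g p = undefined" if "p \<notin> K" for p using that by (auto simp: h_def)
      then have "h E = g \<longleftrightarrow> (\<forall>p\<in>K. sel p E = g p)" for E
        by (auto simp: h_def fun_eq_iff)
      then have "h -` {g} \<inter> space ?M = {E \<in> space ?M. \<forall>p\<in>K. sel p E = g p}" by auto
      also have "\<dots> \<in> sets ?M" using finK sel_meas by (intro sets.sets_Collect_finite_All) auto
      finally show "h -` {g} \<inter> space ?M \<in> sets ?M" .
    qed auto
    from measurable_compose[OF this, of "\<lambda>x. x" "count_space UNIV"] show ?thesis by simp
  qed
  obtain F where F: "\<And>X. measure_pmf.prob F X = measure ?M (h -` X \<inter> space ?M)"
    using pmf_of_finite_range_map[OF M.prob_space_axioms h_meas fin_range] by blast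
  have prob_sel: "M.prob {E \<in> space ?M. sel p E = u} = pmf p u" if "p \<in> K" for p u
  proof -
    have "M.prob {E \<in> space ?M. sel p E = u} = M.prob {E \<in> space ?M. win p E u}"
      using sel_meas ae_win[OF that]
      by (intro M.finite_measure_eq_AE) (auto elim!: eventually_mono dest: sel_win)
    then show ?thesis using prob_win[OF that] by simp
  qed
  show ?thesis
  proof (rule that[of F], unfold is_matching_def, intro conjI ballI allI)
    fix p assume p: "p \<in> K"
    show "map_pmf (\<lambda>f. f p) F = p"
    proof (rule pmf_eqI)
      fix u
      have "pmf (map_pmf (\<lambda>f. f p) F) u = measure_pmf.prob F {f. f p = u}"
        by (simp add: pmf_map vimage_def)
      also have "\<dots> = M.prob {E \<in> space ?M. sel p E = u}"
        unfolding F using p by (intro arg_cong[where f = M.prob]) (auto simp: h_def)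
      finally show "pmf (map_pmf (\<lambda>f. f p) F) u = pmf p u" using prob_sel[OF p] by simp
    qed
  next
    fix p q u assume p: "p \<in> K" and q: "q \<in> K"
    have "measure_pmf.prob F {f. f p = u \<and> f q \<noteq> u} = M.prob {E \<in> space ?M. sel p E = u \<and> sel q E \<noteq> u}"
      unfolding F using p q by (intro arg_cong[where f = M.prob]) (auto simp: h_def)
    also have "{E \<in> space ?M. sel p E = u \<and> sel q E \<noteq> u} =
        {E \<in> space ?M. sel p E = u} - {E \<in> space ?M. sel p E = u \<and> sel q E = u}" by auto
    also have "M.prob \<dots> = M.prob {E \<in> space ?M. sel p E = u} - M.prob {E \<in> space ?M. sel p E = u \<and> sel q E = u}"
      using sel_meas by (intro M.finite_measure_Diff) (auto intro: sets.sets_Collect_conj)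
    also have "\<dots> \<le> pmf p u - M.prob {E \<in> space ?M. win p E u \<and> win q E u}"
      using prob_sel[OF p] sel_win sel_meas
      by (auto intro!: M.finite_measure_mono intro: sets.sets_Collect_conj)
    also have "\<dots> \<le> pmf p u - pmf p u * pmf q u / (pmf p u + pmf q u)"
      using prob_win2[OF p q] by simp
    also have "\<dots> \<le> pmf p u * (pmf p u / (pmf p u + pmf q u))"
    proof (cases "pmf p u = 0")
      case False
      then have "pmf p u + pmf q u > 0" using pmf_nonneg[of p u] pmf_nonneg[of q u] by linarith
      then show ?thesis by (simp add: field_simps)
    qed simp
    finally show "measure_pmf.prob F {f. f p = u \<and> f q \<noteq> u} \<le> pmf p u * (pmf p u / (pmf p u + pmf q u))" .
  qed
qed

section \<open>Expected disagreement of two parties sharing a race, with bins and messages\<close>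

lemma nn_integral_pmf_swap:
  "(\<integral>\<^sup>+x. \<integral>\<^sup>+y. f x y \<partial>measure_pmf B \<partial>measure_pmf A) = (\<integral>\<^sup>+y. \<integral>\<^sup>+x. f x y \<partial>measure_pmf A \<partial>measure_pmf B)"
proof -
  have "(\<integral>\<^sup>+x. \<integral>\<^sup>+y. f x y \<partial>measure_pmf B \<partial>measure_pmf A) = (\<integral>\<^sup>+z. f (fst z) (snd z) \<partial>pair_pmf A B)"
    by (simp add: nn_integral_pair_pmf')
  also have "\<dots> = (\<integral>\<^sup>+y. \<integral>\<^sup>+x. f x y \<partial>measure_pmf A \<partial>measure_pmf B)"
    by (subst pair_commute_pmf) (simp add: nn_integral_pair_pmf' split_beta)
  finally show ?thesis .
qed

lemma nn_integral_pmf_component: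
  assumes "map_pmf (\<lambda>f. f p) F = p"
  shows "(\<integral>\<^sup>+f. h (f p) \<partial>measure_pmf F) = (\<integral>\<^sup>+a. h a \<partial>measure_pmf p)"
  by (subst (2) assms[symmetric]) simp

lemma nn_integral_pmf_le_const:
  assumes "\<And>x. x \<in> set_pmf p \<Longrightarrow> f x \<le> c"
  shows "(\<integral>\<^sup>+x. f x \<partial>measure_pmf p) \<le> c"
proof -
  have "(\<integral>\<^sup>+x. f x \<partial>measure_pmf p) \<le> (\<integral>\<^sup>+x. c \<partial>measure_pmf p)"
    using assms by (intro nn_integral_mono_AE) (auto simp: AE_measure_pmf_iff)
  then show ?thesis by simp
qed

lemma nn_integral_pmf_mono:
  assumes "\<And>x. x \<in> set_pmf p \<Longrightarrow> f x \<le> g x"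
  shows "(\<integral>\<^sup>+x. f x \<partial>measure_pmf p) \<le> (\<integral>\<^sup>+x. g x \<partial>measure_pmf p)"
  using assms by (intro nn_integral_mono_AE) (auto simp: AE_measure_pmf_iff)

text \<open>
  \<open>c\<close> is the factor by which binning or the message set reweights the likelihood ratio. The
  value \<open>0\<close> at \<open>c = 1\<close>, \<open>p = q\<close>, where both parties run the same race, is what makes
  description rate \<open>0\<close> usable.
\<close>

definition mismatch :: "real \<Rightarrow> 'a pmf \<Rightarrow> 'a pmf \<Rightarrow> 'a \<Rightarrow> ennreal" where
  "mismatch c p q a =
     (if c = 1 \<and> p = q then 0 else ennreal (c * pmf p a / (c * pmf p a + pmf q a)))"

lemma is_matchingD:
  assumes "is_matching K F" "p \<in> K"
  shows "map_pmf (\<lambda>f. f p) F = p" "f \<in> set_pmf F \<Longrightarrow> f p \<in> set_pmf p"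
proof -
  show 1: "map_pmf (\<lambda>f. f p) F = p" using assms by (simp add: is_matching_def)
  show "f p \<in> set_pmf p" if "f \<in> set_pmf F"
    using that by (subst 1[symmetric]) auto
qed

text \<open>
  The guess \<open>q (f p) y\<close> may depend on the selected element and on an observation \<open>y\<close>, as long
  as \<open>y\<close> depends on the race only through the selected element.
\<close>

lemma matching_conditional:
  assumes F: "is_matching K F" and p: "p \<in> K" and fin: "finite (set_pmf p)"
    and q: "\<And>a y. a \<in> set_pmf p \<Longrightarrow> q a y \<in> K"
  shows "(\<integral>\<^sup>+f. \<integral>\<^sup>+y. of_bool (f (q (f p) y) \<noteq> f p) \<partial>measure_pmf (G (f p)) \<partial>measure_pmf F)
    \<le> (\<integral>\<^sup>+a. \<integral>\<^sup>+y. mismatch 1 p (q a y) a \<partial>measure_pmf (G a) \<partial>measure_pmf p)"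
proof -
  have "(\<integral>\<^sup>+f. \<integral>\<^sup>+y. of_bool (f (q (f p) y) \<noteq> f p) \<partial>measure_pmf (G (f p)) \<partial>measure_pmf F)
     = (\<integral>\<^sup>+f. (\<Sum>a\<in>set_pmf p. \<integral>\<^sup>+y. of_bool (f p = a \<and> f (q a y) \<noteq> a) \<partial>measure_pmf (G a)) \<partial>measure_pmf F)"
  proof (rule nn_integral_cong_AE, subst AE_measure_pmf_iff, intro ballI)
    fix f assume f: "f \<in> set_pmf F"
    have "(\<Sum>a\<in>set_pmf p. \<integral>\<^sup>+y. of_bool (f p = a \<and> f (q a y) \<noteq> a) \<partial>measure_pmf (G a))
       = (\<Sum>a\<in>set_pmf p. if a = f p then \<integral>\<^sup>+y. of_bool (f (q (f p) y) \<noteq> f p) \<partial>measure_pmf (G (f p)) else 0)"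
      by (intro sum.cong) auto
    also have "\<dots> = (\<integral>\<^sup>+y. of_bool (f (q (f p) y) \<noteq> f p) \<partial>measure_pmf (G (f p)))"
      using fin is_matchingD(2)[OF F p f] by simp
    finally show "(\<integral>\<^sup>+y. of_bool (f (q (f p) y) \<noteq> f p) \<partial>measure_pmf (G (f p))) =
       (\<Sum>a\<in>set_pmf p. \<integral>\<^sup>+y. of_bool (f p = a \<and> f (q a y) \<noteq> a) \<partial>measure_pmf (G a))" ..
  qed
  \<comment> \<open>Fixing the value \<open>a\<close> of \<open>f p\<close> freezes both the law of
    \<open>y\<close> and the guess \<open>q a y\<close>. The integrals over \<open>f\<close> and
    \<open>y\<close> can then be exchanged, and the bound for two fixed laws applies for each
    \<open>y\<close>.\<close>
  also have "\<dots> = (\<Sum>a\<in>set_pmf p. \<integral>\<^sup>+f. \<integral>\<^sup>+y. of_bool (f p = a \<and> f (q a y) \<noteq> a) \<partial>measure_pmf (G a) \<partial>measure_pmf F)"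
    by (rule nn_integral_sum) auto
  also have "\<dots> = (\<Sum>a\<in>set_pmf p. \<integral>\<^sup>+y. \<integral>\<^sup>+f. of_bool (f p = a \<and> f (q a y) \<noteq> a) \<partial>measure_pmf F \<partial>measure_pmf (G a))"
    by (subst nn_integral_pmf_swap) simp
  also have "\<dots> \<le> (\<Sum>a\<in>set_pmf p. \<integral>\<^sup>+y. ennreal (pmf p a) * mismatch 1 p (q a y) a \<partial>measure_pmf (G a))"
  proof (intro sum_mono nn_integral_pmf_mono)
    fix a y assume a: "a \<in> set_pmf p"
    have "(\<integral>\<^sup>+f. of_bool (f p = a \<and> f (q a y) \<noteq> a) \<partial>measure_pmf F) = (\<integral>\<^sup>+f. indicator {f. f p = a \<and> f (q a y) \<noteq> a} f \<partial>measure_pmf F)"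
      by (intro nn_integral_cong) (auto split: split_indicator)
    also have "\<dots> = emeasure (measure_pmf F) {f. f p = a \<and> f (q a y) \<noteq> a}" by simp
    also have "\<dots> \<le> ennreal (pmf p a) * mismatch 1 p (q a y) a"
    proof (cases "p = q a y")
      \<comment> \<open>Equal laws select the same element; without the special value of
        \<open>mismatch\<close> the bound here would be one half.\<close>
      case True
      then have empty: "{f. f p = a \<and> f (q a y) \<noteq> a} = {}" by auto
      show ?thesis unfolding empty by simp
    next
      case False
      have "measure_pmf.prob F {f. f p = a \<and> f (q a y) \<noteq> a} \<le> pmf p a * (pmf p a / (pmf p a + pmf (q a y) a))"
        using F p q[OF a] by (simp add: is_matching_def)
      then show ?thesis using False
        by (simp add: mismatch_def measure_pmf.emeasure_eq_measure ennreal_mult[symmetric])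
    qed
    finally show "(\<integral>\<^sup>+f. of_bool (f p = a \<and> f (q a y) \<noteq> a) \<partial>measure_pmf F) \<le> ennreal (pmf p a) * mismatch 1 p (q a y) a" .
  qed
  also have "\<dots> = (\<Sum>a\<in>set_pmf p. (\<integral>\<^sup>+y. mismatch 1 p (q a y) a \<partial>measure_pmf (G a)) * ennreal (pmf p a))"
    by (subst nn_integral_cmult) (auto simp: mult.commute)
  also have "\<dots> = (\<integral>\<^sup>+a. \<integral>\<^sup>+y. mismatch 1 p (q a y) a \<partial>measure_pmf (G a) \<partial>measure_pmf p)"
    using fin by (subst nn_integral_measure_pmf_finite) auto
  finally show ?thesis .
qed

text \<open>The selected element carries an independent uniform bin index, and the guesser, told the
  index \<open>m\<close>, races with that index fixed. Its law is more concentrated than the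
  sender's by the factor \<open>B\<close>, which puts \<open>1 / B\<close> on the likelihood ratio.
  With a single bin, equality of the laws survives the pairing.\<close>

lemma mismatch_pair_return_right:
  assumes "m \<in> {1..B}"
  shows "mismatch 1 (pair_pmf p (pmf_of_set {1..B})) (pair_pmf q (return_pmf m)) (v, m) \<le> mismatch (1 / real B) p q v"
proof (cases "B = 1 \<and> p = q")
  case True
  then have "pair_pmf p (pmf_of_set {1..B}) = pair_pmf q (return_pmf m)"
    using assms by (simp add: pmf_of_set_singleton)
  then show ?thesis by (simp add: mismatch_def)
next
  case False
  then have *: "\<not> (1 / real B = 1 \<and> p = q)" using assms by auto
  show ?thesis unfolding mismatch_def[of "1 / real B"] if_not_P[OF *]
    using assms by (auto simp: mismatch_def pmf_pair)
qed

text \<open>The roles are reversed for the message: the encoder fixes the second coordinate and the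
  decoder leaves it uniform, so the likelihood ratio grows by the factor \<open>M\<close>.\<close>

lemma mismatch_pair_return_left:
  assumes "w \<in> {1..M}"
  shows "mismatch 1 (pair_pmf p (return_pmf w)) (pair_pmf q (pmf_of_set {1..M})) (u, w) \<le> mismatch (real M) p q u"
proof (cases "M = 1 \<and> p = q")
  case True
  then have "pair_pmf p (return_pmf w) = pair_pmf q (pmf_of_set {1..M})"
    using assms by (simp add: pmf_of_set_singleton)
  then show ?thesis by (simp add: mismatch_def)
next
  case False
  then have *: "\<not> (real M = 1 \<and> p = q)" using assms by auto
  have M: "real M > 0" using assms by simp
  have "pmf p u / (pmf p u + pmf q u / real M) = real M * pmf p u / (real M * pmf p u + pmf q u)"
  proof -
    have "real M * pmf p u + pmf q u = real M * (pmf p u + pmf q u / real M)"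
      using M by (simp add: field_simps)
    then show ?thesis using M by simp
  qed
  then show ?thesis unfolding mismatch_def[of "real M"] if_not_P[OF *]
    using assms by (auto simp: mismatch_def pmf_pair)
qed

section \<open>One-shot code\<close>

lemma nn_integral_pmf_exists_le:
  assumes "(\<integral>\<^sup>+x. g x \<partial>measure_pmf p) \<le> c"
  shows "\<exists>x\<in>set_pmf p. g x \<le> c"
proof (rule ccontr)
  assume "\<not> ?thesis"
  then have gt: "\<And>x. x \<in> set_pmf p \<Longrightarrow> c < g x" by auto
  obtain x0 where "x0 \<in> set_pmf p" using set_pmf_not_empty[of p] by auto
  with gt have c: "c \<noteq> \<infinity>" by fastforce
  have "(\<integral>\<^sup>+x. c \<partial>measure_pmf p) < (\<integral>\<^sup>+x. g x \<partial>measure_pmf p)"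
  proof (rule nn_integral_less)
    show "\<not> (AE x in measure_pmf p. g x \<le> c)"
      using gt \<open>x0 \<in> set_pmf p\<close> by (auto simp: AE_measure_pmf_iff not_le)
  qed (use gt c in \<open>auto simp: AE_measure_pmf_iff less_imp_le\<close>)
  with assms show False by simp
qed

text \<open>Kernels on blocks take arguments from infinite function types, yet only finitely many
  laws occur among their values. Finitely many laws of finite support are what a race
  requires.\<close>

definition finite_kernel :: "('a \<Rightarrow> 'b pmf) \<Rightarrow> bool" where
  "finite_kernel k \<longleftrightarrow> finite (range k) \<and> (\<forall>x. finite (set_pmf (k x)))"

text \<open>Laws from \<open>P\<close> are paired with a uniform index, laws from \<open>Q\<close>
  with a known one. For a description the party producing the index uses \<open>P\<close>; for the
  message it is the decoder.\<close>

definition bin_family :: "'a pmf set \<Rightarrow> 'a pmf set \<Rightarrow> nat \<Rightarrow> ('a \<times> nat) pmf set" where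
  "bin_family P Q N = (\<lambda>p. pair_pmf p (pmf_of_set {1..N})) ` P \<union>
     (\<lambda>(p, m). pair_pmf p (return_pmf m)) ` (Q \<times> {1..N})"

lemma bin_family_memI:
  "p \<in> P \<Longrightarrow> pair_pmf p (pmf_of_set {1..N}) \<in> bin_family P Q N"
  "p \<in> Q \<Longrightarrow> m \<in> {1..N} \<Longrightarrow> pair_pmf p (return_pmf m) \<in> bin_family P Q N"
  by (auto simp: bin_family_def)

lemma exists_matching_bin_family:
  assumes "finite_kernel k" "finite_kernel k'" and N: "N \<ge> 1"
  obtains F where "is_matching (bin_family (range k) (range k') N) F"
proof (rule exists_matching)
  show "finite (bin_family (range k) (range k') N)"
    using assms by (simp add: bin_family_def finite_kernel_def)
  show "finite (set_pmf p)" if "p \<in> bin_family (range k) (range k') N" for p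
    using that assms N by (auto simp: bin_family_def finite_kernel_def set_pmf_of_set)
qed

text \<open>The error is averaged over four independent matchings, and some realisation does at
  least as well as the average; fixing it yields deterministic maps. A description is the bin index
  of the selected pair. The support condition on \<open>e\<close> will show that codewords are
  extensional sequences.\<close>

lemma one_shot_code:
  fixes PS :: "('s1 \<times> 's2) pmf" and W :: "'x \<Rightarrow> 's1 \<Rightarrow> 's2 \<Rightarrow> 'y pmf"
    and KV1 :: "'s1 \<Rightarrow> 'v1 pmf" and KV2 :: "'s2 \<Rightarrow> 'v2 pmf"
    and KU :: "'s1 \<Rightarrow> 'v1 \<Rightarrow> 'v2 \<Rightarrow> 'u pmf" and KX :: "'u \<Rightarrow> 's1 \<Rightarrow> 'v1 \<Rightarrow> 'v2 \<Rightarrow> 'x pmf"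
    and dV1 :: "'y \<Rightarrow> 's2 \<Rightarrow> 'v2 \<Rightarrow> 'v1 pmf" and eV2 :: "'s1 \<Rightarrow> 'v2 pmf"
    and dU :: "'y \<Rightarrow> 's2 \<Rightarrow> 'v1 \<Rightarrow> 'v2 \<Rightarrow> 'u pmf"
    and M B1 B2 :: nat
  assumes pos: "M \<ge> 1" "B1 \<ge> 1" "B2 \<ge> 1"
    and fin: "finite_kernel KV1" "finite_kernel KV2" "finite_kernel eV2"
      "finite_kernel (\<lambda>(s1, v1, v2). KU s1 v1 v2)" "finite_kernel (\<lambda>(u, s1, v1, v2). KX u s1 v1 v2)"
      "finite_kernel (\<lambda>(y, s2, v2). dV1 y s2 v2)" "finite_kernel (\<lambda>(y, s2, v1, v2). dU y s2 v1 v2)"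
  obtains e :: "nat \<Rightarrow> 's1 \<Rightarrow> nat \<Rightarrow> 'x" and d :: "'y \<Rightarrow> 's2 \<Rightarrow> nat \<Rightarrow> nat"
    and k1 :: "'s1 \<Rightarrow> nat" and k2 :: "'s2 \<Rightarrow> nat"
  where "\<And>s1. k1 s1 \<in> {1..B1}" "\<And>s2. k2 s2 \<in> {1..B2}"
    "\<And>w s1 m. w \<in> {1..M} \<Longrightarrow> m \<in> {1..B2} \<Longrightarrow> \<exists>u v1 v2. e w s1 m \<in> set_pmf (KX u s1 v1 v2)"
    "\<And>y s2 m. m \<in> {1..B1} \<Longrightarrow> d y s2 m \<in> {1..M}"
    "(\<Sum>w=1..M. \<integral>\<^sup>+s. \<integral>\<^sup>+y. of_bool (d y (snd s) (k1 (fst s)) \<noteq> w)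
        \<partial>measure_pmf (W (e w (fst s) (k2 (snd s))) (fst s) (snd s)) \<partial>measure_pmf PS)
     \<le> of_nat M *
       ((\<integral>\<^sup>+(s1, s2, v1, v2, u, x, y). mismatch (1 / real B1) (KV1 s1) (dV1 y s2 v2) v1
           \<partial>measure_pmf (joint_law PS W KV1 KV2 KU KX)) +
        (\<integral>\<^sup>+(s1, s2, v1, v2, u, x, y). mismatch (1 / real B2) (KV2 s2) (eV2 s1) v2
           \<partial>measure_pmf (joint_law PS W KV1 KV2 KU KX)) +
        (\<integral>\<^sup>+(s1, s2, v1, v2, u, x, y). mismatch (real M) (KU s1 v1 v2) (dU y s2 v1 v2) u
           \<partial>measure_pmf (joint_law PS W KV1 KV2 KU KX)))"
proof -
  \<comment> \<open>The \<open>pr\<close> laws belong to the party that generates a choice, the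
    \<open>gu\<close> laws to the party that reproduces it. The second coordinate is the bin index,
    or the message in \<open>pr3\<close> and \<open>gu3\<close>.\<close>
  define pr1 where "pr1 s1 = pair_pmf (KV1 s1) (pmf_of_set {1..B1})" for s1
  define pr2 where "pr2 s2 = pair_pmf (KV2 s2) (pmf_of_set {1..B2})" for s2
  define pr3 where "pr3 w s1 v1 v2 = pair_pmf (KU s1 v1 v2) (return_pmf w)" for w :: nat and s1 v1 v2
  define gu1 where "gu1 m y s2 v2 = pair_pmf (dV1 y s2 v2) (return_pmf m)" for m :: nat and y s2 v2
  define gu2 where "gu2 m s1 = pair_pmf (eV2 s1) (return_pmf m)" for m :: nat and s1
  define gu3 where "gu3 y s2 v1 v2 = pair_pmf (dU y s2 v1 v2) (pmf_of_set {1..M})" for y s2 v1 v2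
  define K1 where "K1 = bin_family (range KV1) (range (\<lambda>(y, s2, v2). dV1 y s2 v2)) B1"
  define K2 where "K2 = bin_family (range KV2) (range eV2) B2"
  define K3 where "K3 = bin_family (range (\<lambda>(y, s2, v1, v2). dU y s2 v1 v2)) (range (\<lambda>(s1, v1, v2). KU s1 v1 v2)) M"
  define KXs where "KXs = range (\<lambda>(u, s1, v1, v2). KX u s1 v1 v2)"
  obtain F1 where F1: "is_matching K1 F1"
    using exists_matching_bin_family[OF fin(1,6) pos(2)] unfolding K1_def by metis
  obtain F2 where F2: "is_matching K2 F2"
    using exists_matching_bin_family[OF fin(2,3) pos(3)] unfolding K2_def by metis
  obtain F3 where F3: "is_matching K3 F3"
    using exists_matching_bin_family[OF fin(7,4) pos(1)] unfolding K3_def by metis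
  \<comment> \<open>Of this matching only the marginals and supports matter: it turns the stochastic
    input kernel into a random function that can be fixed like the races.\<close>
  obtain FX where FX: "is_matching KXs FX"
    using exists_matching[of KXs] fin(5) unfolding KXs_def finite_kernel_def by blast
  have dV1_range: "dV1 y s2 v2 \<in> range (\<lambda>(y, s2, v2). dV1 y s2 v2)" for y s2 v2
    by (rule range_eqI[of _ _ "(y, s2, v2)"]) simp
  have dU_range: "dU y s2 v1 v2 \<in> range (\<lambda>(y, s2, v1, v2). dU y s2 v1 v2)" for y s2 v1 v2
    by (rule range_eqI[of _ _ "(y, s2, v1, v2)"]) simp
  have KU_range: "KU s1 v1 v2 \<in> range (\<lambda>(s1, v1, v2). KU s1 v1 v2)" for s1 v1 v2
    by (rule range_eqI[of _ _ "(s1, v1, v2)"]) simp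
  have KX_in: "KX u s1 v1 v2 \<in> KXs" for u s1 v1 v2
    unfolding KXs_def by (rule range_eqI[of _ _ "(u, s1, v1, v2)"]) simp
  have mem: "pr1 s1 \<in> K1" "pr2 s2 \<in> K2" "gu3 y s2 v1 v2 \<in> K3"
      "m1 \<in> {1..B1} \<Longrightarrow> gu1 m1 y s2 v2 \<in> K1" "m2 \<in> {1..B2} \<Longrightarrow> gu2 m2 s1 \<in> K2"
      "w \<in> {1..M} \<Longrightarrow> pr3 w s1 v1 v2 \<in> K3" for s1 s2 y v1 v2 m1 m2 w
    unfolding pr1_def pr2_def gu3_def gu1_def gu2_def pr3_def K1_def K2_def K3_def
    by (rule bin_family_memI; use dV1_range dU_range KU_range in auto)+
  have fin_pr: "finite (set_pmf (pr1 s1))" "finite (set_pmf (pr2 s2))" "finite (set_pmf (pr3 w s1 v1 v2))"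
    for s1 s2 w v1 v2
    using fin pos by (auto simp: pr1_def pr2_def pr3_def finite_kernel_def set_pmf_of_set)
  have snd_pr: "a1 \<in> set_pmf (pr1 s1) \<Longrightarrow> snd a1 \<in> {1..B1}" "a2 \<in> set_pmf (pr2 s2) \<Longrightarrow> snd a2 \<in> {1..B2}"
      "a3 \<in> set_pmf (gu3 y s2 v1 v2) \<Longrightarrow> snd a3 \<in> {1..M}" "a4 \<in> set_pmf (pr3 w s1 v1 v2) \<Longrightarrow> snd a4 = w"
    for a1 a2 a3 a4 w s1 s2 v1 v2 y
    using pos by (auto simp: pr1_def pr2_def pr3_def gu3_def set_pmf_of_set)
  define enc' where "enc' f1 f2 f3 fx w s1 m =
     (let v1 = fst (f1 (pr1 s1)); v2 = fst (f2 (gu2 m s1)); u = fst (f3 (pr3 w s1 v1 v2)) in fx (KX u s1 v1 v2))"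
    for f1 :: "('v1 \<times> nat) pmf \<Rightarrow> 'v1 \<times> nat" and f2 :: "('v2 \<times> nat) pmf \<Rightarrow> 'v2 \<times> nat" and f3 :: "('u \<times> nat) pmf \<Rightarrow> 'u \<times> nat" and fx :: "'x pmf \<Rightarrow> 'x" and w s1 m
  define dec' where "dec' f1 f2 f3 y s2 m =
     (let v2 = fst (f2 (pr2 s2)); v1 = fst (f1 (gu1 m y s2 v2)) in snd (f3 (gu3 y s2 v1 v2)))"
    for f1 :: "('v1 \<times> nat) pmf \<Rightarrow> 'v1 \<times> nat" and f2 :: "('v2 \<times> nat) pmf \<Rightarrow> 'v2 \<times> nat" and f3 :: "('u \<times> nat) pmf \<Rightarrow> 'u \<times> nat" and y s2 m
  define er where "er w s1 s2 f1 f2 f3 fx = (\<integral>\<^sup>+y. of_bool (dec' f1 f2 f3 y s2 (snd (f1 (pr1 s1))) \<noteq> w)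
        \<partial>measure_pmf (W (enc' f1 f2 f3 fx w s1 (snd (f2 (pr2 s2)))) s1 s2))" for w s1 s2
    and f1 :: "('v1 \<times> nat) pmf \<Rightarrow> 'v1 \<times> nat" and f2 :: "('v2 \<times> nat) pmf \<Rightarrow> 'v2 \<times> nat" and f3 :: "('u \<times> nat) pmf \<Rightarrow> 'u \<times> nat" and fx :: "'x pmf \<Rightarrow> 'x"
  define t1 where "t1 s1 s2 = (\<integral>\<^sup>+v2. \<integral>\<^sup>+v1. \<integral>\<^sup>+u. \<integral>\<^sup>+x. \<integral>\<^sup>+y. mismatch (1 / real B1) (KV1 s1) (dV1 y s2 v2) v1
     \<partial>W x s1 s2 \<partial>KX u s1 v1 v2 \<partial>KU s1 v1 v2 \<partial>KV1 s1 \<partial>KV2 s2)" for s1 s2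
  define t2 where "t2 s1 s2 = (\<integral>\<^sup>+v2. mismatch (1 / real B2) (KV2 s2) (eV2 s1) v2 \<partial>KV2 s2)" for s1 s2
  define t3 where "t3 s1 s2 = (\<integral>\<^sup>+v1. \<integral>\<^sup>+v2. \<integral>\<^sup>+u. \<integral>\<^sup>+x. \<integral>\<^sup>+y. mismatch (real M) (KU s1 v1 v2) (dU y s2 v1 v2) u
     \<partial>W x s1 s2 \<partial>KX u s1 v1 v2 \<partial>KU s1 v1 v2 \<partial>KV2 s2 \<partial>KV1 s1)" for s1 s2
  note marg1 = nn_integral_pmf_component[OF is_matchingD(1)[OF F1 mem(1)]]
  note marg2 = nn_integral_pmf_component[OF is_matchingD(1)[OF F2 mem(2)]]
  note marg3 = nn_integral_pmf_component[OF is_matchingD(1)[OF F3 mem(6)]]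
  note margX = nn_integral_pmf_component[OF is_matchingD(1)[OF FX KX_in]]

  \<comment> \<open>The input that would be sent if the encoder had the true \<open>v2\<close>. It
    depends on each race only through the intended selection, as \<open>matching_conditional\<close>
    demands; the actual input also involves \<open>f2\<close> at the encoder's guess law.\<close>
  define x_id where "x_id f1 f2 f3 fx w s1 s2 =
     (let v1 = fst (f1 (pr1 s1)); v2 = fst (f2 (pr2 s2)) in fx (KX (fst (f3 (pr3 w s1 v1 v2))) s1 v1 v2))"
    for f1 :: "('v1 \<times> nat) pmf \<Rightarrow> 'v1 \<times> nat" and f2 :: "('v2 \<times> nat) pmf \<Rightarrow> 'v2 \<times> nat" and f3 :: "('u \<times> nat) pmf \<Rightarrow> 'u \<times> nat" and fx :: "'x pmf \<Rightarrow> 'x" and w s1 s2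
  define E1 where "E1 w s1 s2 f1 f2 f3 fx = (\<integral>\<^sup>+y. of_bool (f1 (gu1 (snd (f1 (pr1 s1))) y s2 (fst (f2 (pr2 s2)))) \<noteq> f1 (pr1 s1))
     \<partial>measure_pmf (W (x_id f1 f2 f3 fx w s1 s2) s1 s2))"
    for w s1 s2 and f1 :: "('v1 \<times> nat) pmf \<Rightarrow> 'v1 \<times> nat" and f2 :: "('v2 \<times> nat) pmf \<Rightarrow> 'v2 \<times> nat" and f3 :: "('u \<times> nat) pmf \<Rightarrow> 'u \<times> nat" and fx :: "'x pmf \<Rightarrow> 'x"
  define E2 where "E2 s1 s2 f2 = (of_bool (f2 (gu2 (snd (f2 (pr2 s2))) s1) \<noteq> f2 (pr2 s2)) :: ennreal)" for s1 s2 and f2 :: "('v2 \<times> nat) pmf \<Rightarrow> 'v2 \<times> nat"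
  define E3 where "E3 w s1 s2 f1 f2 f3 fx = (\<integral>\<^sup>+y. of_bool
       (f3 (gu3 y s2 (fst (f1 (pr1 s1))) (fst (f2 (pr2 s2)))) \<noteq> f3 (pr3 w s1 (fst (f1 (pr1 s1))) (fst (f2 (pr2 s2)))))
     \<partial>measure_pmf (W (x_id f1 f2 f3 fx w s1 s2) s1 s2))"
    for w s1 s2 and f1 :: "('v1 \<times> nat) pmf \<Rightarrow> 'v1 \<times> nat" and f2 :: "('v2 \<times> nat) pmf \<Rightarrow> 'v2 \<times> nat" and f3 :: "('u \<times> nat) pmf \<Rightarrow> 'u \<times> nat" and fx :: "'x pmf \<Rightarrow> 'x"

  \<comment> \<open>If the encoder's reproduction of \<open>v2\<close> fails, the error is bounded
    by one, which is \<open>E2\<close>. Otherwise the input is \<open>x_id\<close>, and a wrong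
    message requires a disagreement in the first or third race, because the encoder's third
    selection carries the message \<open>w\<close>.\<close>
  have er_le: "er w s1 s2 f1 f2 f3 fx \<le> E1 w s1 s2 f1 f2 f3 fx + E2 s1 s2 f2 + E3 w s1 s2 f1 f2 f3 fx"
    if f3: "f3 \<in> set_pmf F3" and w: "w \<in> {1..M}" for w s1 s2 f1 f2 f3 fx
  proof (cases "f2 (gu2 (snd (f2 (pr2 s2))) s1) = f2 (pr2 s2)")
    case True
    have w_eq: "snd (f3 (pr3 w s1 v1 v2)) = w" for v1 v2
      using is_matchingD(2)[OF F3 mem(6)[OF w] f3] by (rule snd_pr(4))
    have enc_eq: "enc' f1 f2 f3 fx w s1 (snd (f2 (pr2 s2))) = x_id f1 f2 f3 fx w s1 s2"
      using True by (simp add: enc'_def x_id_def Let_def)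
    have "er w s1 s2 f1 f2 f3 fx \<le> (\<integral>\<^sup>+y.
         of_bool (f1 (gu1 (snd (f1 (pr1 s1))) y s2 (fst (f2 (pr2 s2)))) \<noteq> f1 (pr1 s1)) +
         of_bool (f3 (gu3 y s2 (fst (f1 (pr1 s1))) (fst (f2 (pr2 s2)))) \<noteq> f3 (pr3 w s1 (fst (f1 (pr1 s1))) (fst (f2 (pr2 s2)))))
       \<partial>measure_pmf (W (x_id f1 f2 f3 fx w s1 s2) s1 s2))"
      unfolding er_def enc_eq
      by (intro nn_integral_mono) (auto simp: dec'_def Let_def w_eq of_bool_def)
    also have "\<dots> = E1 w s1 s2 f1 f2 f3 fx + E3 w s1 s2 f1 f2 f3 fx"
      unfolding E1_def E3_def by (rule nn_integral_add) auto
    finally show ?thesis using True by (simp add: E2_def)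
  next
    case False
    have "er w s1 s2 f1 f2 f3 fx \<le> 1"
      unfolding er_def by (intro nn_integral_pmf_le_const) (auto simp: of_bool_def)
    also have "\<dots> = E2 s1 s2 f2" using False by (simp add: E2_def)
    finally show ?thesis by (simp add: add_increasing add_increasing2)
  qed

  have I2: "(\<integral>\<^sup>+f2. E2 s1 s2 f2 \<partial>F2) \<le> t2 s1 s2" for s1 s2
  proof -
    have "(\<integral>\<^sup>+f2. E2 s1 s2 f2 \<partial>F2) =
        (\<integral>\<^sup>+f2. \<integral>\<^sup>+y. of_bool (f2 (gu2 (snd (f2 (pr2 s2))) s1) \<noteq> f2 (pr2 s2)) \<partial>return_pmf () \<partial>F2)"
      by (simp add: E2_def)
    also have "\<dots> \<le> (\<integral>\<^sup>+a. \<integral>\<^sup>+y. mismatch 1 (pr2 s2) (gu2 (snd a) s1) a \<partial>return_pmf () \<partial>pr2 s2)"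
      by (rule matching_conditional[OF F2 mem(2) fin_pr(2), where q = "\<lambda>a y. gu2 (snd a) s1" and G = "\<lambda>_. return_pmf ()"])
        (intro mem(5) snd_pr(2))
    also have "\<dots> \<le> (\<integral>\<^sup>+a. mismatch (1 / real B2) (KV2 s2) (eV2 s1) (fst a) \<partial>pr2 s2)"
    proof (rule nn_integral_pmf_mono)
      fix a assume "a \<in> set_pmf (pr2 s2)"
      then have "snd a \<in> {1..B2}" by (rule snd_pr)
      from mismatch_pair_return_right[OF this, of "KV2 s2" "eV2 s1" "fst a"]
      show "(\<integral>\<^sup>+y. mismatch 1 (pr2 s2) (gu2 (snd a) s1) a \<partial>return_pmf ()) \<le> mismatch (1 / real B2) (KV2 s2) (eV2 s1) (fst a)"
        by (simp add: pr2_def gu2_def)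
    qed
    also have "\<dots> = t2 s1 s2"
      by (simp add: pr2_def nn_integral_pair_pmf' t2_def)
    finally show ?thesis .
  qed

  \<comment> \<open>\<open>f1\<close> is integrated innermost: for fixed \<open>f2\<close>,
    \<open>f3\<close> and \<open>fx\<close> the output law depends on \<open>f1\<close> through
    \<open>f1 (pr1 s1)\<close> alone. The remaining integrals then replace each selection by its
    marginal law.\<close>
  have I1: "(\<integral>\<^sup>+f2. \<integral>\<^sup>+f3. \<integral>\<^sup>+fx. \<integral>\<^sup>+f1. E1 w s1 s2 f1 f2 f3 fx \<partial>F1 \<partial>FX \<partial>F3 \<partial>F2) \<le> t1 s1 s2"
    if w: "w \<in> {1..M}" for w s1 s2
  proof -
    \<comment> \<open>\<open>G\<close> reads only the first coordinate of \<open>a\<close>; the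
      index \<open>0\<close> given to it below is a placeholder.\<close>
    define G where "G f2 f3 fx a = W (fx (KX (fst (f3 (pr3 w s1 (fst a) (fst (f2 (pr2 s2)))))) s1 (fst a) (fst (f2 (pr2 s2))))) s1 s2"
      for f2 :: "('v2 \<times> nat) pmf \<Rightarrow> 'v2 \<times> nat" and f3 :: "('u \<times> nat) pmf \<Rightarrow> 'u \<times> nat" and fx :: "'x pmf \<Rightarrow> 'x" and a :: "'v1 \<times> nat"
    define mm where "mm v2 y v1 = mismatch (1 / real B1) (KV1 s1) (dV1 y s2 v2) v1" for v2 y v1
    have "(\<integral>\<^sup>+f1. E1 w s1 s2 f1 f2 f3 fx \<partial>F1) \<le> (\<integral>\<^sup>+v1. \<integral>\<^sup>+y. mm (fst (f2 (pr2 s2))) y v1 \<partial>G f2 f3 fx (v1, 0) \<partial>KV1 s1)" for f2 f3 fx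
    proof -
      have "(\<integral>\<^sup>+f1. E1 w s1 s2 f1 f2 f3 fx \<partial>F1) =
        (\<integral>\<^sup>+f1. \<integral>\<^sup>+y. of_bool (f1 (gu1 (snd (f1 (pr1 s1))) y s2 (fst (f2 (pr2 s2)))) \<noteq> f1 (pr1 s1))
           \<partial>G f2 f3 fx (f1 (pr1 s1)) \<partial>F1)"
        by (simp add: E1_def G_def x_id_def Let_def)
      also have "\<dots> \<le> (\<integral>\<^sup>+a. \<integral>\<^sup>+y. mismatch 1 (pr1 s1) (gu1 (snd a) y s2 (fst (f2 (pr2 s2)))) a \<partial>G f2 f3 fx a \<partial>pr1 s1)"
        by (rule matching_conditional[OF F1 mem(1) fin_pr(1), where q = "\<lambda>a y. gu1 (snd a) y s2 (fst (f2 (pr2 s2)))"])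
          (intro mem(4) snd_pr(1))
      also have "\<dots> \<le> (\<integral>\<^sup>+a. \<integral>\<^sup>+y. mm (fst (f2 (pr2 s2))) y (fst a) \<partial>G f2 f3 fx (fst a, 0) \<partial>pr1 s1)"
      proof (rule nn_integral_pmf_mono)
        fix a assume "a \<in> set_pmf (pr1 s1)"
        then have "snd a \<in> {1..B1}" by (rule snd_pr)
        from mismatch_pair_return_right[OF this, of "KV1 s1" _ "fst a"]
        show "(\<integral>\<^sup>+y. mismatch 1 (pr1 s1) (gu1 (snd a) y s2 (fst (f2 (pr2 s2)))) a \<partial>G f2 f3 fx a)
            \<le> (\<integral>\<^sup>+y. mm (fst (f2 (pr2 s2))) y (fst a) \<partial>G f2 f3 fx (fst a, 0))"
          by (auto simp: pr1_def gu1_def mm_def G_def intro!: nn_integral_mono)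
      qed
      also have "\<dots> = (\<integral>\<^sup>+v1. \<integral>\<^sup>+y. mm (fst (f2 (pr2 s2))) y v1 \<partial>G f2 f3 fx (v1, 0) \<partial>KV1 s1)"
        by (simp add: pr1_def nn_integral_pair_pmf')
      finally show ?thesis .
    qed
    then have "(\<integral>\<^sup>+f2. \<integral>\<^sup>+f3. \<integral>\<^sup>+fx. \<integral>\<^sup>+f1. E1 w s1 s2 f1 f2 f3 fx \<partial>F1 \<partial>FX \<partial>F3 \<partial>F2) \<le>
       (\<integral>\<^sup>+f2. \<integral>\<^sup>+f3. \<integral>\<^sup>+fx. \<integral>\<^sup>+v1. \<integral>\<^sup>+y. mm (fst (f2 (pr2 s2))) y v1 \<partial>G f2 f3 fx (v1, 0) \<partial>KV1 s1 \<partial>FX \<partial>F3 \<partial>F2)"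
      by (intro nn_integral_mono)
    also have "\<dots> = (\<integral>\<^sup>+f2. \<integral>\<^sup>+v1. \<integral>\<^sup>+f3. \<integral>\<^sup>+fx. \<integral>\<^sup>+y. mm (fst (f2 (pr2 s2))) y v1 \<partial>G f2 f3 fx (v1, 0) \<partial>FX \<partial>F3 \<partial>KV1 s1 \<partial>F2)"
      by (subst nn_integral_pmf_swap[where A = FX and B = "KV1 s1"], subst nn_integral_pmf_swap[where A = F3 and B = "KV1 s1"]) simp
    also have "\<dots> = (\<integral>\<^sup>+f2. \<integral>\<^sup>+v1. \<integral>\<^sup>+f3. (\<lambda>u. \<integral>\<^sup>+x. \<integral>\<^sup>+y. mm (fst (f2 (pr2 s2))) y v1 \<partial>W x s1 s2
         \<partial>KX (fst u) s1 v1 (fst (f2 (pr2 s2)))) (f3 (pr3 w s1 v1 (fst (f2 (pr2 s2))))) \<partial>F3 \<partial>KV1 s1 \<partial>F2)"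
    proof (rule nn_integral_cong, rule nn_integral_cong, rule nn_integral_cong)
      fix f2 :: "('v2 \<times> nat) pmf \<Rightarrow> 'v2 \<times> nat" and v1 and f3 :: "('u \<times> nat) pmf \<Rightarrow> 'u \<times> nat"
      let ?v2 = "fst (f2 (pr2 s2))"
      show "(\<integral>\<^sup>+fx. \<integral>\<^sup>+y. mm ?v2 y v1 \<partial>G f2 f3 fx (v1, 0) \<partial>FX) =
          (\<lambda>u. \<integral>\<^sup>+x. \<integral>\<^sup>+y. mm ?v2 y v1 \<partial>W x s1 s2 \<partial>KX (fst u) s1 v1 ?v2) (f3 (pr3 w s1 v1 ?v2))"
        unfolding G_def fst_conv by (rule margX[where h = "\<lambda>x. \<integral>\<^sup>+y. mm ?v2 y v1 \<partial>W x s1 s2"])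
    qed
    also have "\<dots> = (\<integral>\<^sup>+f2. (\<lambda>a. \<integral>\<^sup>+v1. \<integral>\<^sup>+u. \<integral>\<^sup>+x. \<integral>\<^sup>+y. mm (fst a) y v1 \<partial>W x s1 s2
         \<partial>KX u s1 v1 (fst a) \<partial>KU s1 v1 (fst a) \<partial>KV1 s1) (f2 (pr2 s2)) \<partial>F2)"
      by (intro nn_integral_cong, subst marg3[OF w]) (simp add: pr3_def nn_integral_pair_pmf')
    also have "\<dots> = t1 s1 s2"
      by (subst marg2) (simp add: pr2_def nn_integral_pair_pmf' t1_def mm_def)
    finally show ?thesis .
  qed

  \<comment> \<open>The third race uses the true \<open>v1\<close> and \<open>v2\<close>, so
    \<open>f1\<close> and \<open>f2\<close> stay fixed outside. Averaging over \<open>fx\<close>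
    inside makes the output law, given the selected pair, the mixture of \<open>W x s1 s2\<close>
    over the input kernel.\<close>
  have I3: "(\<integral>\<^sup>+f1. \<integral>\<^sup>+f2. \<integral>\<^sup>+f3. \<integral>\<^sup>+fx. E3 w s1 s2 f1 f2 f3 fx \<partial>FX \<partial>F3 \<partial>F2 \<partial>F1) \<le> t3 s1 s2"
    if w: "w \<in> {1..M}" for w s1 s2
  proof -
    define mm where "mm v1 v2 y u = mismatch (real M) (KU s1 v1 v2) (dU y s2 v1 v2) u" for v1 v2 y u
    have "(\<integral>\<^sup>+f3. \<integral>\<^sup>+fx. E3 w s1 s2 f1 f2 f3 fx \<partial>FX \<partial>F3) \<le>
       (\<integral>\<^sup>+u. \<integral>\<^sup>+x. \<integral>\<^sup>+y. mm (fst (f1 (pr1 s1))) (fst (f2 (pr2 s2))) y u \<partial>W x s1 s2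
          \<partial>KX u s1 (fst (f1 (pr1 s1))) (fst (f2 (pr2 s2))) \<partial>KU s1 (fst (f1 (pr1 s1))) (fst (f2 (pr2 s2))))" for f1 f2
    proof -
      let ?v1 = "fst (f1 (pr1 s1))" and ?v2 = "fst (f2 (pr2 s2))"
      let ?P = "pr3 w s1 ?v1 ?v2"
      have "(\<integral>\<^sup>+f3. \<integral>\<^sup>+fx. E3 w s1 s2 f1 f2 f3 fx \<partial>FX \<partial>F3) =
         (\<integral>\<^sup>+f3. \<integral>\<^sup>+x. \<integral>\<^sup>+y. of_bool (f3 (gu3 y s2 ?v1 ?v2) \<noteq> f3 ?P) \<partial>W x s1 s2 \<partial>KX (fst (f3 ?P)) s1 ?v1 ?v2 \<partial>F3)"
        unfolding E3_def x_id_def Let_def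
      proof (rule nn_integral_cong)
        fix f3
        show "(\<integral>\<^sup>+fx. \<integral>\<^sup>+y. of_bool (f3 (gu3 y s2 ?v1 ?v2) \<noteq> f3 ?P) \<partial>W (fx (KX (fst (f3 ?P)) s1 ?v1 ?v2)) s1 s2 \<partial>FX) =
            (\<integral>\<^sup>+x. \<integral>\<^sup>+y. of_bool (f3 (gu3 y s2 ?v1 ?v2) \<noteq> f3 ?P) \<partial>W x s1 s2 \<partial>KX (fst (f3 ?P)) s1 ?v1 ?v2)"
          by (rule margX[where h = "\<lambda>x. \<integral>\<^sup>+y. of_bool (f3 (gu3 y s2 ?v1 ?v2) \<noteq> f3 ?P) \<partial>W x s1 s2"])
      qed
      also have "\<dots> = (\<integral>\<^sup>+f3. \<integral>\<^sup>+y. of_bool (f3 (gu3 y s2 ?v1 ?v2) \<noteq> f3 ?P)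
          \<partial>(bind_pmf (KX (fst (f3 ?P)) s1 ?v1 ?v2) (\<lambda>x. W x s1 s2)) \<partial>F3)"
        by simp
      also have "\<dots> \<le> (\<integral>\<^sup>+a. \<integral>\<^sup>+y. mismatch 1 ?P (gu3 y s2 ?v1 ?v2) a
          \<partial>(bind_pmf (KX (fst a) s1 ?v1 ?v2) (\<lambda>x. W x s1 s2)) \<partial>?P)"
        by (rule matching_conditional[OF F3 mem(6)[OF w] fin_pr(3), where q = "\<lambda>a y. gu3 y s2 ?v1 ?v2"
            and G = "\<lambda>a. bind_pmf (KX (fst a) s1 ?v1 ?v2) (\<lambda>x. W x s1 s2)"]) (rule mem)
      also have "\<dots> \<le> (\<integral>\<^sup>+a. \<integral>\<^sup>+y. mm ?v1 ?v2 y (fst a)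
          \<partial>(bind_pmf (KX (fst a) s1 ?v1 ?v2) (\<lambda>x. W x s1 s2)) \<partial>?P)"
      proof (rule nn_integral_pmf_mono, rule nn_integral_mono)
        fix a y assume "a \<in> set_pmf ?P"
        then have "snd a = w" by (rule snd_pr)
        with mismatch_pair_return_left[OF w, of "KU s1 ?v1 ?v2" "dU y s2 ?v1 ?v2" "fst a"]
        show "mismatch 1 ?P (gu3 y s2 ?v1 ?v2) a \<le> mm ?v1 ?v2 y (fst a)"
          by (cases a) (simp add: pr3_def gu3_def mm_def)
      qed
      finally show ?thesis by (simp add: pr3_def nn_integral_pair_pmf')
    qed
    then have "(\<integral>\<^sup>+f1. \<integral>\<^sup>+f2. \<integral>\<^sup>+f3. \<integral>\<^sup>+fx. E3 w s1 s2 f1 f2 f3 fx \<partial>FX \<partial>F3 \<partial>F2 \<partial>F1) \<le>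
      (\<integral>\<^sup>+f1. \<integral>\<^sup>+f2. (\<lambda>a b. \<integral>\<^sup>+u. \<integral>\<^sup>+x. \<integral>\<^sup>+y. mm (fst a) (fst b) y u \<partial>W x s1 s2
          \<partial>KX u s1 (fst a) (fst b) \<partial>KU s1 (fst a) (fst b)) (f1 (pr1 s1)) (f2 (pr2 s2)) \<partial>F2 \<partial>F1)"
      by (intro nn_integral_mono)
    also have "\<dots> = t3 s1 s2"
      by (subst marg2, subst marg1) (simp add: pr1_def pr2_def nn_integral_pair_pmf' t3_def mm_def)
    finally show ?thesis .
  qed

  have total: "(\<integral>\<^sup>+f1. \<integral>\<^sup>+f2. \<integral>\<^sup>+f3. \<integral>\<^sup>+fx. er w s1 s2 f1 f2 f3 fx \<partial>FX \<partial>F3 \<partial>F2 \<partial>F1) \<le> t1 s1 s2 + t2 s1 s2 + t3 s1 s2"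
    if w: "w \<in> {1..M}" for w s1 s2
  proof -
    have "(\<integral>\<^sup>+f1. \<integral>\<^sup>+f2. \<integral>\<^sup>+f3. \<integral>\<^sup>+fx. er w s1 s2 f1 f2 f3 fx \<partial>FX \<partial>F3 \<partial>F2 \<partial>F1) \<le>
       (\<integral>\<^sup>+f1. \<integral>\<^sup>+f2. \<integral>\<^sup>+f3. \<integral>\<^sup>+fx. E1 w s1 s2 f1 f2 f3 fx + E2 s1 s2 f2 + E3 w s1 s2 f1 f2 f3 fx \<partial>FX \<partial>F3 \<partial>F2 \<partial>F1)"
      by (rule nn_integral_mono, rule nn_integral_mono, rule nn_integral_pmf_mono, rule nn_integral_mono,
          rule er_le[OF _ w])
    also have "\<dots> = (\<integral>\<^sup>+f1. \<integral>\<^sup>+f2. \<integral>\<^sup>+f3. \<integral>\<^sup>+fx. E1 w s1 s2 f1 f2 f3 fx \<partial>FX \<partial>F3 \<partial>F2 \<partial>F1)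
        + (\<integral>\<^sup>+f2. E2 s1 s2 f2 \<partial>F2) + (\<integral>\<^sup>+f1. \<integral>\<^sup>+f2. \<integral>\<^sup>+f3. \<integral>\<^sup>+fx. E3 w s1 s2 f1 f2 f3 fx \<partial>FX \<partial>F3 \<partial>F2 \<partial>F1)"
      by (simp add: nn_integral_add)
    also have "(\<integral>\<^sup>+f1. \<integral>\<^sup>+f2. \<integral>\<^sup>+f3. \<integral>\<^sup>+fx. E1 w s1 s2 f1 f2 f3 fx \<partial>FX \<partial>F3 \<partial>F2 \<partial>F1) =
        (\<integral>\<^sup>+f2. \<integral>\<^sup>+f3. \<integral>\<^sup>+fx. \<integral>\<^sup>+f1. E1 w s1 s2 f1 f2 f3 fx \<partial>F1 \<partial>FX \<partial>F3 \<partial>F2)"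
      by (subst nn_integral_pmf_swap[where A = F1 and B = F2], subst nn_integral_pmf_swap[where A = F1 and B = F3], subst nn_integral_pmf_swap[where A = F1 and B = FX]) simp
    finally show ?thesis
      by (rule order_trans) (intro add_mono I1 I2 I3 w)
  qed

  define F where "F = pair_pmf F1 (pair_pmf F2 (pair_pmf F3 FX))"
  define er' where "er' w s f = er w (fst s) (snd s) (fst f) (fst (snd f)) (fst (snd (snd f))) (snd (snd (snd f)))" for w s f
  let ?J = "joint_law PS W KV1 KV2 KU KX"
  let ?T = "(\<integral>\<^sup>+(s1, s2, v1, v2, u, x, y). mismatch (1 / real B1) (KV1 s1) (dV1 y s2 v2) v1 \<partial>?J) +
        (\<integral>\<^sup>+(s1, s2, v1, v2, u, x, y). mismatch (1 / real B2) (KV2 s2) (eV2 s1) v2 \<partial>?J) +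
        (\<integral>\<^sup>+(s1, s2, v1, v2, u, x, y). mismatch (real M) (KU s1 v1 v2) (dU y s2 v1 v2) u \<partial>?J)"
  have T_eq: "(\<integral>\<^sup>+s. t1 (fst s) (snd s) + t2 (fst s) (snd s) + t3 (fst s) (snd s) \<partial>PS) = ?T"
  proof -
    have "(\<integral>\<^sup>+s. t1 (fst s) (snd s) \<partial>PS) = (\<integral>\<^sup>+(s1, s2, v1, v2, u, x, y). mismatch (1 / real B1) (KV1 s1) (dV1 y s2 v2) v1 \<partial>?J)"
      unfolding t1_def by (subst nn_integral_pmf_swap) (simp add: joint_law_def split_beta)
    moreover have "(\<integral>\<^sup>+s. t2 (fst s) (snd s) \<partial>PS) = (\<integral>\<^sup>+(s1, s2, v1, v2, u, x, y). mismatch (1 / real B2) (KV2 s2) (eV2 s1) v2 \<partial>?J)"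
      unfolding t2_def by (simp add: joint_law_def split_beta)
    moreover have "(\<integral>\<^sup>+s. t3 (fst s) (snd s) \<partial>PS) = (\<integral>\<^sup>+(s1, s2, v1, v2, u, x, y). mismatch (real M) (KU s1 v1 v2) (dU y s2 v1 v2) u \<partial>?J)"
      unfolding t3_def by (simp add: joint_law_def split_beta)
    ultimately show ?thesis by (simp add: nn_integral_add)
  qed
  have "(\<integral>\<^sup>+f. (\<Sum>w=1..M. \<integral>\<^sup>+s. er' w s f \<partial>PS) \<partial>F) = (\<Sum>w=1..M. \<integral>\<^sup>+s. \<integral>\<^sup>+f. er' w s f \<partial>F \<partial>PS)"
    by (subst nn_integral_sum) (auto intro!: sum.cong nn_integral_pmf_swap)
  also have "\<dots> \<le> (\<Sum>w=1..M. ?T)"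
  proof (rule sum_mono)
    fix w assume w: "w \<in> {1..M}"
    have "(\<integral>\<^sup>+s. \<integral>\<^sup>+f. er' w s f \<partial>F \<partial>PS) \<le> (\<integral>\<^sup>+s. t1 (fst s) (snd s) + t2 (fst s) (snd s) + t3 (fst s) (snd s) \<partial>PS)"
      using total[OF w] by (intro nn_integral_mono) (simp add: F_def er'_def nn_integral_pair_pmf')
    then show "(\<integral>\<^sup>+s. \<integral>\<^sup>+f. er' w s f \<partial>F \<partial>PS) \<le> ?T" unfolding T_eq .
  qed
  also have "\<dots> = of_nat M * ?T" by simp
  finally have "\<exists>f\<in>set_pmf F. (\<Sum>w=1..M. \<integral>\<^sup>+s. er' w s f \<partial>PS) \<le> of_nat M * ?T"
    by (rule nn_integral_pmf_exists_le)
  then obtain f where f: "f \<in> set_pmf F" and le: "(\<Sum>w=1..M. \<integral>\<^sup>+s. er' w s f \<partial>PS) \<le> of_nat M * ?T" ..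
  obtain f1 f2 f3 fx where f_eq: "f = (f1, f2, f3, fx)" by (cases f)
  with f have fs: "f1 \<in> set_pmf F1" "f2 \<in> set_pmf F2" "f3 \<in> set_pmf F3" "fx \<in> set_pmf FX"
    by (auto simp: F_def)
  show ?thesis
  proof (rule that)
    show "snd (f1 (pr1 s1)) \<in> {1..B1}" for s1
      using is_matchingD(2)[OF F1 mem(1) fs(1)] by (rule snd_pr)
    show "snd (f2 (pr2 s2)) \<in> {1..B2}" for s2
      using is_matchingD(2)[OF F2 mem(2) fs(2)] by (rule snd_pr)
    show "\<exists>u v1 v2. enc' f1 f2 f3 fx w s1 m \<in> set_pmf (KX u s1 v1 v2)" for w s1 m
      unfolding enc'_def Let_def by (intro exI) (rule is_matchingD(2)[OF FX KX_in fs(4)])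
    show "dec' f1 f2 f3 y s2 m \<in> {1..M}" for y s2 m
      unfolding dec'_def Let_def using is_matchingD(2)[OF F3 mem(3) fs(3)] by (rule snd_pr)
    show "(\<Sum>w=1..M. \<integral>\<^sup>+s. \<integral>\<^sup>+y. of_bool (dec' f1 f2 f3 y (snd s) (snd (f1 (pr1 (fst s)))) \<noteq> w)
        \<partial>measure_pmf (W (enc' f1 f2 f3 fx w (fst s) (snd (f2 (pr2 (snd s))))) (fst s) (snd s)) \<partial>measure_pmf PS)
      \<le> of_nat M * ?T"
      using le by (simp add: er'_def er_def f_eq)
  qed
qed

section \<open>Block codes\<close>

lemma ratio_le_powr:
  fixes a b t :: real
  assumes "a \<ge> 0" "b > 0" "0 < t" "t \<le> 1"
  shows "a / (a + b) \<le> (a / b) powr t"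
proof -
  define r where "r = a / b"
  have r: "r \<ge> 0" using assms by (simp add: r_def)
  have a: "a = r * b" using assms by (simp add: r_def)
  have "a / (a + b) = (r * b) / ((r + 1) * b)" unfolding a by (simp add: algebra_simps)
  also have "\<dots> = r / (r + 1)" using assms by simp
  \<comment> \<open>The quotient is at most \<open>min 1 r\<close>, which lies below
    \<open>r powr t\<close> on either side of \<open>r = 1\<close> because
    \<open>0 < t \<le> 1\<close>.\<close>
  also have "\<dots> \<le> r powr t"
  proof (cases "r \<ge> 1")
    case True
    have "r / (r + 1) \<le> 1" using r by simp
    also have "\<dots> \<le> r powr t" using True assms by (intro ge_one_powr_ge_zero) auto
    finally show ?thesis .
  next
    case False
    have "r / (r + 1) \<le> r" using r by (simp add: divide_le_eq algebra_simps)
    also have "r \<le> r powr t"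
      using False r assms powr_mono'[of t 1 r] by (cases "r = 0") auto
    finally show ?thesis .
  qed
  finally show ?thesis by (simp add: r_def)
qed

text \<open>
  The value \<open>\<top>\<close> at \<open>pmf q v = 0\<close> replaces the junk value of the division, so that
  \<open>mismatch_Pi_pmf_le\<close> holds without support conditions.
\<close>

definition tilted_ratio :: "real \<Rightarrow> 'a pmf \<Rightarrow> 'a pmf \<Rightarrow> 'a \<Rightarrow> ennreal" where
  "tilted_ratio t p q v =
     (if p = q then 1 else if pmf q v = 0 then \<top> else ennreal ((pmf p v / pmf q v) powr t))"

text \<open>A quotient \<open>a / (a + b)\<close> of product masses does not factorise, but the
  power of \<open>a / b\<close> that dominates it does. If some guess mass vanishes at a point
  charged by the first law, one factor is infinite and the others are nonzero, so the right side is
  infinite.\<close>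

lemma mismatch_Pi_pmf_le:
  assumes A: "finite A" and c: "c > 0" and t: "0 < t" "t \<le> 1"
  shows "mismatch c (Pi_pmf A d p) (Pi_pmf A d q) v \<le>
    ennreal (c powr t) * (\<Prod>i\<in>A. tilted_ratio t (p i) (q i) (v i))"
proof (cases "pmf (Pi_pmf A d p) v = 0")
  case True
  then show ?thesis by (simp add: mismatch_def)
next
  case False
  then have out: "\<forall>x. x \<notin> A \<longrightarrow> v x = d" and p_nz: "\<forall>i\<in>A. pmf (p i) (v i) \<noteq> 0"
    using A by (auto simp: pmf_Pi split: if_splits)
  have pmf_eq: "pmf (Pi_pmf A d r) v = (\<Prod>i\<in>A. pmf (r i) (v i))" for r
    using A out by (simp add: pmf_Pi)
  have p_pos: "pmf (p i) (v i) > 0" if "i \<in> A" for i using p_nz that by (simp add: pmf_pos)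
  have tilted_nz: "tilted_ratio t (p i) (q i) (v i) \<noteq> 0" if "i \<in> A" for i
    using p_pos[OF that] by (auto simp: tilted_ratio_def)
  show ?thesis
  proof (cases "\<exists>i\<in>A. pmf (q i) (v i) = 0")
    case True
    then obtain i where i: "i \<in> A" "pmf (q i) (v i) = 0" by blast
    then have "p i \<noteq> q i" using p_pos[of i] by auto
    with i have "tilted_ratio t (p i) (q i) (v i) = \<top>" by (simp add: tilted_ratio_def)
    then have "(\<Prod>i\<in>A. tilted_ratio t (p i) (q i) (v i)) = \<top>"
      using A i tilted_nz by (subst prod.remove[OF A i(1)]) (auto simp: ennreal_top_mult)
    then show ?thesis using c by (simp add: ennreal_mult_top)
  next
    case False
    then have q_pos: "pmf (q i) (v i) > 0" if "i \<in> A" for i using that by (simp add: pmf_pos)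
    have "tilted_ratio t (p i) (q i) (v i) = ennreal ((pmf (p i) (v i) / pmf (q i) (v i)) powr t)" if "i \<in> A" for i
      using q_pos[OF that] by (auto simp: tilted_ratio_def)
    then have "(\<Prod>i\<in>A. tilted_ratio t (p i) (q i) (v i)) = (\<Prod>i\<in>A. ennreal ((pmf (p i) (v i) / pmf (q i) (v i)) powr t))"
      by (intro prod.cong) auto
    also have "\<dots> = ennreal ((\<Prod>i\<in>A. pmf (p i) (v i) / pmf (q i) (v i)) powr t)"
      by (simp add: prod_ennreal prod_powr_distrib)
    finally have *: "(\<Prod>i\<in>A. tilted_ratio t (p i) (q i) (v i)) =
        ennreal (((\<Prod>i\<in>A. pmf (p i) (v i)) / (\<Prod>i\<in>A. pmf (q i) (v i))) powr t)"
      by (simp add: prod_dividef)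
    let ?p = "\<Prod>i\<in>A. pmf (p i) (v i)" and ?q = "\<Prod>i\<in>A. pmf (q i) (v i)"
    have pq: "?p \<ge> 0" "?q > 0" using q_pos by (auto intro: prod_nonneg prod_pos)
    have "mismatch c (Pi_pmf A d p) (Pi_pmf A d q) v \<le> ennreal (c * ?p / (c * ?p + ?q))"
      by (simp add: mismatch_def pmf_eq)
    also have "\<dots> \<le> ennreal ((c * ?p / ?q) powr t)"
      using c pq t by (intro ennreal_leI ratio_le_powr) auto
    also have "\<dots> = ennreal (c powr t * (?p / ?q) powr t)"
      using c pq by (simp flip: powr_mult)
    finally show ?thesis unfolding * by (simp add: ennreal_mult)
  qed
qed

text \<open>The difference of \<open>E (r powr t)\<close> and \<open>2 powr (t * D)\<close> vanishes
  at \<open>t = 0\<close> and has derivative \<open>ln 2 * (E (log 2 r) - D) < 0\<close> there, so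
  it is negative for small positive \<open>t\<close>.\<close>

lemma exists_tilt:
  fixes J :: "'a::finite pmf"
  assumes r: "\<And>\<omega>. \<omega> \<in> set_pmf J \<Longrightarrow> r \<omega> > 0"
    and less: "measure_pmf.expectation J (\<lambda>\<omega>. log 2 (r \<omega>)) < D"
  obtains t where "0 < t" "t \<le> 1" "(\<integral>\<^sup>+\<omega>. ennreal (r \<omega> powr t) \<partial>measure_pmf J) \<le> ennreal (2 powr (t * D))"
proof -
  define h where "h t = (\<Sum>\<omega>\<in>set_pmf J. pmf J \<omega> * r \<omega> powr t) - 2 powr (t * D)" for t
  have exp_eq: "measure_pmf.expectation J f = (\<Sum>\<omega>\<in>set_pmf J. pmf J \<omega> * f \<omega>)" for f :: "'a \<Rightarrow> real"
    by (subst integral_measure_pmf[of "set_pmf J"]) auto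
  have h0: "h 0 = 0"
  proof -
    have "(\<Sum>\<omega>\<in>set_pmf J. pmf J \<omega> * r \<omega> powr 0) = (\<Sum>\<omega>\<in>set_pmf J. pmf J \<omega>)"
      by (intro sum.cong) (auto dest: r)
    then show ?thesis using exp_eq[of "\<lambda>_. 1"] by (simp add: h_def)
  qed
  have "(h has_real_derivative (\<Sum>\<omega>\<in>set_pmf J. pmf J \<omega> * ln (r \<omega>)) - D * ln 2) (at 0)"
  proof -
    have "((\<lambda>t. \<Sum>\<omega>\<in>set_pmf J. pmf J \<omega> * r \<omega> powr t) has_real_derivative (\<Sum>\<omega>\<in>set_pmf J. pmf J \<omega> * ln (r \<omega>))) (at 0)"
    proof (rule DERIV_sum)
      fix \<omega> assume "\<omega> \<in> set_pmf J"
      from r[OF this] show "((\<lambda>t. pmf J \<omega> * r \<omega> powr t) has_real_derivative pmf J \<omega> * ln (r \<omega>)) (at 0)"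
        by (auto intro!: derivative_eq_intros)
    qed
    moreover have "((\<lambda>t. 2 powr (t * D)) has_real_derivative D * ln 2) (at 0)"
      by (auto intro!: derivative_eq_intros)
    ultimately show ?thesis unfolding h_def by (rule DERIV_diff)
  qed
  moreover have "(\<Sum>\<omega>\<in>set_pmf J. pmf J \<omega> * ln (r \<omega>)) - D * ln 2 < 0"
    using less unfolding exp_eq by (simp add: log_def field_simps sum_divide_distrib[symmetric])
  ultimately obtain e where e: "e > 0" "\<And>x. 0 < x \<Longrightarrow> x < e \<Longrightarrow> h (0 + x) < h 0"
    using DERIV_neg_dec_right by blast
  define t where "t = min 1 (e / 2)"
  have t: "0 < t" "t \<le> 1" "t < e" using e by (auto simp: t_def)
  with e(2)[of t] h0 have "h t < 0" by simp
  then have "(\<Sum>\<omega>\<in>set_pmf J. pmf J \<omega> * r \<omega> powr t) \<le> 2 powr (t * D)" by (simp add: h_def)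
  moreover have "(\<integral>\<^sup>+\<omega>. ennreal (r \<omega> powr t) \<partial>measure_pmf J) = ennreal (\<Sum>\<omega>\<in>set_pmf J. pmf J \<omega> * r \<omega> powr t)"
    by (subst nn_integral_measure_pmf_finite) (auto simp: ennreal_mult[symmetric] mult.commute intro!: sum.cong)
  ultimately show ?thesis using t by (intro that[of t]) (auto intro: ennreal_leI)
qed

text \<open>The components of a default pair need not be default values, so both sequences are
  restricted to the block. This is the form in which \<open>decoded_law\<close> hands them to the
  code.\<close>

definition iid_states :: "nat \<Rightarrow> ('s1 \<times> 's2) pmf \<Rightarrow> ((nat \<Rightarrow> 's1) \<times> (nat \<Rightarrow> 's2)) pmf" where
  "iid_states n pS = map_pmf (\<lambda>s. (restrict (\<lambda>i. fst (s i)) {..<n}, restrict (\<lambda>i. snd (s i)) {..<n}))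
     (Pi_pmf {..<n} undefined (\<lambda>_. pS))"

text \<open>The kernel may vary with the position, so that a block can be used in part only.\<close>

definition memoryless :: "nat \<Rightarrow> (nat \<Rightarrow> 'b \<Rightarrow> 'a pmf) \<Rightarrow> (nat \<Rightarrow> 'b) \<Rightarrow> (nat \<Rightarrow> 'a) pmf" where
  "memoryless n k z = Pi_pmf {..<n} undefined (\<lambda>i. k i (z i))"

lemma memoryless_cong:
  assumes "\<And>i. i < n \<Longrightarrow> k i (z i) = k' i (z' i)"
  shows "memoryless n k z = memoryless n k' z'"
  unfolding memoryless_def by (rule Pi_pmf_cong) (use assms in auto)

text \<open>The law depends on \<open>h z\<close> only through its first \<open>n\<close> letters,
  and these range over a finite alphabet.\<close>

lemma finite_kernel_memoryless:
  fixes k :: "nat \<Rightarrow> 'b::finite \<Rightarrow> 'a::finite pmf"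
  shows "finite_kernel (\<lambda>z. memoryless n k (h z))"
  unfolding finite_kernel_def
proof (intro conjI allI)
  have "range (\<lambda>z. memoryless n k (h z)) \<subseteq> memoryless n k ` ({..<n} \<rightarrow>\<^sub>E UNIV)"
  proof safe
    fix z
    have "memoryless n k (h z) = memoryless n k (restrict (h z) {..<n})"
      by (rule memoryless_cong) simp
    then show "memoryless n k (h z) \<in> memoryless n k ` ({..<n} \<rightarrow>\<^sub>E UNIV)" by auto
  qed
  then show "finite (range (\<lambda>z. memoryless n k (h z)))"
    by (rule finite_subset) (auto intro!: finite_PiE)
  show "finite (set_pmf (memoryless n k (h z)))" for z
    by (simp add: memoryless_def set_Pi_pmf finite_PiE_dflt)
qed

text \<open>The variables are integrated in the reverse order of their generation. Each conditional
  law is a product law, so a product over the letters stays one; \<open>h6\<close> down to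
  \<open>h2\<close> are the partially integrated letters.\<close>

lemma nn_integral_prod_joint_law:
  fixes h :: "nat \<Rightarrow> 's1 \<times> 's2 \<times> 'v1 \<times> 'v2 \<times> 'u \<times> 'x \<times> 'y \<Rightarrow> ennreal"
  shows "(\<integral>\<^sup>+(s1, s2, v1, v2, u, x, y). (\<Prod>i<n. h i (s1 i, s2 i, v1 i, v2 i, u i, x i, y i))
     \<partial>joint_law (iid_states n pS)
        (\<lambda>x s1 s2. memoryless n (\<lambda>_ (x, s1, s2). pY x s1 s2) (\<lambda>i. (x i, s1 i, s2 i)))
        (memoryless n kV1) (memoryless n kV2)
        (\<lambda>s1 v1 v2. memoryless n kU (\<lambda>i. (s1 i, v1 i, v2 i)))
        (\<lambda>u s1 v1 v2. memoryless n kX (\<lambda>i. (u i, s1 i, v1 i, v2 i)))) =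
   (\<Prod>i<n. \<integral>\<^sup>+\<omega>. h i \<omega> \<partial>joint_law pS pY (kV1 i) (kV2 i)
      (\<lambda>s1 v1 v2. kU i (s1, v1, v2)) (\<lambda>u s1 v1 v2. kX i (u, s1, v1, v2)))"
proof -
  note P = nn_integral_prod_Pi_pmf[OF finite_lessThan]
  define h6 where "h6 i s1 s2 v1 v2 u x = (\<integral>\<^sup>+y. h i (s1, s2, v1, v2, u, x, y) \<partial>pY x s1 s2)" for i s1 s2 v1 v2 u x
  define h5 where "h5 i s1 s2 v1 v2 u = (\<integral>\<^sup>+x. h6 i s1 s2 v1 v2 u x \<partial>kX i (u, s1, v1, v2))" for i s1 s2 v1 v2 u
  define h4 where "h4 i s1 s2 v1 v2 = (\<integral>\<^sup>+u. h5 i s1 s2 v1 v2 u \<partial>kU i (s1, v1, v2))" for i s1 s2 v1 v2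
  define h3 where "h3 i s1 s2 v1 = (\<integral>\<^sup>+v2. h4 i s1 s2 v1 v2 \<partial>kV2 i s2)" for i s1 s2 v1
  define h2 where "h2 i s1 s2 = (\<integral>\<^sup>+v1. h3 i s1 s2 v1 \<partial>kV1 i s1)" for i s1 s2
  have e6: "(\<integral>\<^sup>+y. (\<Prod>i<n. h i (s1 i, s2 i, v1 i, v2 i, u i, x i, y i))
      \<partial>memoryless n (\<lambda>_ (x, s1, s2). pY x s1 s2) (\<lambda>i. (x i, s1 i, s2 i))) = (\<Prod>i<n. h6 i (s1 i) (s2 i) (v1 i) (v2 i) (u i) (x i))"
    for s1 s2 v1 v2 u x
    unfolding memoryless_def h6_def split_conv
    by (rule P[where f = "\<lambda>i y. h i (s1 i, s2 i, v1 i, v2 i, u i, x i, y)"])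
  have e5: "(\<integral>\<^sup>+x. (\<Prod>i<n. h6 i (s1 i) (s2 i) (v1 i) (v2 i) (u i) (x i))
      \<partial>memoryless n kX (\<lambda>i. (u i, s1 i, v1 i, v2 i))) = (\<Prod>i<n. h5 i (s1 i) (s2 i) (v1 i) (v2 i) (u i))"
    for s1 s2 v1 v2 u
    unfolding memoryless_def h5_def
    by (rule P[where f = "\<lambda>i x. h6 i (s1 i) (s2 i) (v1 i) (v2 i) (u i) x"])
  have e4: "(\<integral>\<^sup>+u. (\<Prod>i<n. h5 i (s1 i) (s2 i) (v1 i) (v2 i) (u i))
      \<partial>memoryless n kU (\<lambda>i. (s1 i, v1 i, v2 i))) = (\<Prod>i<n. h4 i (s1 i) (s2 i) (v1 i) (v2 i))"
    for s1 s2 v1 v2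
    unfolding memoryless_def h4_def
    by (rule P[where f = "\<lambda>i u. h5 i (s1 i) (s2 i) (v1 i) (v2 i) u"])
  have e3: "(\<integral>\<^sup>+v2. (\<Prod>i<n. h4 i (s1 i) (s2 i) (v1 i) (v2 i)) \<partial>memoryless n kV2 s2) = (\<Prod>i<n. h3 i (s1 i) (s2 i) (v1 i))"
    for s1 s2 v1
    unfolding memoryless_def h3_def by (rule P[where f = "\<lambda>i v2. h4 i (s1 i) (s2 i) (v1 i) v2"])
  have e2: "(\<integral>\<^sup>+v1. (\<Prod>i<n. h3 i (s1 i) (s2 i) (v1 i)) \<partial>memoryless n kV1 s1) = (\<Prod>i<n. h2 i (s1 i) (s2 i))"
    for s1 s2
    unfolding memoryless_def h2_def by (rule P[where f = "\<lambda>i v1. h3 i (s1 i) (s2 i) v1"])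
  have e1: "(\<integral>\<^sup>+s. (\<Prod>i<n. h2 i (fst (s i)) (snd (s i))) \<partial>Pi_pmf {..<n} undefined (\<lambda>_. pS)) =
      (\<Prod>i<n. \<integral>\<^sup>+s. h2 i (fst s) (snd s) \<partial>pS)"
    by (rule P[where f = "\<lambda>i s. h2 i (fst s) (snd s)"])
  have "(\<integral>\<^sup>+\<omega>. h i \<omega> \<partial>joint_law pS pY (kV1 i) (kV2 i)
      (\<lambda>s1 v1 v2. kU i (s1, v1, v2)) (\<lambda>u s1 v1 v2. kX i (u, s1, v1, v2))) = (\<integral>\<^sup>+s. h2 i (fst s) (snd s) \<partial>pS)" for i
    by (simp add: joint_law_def split_beta h2_def h3_def h4_def h5_def h6_def)
  then show ?thesis
    by (simp add: joint_law_def split_beta e6 e5 e4 e3 e2 iid_states_def flip: e1)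
qed

section \<open>Rounding of rates and partially used blocks\<close>

lemma num_indices_bounds:
  assumes "R \<ge> 0"
  shows "num_indices n R \<ge> 1" "real (num_indices n R) \<le> 2 powr (real n * R)"
    "2 powr (real n * R) \<le> 2 * real (num_indices n R)"
proof -
  have ge: "2 powr (real n * R) \<ge> 1" using assms by (intro ge_one_powr_ge_zero) auto
  then have fl: "\<lfloor>2 powr (real n * R)\<rfloor> \<ge> 1" by simp
  then show 1: "num_indices n R \<ge> 1" by (simp add: num_indices_def le_nat_iff)
  have eq: "real (num_indices n R) = of_int \<lfloor>2 powr (real n * R)\<rfloor>"
    using fl by (simp add: num_indices_def)
  show "real (num_indices n R) \<le> 2 powr (real n * R)" unfolding eq by simp
  \<comment> \<open>Rounding down loses at most a factor two, since the integer part
    \<open>N\<close> is at least one: \<open>N + 1 \<le> 2 * N\<close>.\<close>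
  have "2 powr (real n * R) < real (num_indices n R) + 1" unfolding eq by linarith
  with 1 show "2 powr (real n * R) \<le> 2 * real (num_indices n R)" by linarith
qed

lemma num_indices_0 [simp]: "num_indices n 0 = 1"
  by (simp add: num_indices_def)

lemma two_powr_linear_tendsto_0:
  fixes a \<delta> :: real
  assumes "\<delta> > 0"
  shows "(\<lambda>n. 2 powr (a - \<delta> * real n)) \<longlonglongrightarrow> 0"
proof -
  have "(\<lambda>n. 2 powr a * (2 powr (- \<delta>)) ^ n) \<longlonglongrightarrow> 2 powr a * 0"
    using assms by (intro tendsto_mult tendsto_const LIMSEQ_power_zero) (simp add: powr_less_one)
  moreover have "2 powr a * (2 powr (- \<delta>)) ^ n = 2 powr (a - \<delta> * real n)" for n
    by (simp add: powr_realpow[symmetric] powr_powr powr_add[symmetric])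
  ultimately show ?thesis by simp
qed

text \<open>
  Only the first \<open>m\<close> of the \<open>n\<close> letters carry information; the description indices still
  range over the alphabets for length \<open>n\<close>, which gains slack in the rate constraints.
\<close>

definition pad :: "nat \<Rightarrow> ('b \<Rightarrow> 'a pmf) \<Rightarrow> nat \<Rightarrow> 'b \<Rightarrow> 'a pmf" where
  "pad m k i b = (if i < m then k b else return_pmf undefined)"

lemma pad_less: "i < m \<Longrightarrow> pad m k i = k"
  and pad_ge: "\<not> i < m \<Longrightarrow> pad m k i = (\<lambda>_. return_pmf undefined)"
  by (auto simp: pad_def)

text \<open>States and channel run over all \<open>n\<close> letters; only the auxiliary variables
  and the input are constant from position \<open>m\<close> on.\<close>

definition block_law ::
    "nat \<Rightarrow> nat \<Rightarrow> ('s1 \<times> 's2) pmf \<Rightarrow> ('x \<Rightarrow> 's1 \<Rightarrow> 's2 \<Rightarrow> 'y pmf) \<Rightarrow> ('s1 \<Rightarrow> 'v1 pmf) \<Rightarrow> ('s2 \<Rightarrow> 'v2 pmf) \<Rightarrow>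
      ('s1 \<Rightarrow> 'v1 \<Rightarrow> 'v2 \<Rightarrow> 'u pmf) \<Rightarrow> ('u \<Rightarrow> 's1 \<Rightarrow> 'v1 \<Rightarrow> 'v2 \<Rightarrow> 'x pmf) \<Rightarrow>
      ((nat \<Rightarrow> 's1) \<times> (nat \<Rightarrow> 's2) \<times> (nat \<Rightarrow> 'v1) \<times> (nat \<Rightarrow> 'v2) \<times> (nat \<Rightarrow> 'u) \<times> (nat \<Rightarrow> 'x) \<times> (nat \<Rightarrow> 'y)) pmf" where
  "block_law n m pS pY pV1 pV2 pU pX = joint_law (iid_states n pS)
     (\<lambda>x s1 s2. memoryless n (\<lambda>_ (x, s1, s2). pY x s1 s2) (\<lambda>i. (x i, s1 i, s2 i)))
     (memoryless n (pad m pV1)) (memoryless n (pad m pV2))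
     (\<lambda>s1 v1 v2. memoryless n (pad m (\<lambda>(s1, v1, v2). pU s1 v1 v2)) (\<lambda>i. (s1 i, v1 i, v2 i)))
     (\<lambda>u s1 v1 v2. memoryless n (pad m (\<lambda>(u, s1, v1, v2). pX u s1 v1 v2)) (\<lambda>i. (u i, s1 i, v1 i, v2 i)))"

text \<open>\<open>P\<close>, \<open>Q\<close> and \<open>val\<close> read a whole letter, so that
  all three races are instances. From position \<open>m\<close> on both padded laws are the same
  point mass, whose \<open>tilted_ratio\<close> is one, which leaves an \<open>m\<close>-th
  power.\<close>

lemma nn_integral_block_mismatch_le:
  assumes m: "m \<le> n" and c: "c > 0" and t: "0 < t" "t \<le> 1"
  shows "(\<integral>\<^sup>+(s1, s2, v1, v2, u, x, y). mismatch c
        (memoryless n (pad m P) (\<lambda>i. (s1 i, s2 i, v1 i, v2 i, u i, x i, y i)))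
        (memoryless n (pad m Q) (\<lambda>i. (s1 i, s2 i, v1 i, v2 i, u i, x i, y i)))
        (\<lambda>i. val (s1 i, s2 i, v1 i, v2 i, u i, x i, y i)) \<partial>block_law n m pS pY pV1 pV2 pU pX)
    \<le> ennreal (c powr t) * (\<integral>\<^sup>+\<omega>. tilted_ratio t (P \<omega>) (Q \<omega>) (val \<omega>) \<partial>joint_law pS pY pV1 pV2 pU pX) ^ m"
    (is "?L \<le> _ * ?I ^ m")
proof -
  let ?J = "block_law n m pS pY pV1 pV2 pU pX"
  define h where "h i \<omega> = (if i < m then tilted_ratio t (P \<omega>) (Q \<omega>) (val \<omega>) else 1)" for i \<omega>
  have tilted: "tilted_ratio t (pad m P i \<omega>) (pad m Q i \<omega>) (val \<omega>) = h i \<omega>" for i \<omega>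
    by (simp add: h_def pad_def tilted_ratio_def)
  have "?L \<le> (\<integral>\<^sup>+(s1, s2, v1, v2, u, x, y). ennreal (c powr t) *
      (\<Prod>i<n. h i (s1 i, s2 i, v1 i, v2 i, u i, x i, y i)) \<partial>?J)"
    unfolding memoryless_def split_beta
    by (intro nn_integral_mono order_trans[OF mismatch_Pi_pmf_le[OF finite_lessThan c t]])
      (simp add: tilted)
  also have "\<dots> = ennreal (c powr t) * (\<integral>\<^sup>+(s1, s2, v1, v2, u, x, y).
      (\<Prod>i<n. h i (s1 i, s2 i, v1 i, v2 i, u i, x i, y i)) \<partial>?J)"
    unfolding split_beta by (rule nn_integral_cmult) simp
  also have "(\<integral>\<^sup>+(s1, s2, v1, v2, u, x, y).
      (\<Prod>i<n. h i (s1 i, s2 i, v1 i, v2 i, u i, x i, y i)) \<partial>?J) = (\<Prod>i<n. if i < m then ?I else 1)"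
    unfolding block_law_def nn_integral_prod_joint_law
  proof (rule prod.cong)
    fix i
    have "h i = (if i < m then (\<lambda>\<omega>. tilted_ratio t (P \<omega>) (Q \<omega>) (val \<omega>)) else (\<lambda>_. 1))"
      by (auto simp: h_def)
    then show "integral\<^sup>N (measure_pmf (joint_law pS pY (pad m pV1 i) (pad m pV2 i)
        (\<lambda>s1 v1 v2. pad m (\<lambda>(s1, v1, v2). pU s1 v1 v2) i (s1, v1, v2))
        (\<lambda>u s1 v1 v2. pad m (\<lambda>(u, s1, v1, v2). pX u s1 v1 v2) i (u, s1, v1, v2)))) (h i) = (if i < m then ?I else 1)"
      by (cases "i < m") (simp_all add: pad_less pad_ge)
  qed simp
  also have "\<dots> = ?I ^ m"
  proof -
    have "{..<n} \<inter> {i. i < m} = {..<m}" using m by auto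
    then show ?thesis by (simp add: prod.If_cases)
  qed
  finally show ?thesis .
qed

text \<open>The tilt is found from the single-letter law, so one \<open>t\<close> serves all block
  lengths and all reweighting factors \<open>c\<close>.\<close>

lemma block_mismatch_exponent:
  fixes pS :: "('s1::finite \<times> 's2::finite) pmf" and pY :: "'x::finite \<Rightarrow> 's1 \<Rightarrow> 's2 \<Rightarrow> 'y::finite pmf"
    and pV1 :: "'s1 \<Rightarrow> 'v1::finite pmf" and pV2 :: "'s2 \<Rightarrow> 'v2::finite pmf"
    and pU :: "'s1 \<Rightarrow> 'v1 \<Rightarrow> 'v2 \<Rightarrow> 'u::finite pmf"
  assumes pos: "\<And>\<omega>. \<omega> \<in> set_pmf (joint_law pS pY pV1 pV2 pU pX) \<Longrightarrow>
      pmf (P \<omega>) (val \<omega>) > 0 \<and> pmf (Q \<omega>) (val \<omega>) > 0"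
    and less: "measure_pmf.expectation (joint_law pS pY pV1 pV2 pU pX)
      (\<lambda>\<omega>. log 2 (pmf (P \<omega>) (val \<omega>) / pmf (Q \<omega>) (val \<omega>))) < D"
  obtains t where "0 < t" "t \<le> 1"
    "\<And>n m c. m \<le> n \<Longrightarrow> c > 0 \<Longrightarrow>
      (\<integral>\<^sup>+(s1, s2, v1, v2, u, x, y). mismatch c
        (memoryless n (pad m P) (\<lambda>i. (s1 i, s2 i, v1 i, v2 i, u i, x i, y i)))
        (memoryless n (pad m Q) (\<lambda>i. (s1 i, s2 i, v1 i, v2 i, u i, x i, y i)))
        (\<lambda>i. val (s1 i, s2 i, v1 i, v2 i, u i, x i, y i)) \<partial>block_law n m pS pY pV1 pV2 pU pX)
      \<le> ennreal (c powr t * 2 powr (t * D * real m))"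
proof -
  let ?J = "joint_law pS pY pV1 pV2 pU pX"
  let ?r = "\<lambda>\<omega>. pmf (P \<omega>) (val \<omega>) / pmf (Q \<omega>) (val \<omega>)"
  obtain t where t: "0 < t" "t \<le> 1" "(\<integral>\<^sup>+\<omega>. ennreal (?r \<omega> powr t) \<partial>?J) \<le> ennreal (2 powr (t * D))"
    by (rule exists_tilt[of ?J ?r, OF _ less]) (use pos in auto)
  have "(\<integral>\<^sup>+\<omega>. tilted_ratio t (P \<omega>) (Q \<omega>) (val \<omega>) \<partial>?J) \<le> (\<integral>\<^sup>+\<omega>. ennreal (?r \<omega> powr t) \<partial>?J)"
  proof (rule nn_integral_pmf_mono)
    fix \<omega> assume "\<omega> \<in> set_pmf ?J"
    from pos[OF this] show "tilted_ratio t (P \<omega>) (Q \<omega>) (val \<omega>) \<le> ennreal (?r \<omega> powr t)"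
      by (auto simp: tilted_ratio_def)
  qed
  with t(3) have I: "(\<integral>\<^sup>+\<omega>. tilted_ratio t (P \<omega>) (Q \<omega>) (val \<omega>) \<partial>?J) \<le> ennreal (2 powr (t * D))"
    by (rule order_trans[rotated])
  show ?thesis
  proof (rule that[OF t(1,2)])
    fix n m :: nat and c :: real assume m: "m \<le> n" and c: "c > 0"
    have "ennreal (c powr t) * (\<integral>\<^sup>+\<omega>. tilted_ratio t (P \<omega>) (Q \<omega>) (val \<omega>) \<partial>?J) ^ m
        \<le> ennreal (c powr t) * ennreal (2 powr (t * D)) ^ m"
      by (intro mult_left_mono power_mono I) auto
    also have "\<dots> = ennreal (c powr t * 2 powr (t * D * real m))"
      by (simp add: ennreal_power ennreal_mult[symmetric] powr_powr powr_realpow[symmetric] flip: powr_mult)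
    finally show "(\<integral>\<^sup>+(s1, s2, v1, v2, u, x, y). mismatch c
        (memoryless n (pad m P) (\<lambda>i. (s1 i, s2 i, v1 i, v2 i, u i, x i, y i)))
        (memoryless n (pad m Q) (\<lambda>i. (s1 i, s2 i, v1 i, v2 i, u i, x i, y i)))
        (\<lambda>i. val (s1 i, s2 i, v1 i, v2 i, u i, x i, y i)) \<partial>block_law n m pS pY pV1 pV2 pU pX)
      \<le> ennreal (c powr t * 2 powr (t * D * real m))"
      by (rule order_trans[OF nn_integral_block_mismatch_le[OF m c t(1,2)]])
  qed
qed

text \<open>The one-shot code with whole sequences in place of letters. The factor in its bound, the
  number of messages, cancels against the average over the messages.\<close>

lemma block_code:
  fixes pS :: "('s1::finite \<times> 's2::finite) pmf" and pY :: "'x::finite \<Rightarrow> 's1 \<Rightarrow> 's2 \<Rightarrow> 'y::finite pmf"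
    and pV1 :: "'s1 \<Rightarrow> 'v1::finite pmf" and pV2 :: "'s2 \<Rightarrow> 'v2::finite pmf"
    and pU :: "'s1 \<Rightarrow> 'v1 \<Rightarrow> 'v2 \<Rightarrow> 'u::finite pmf" and pX :: "'u \<Rightarrow> 's1 \<Rightarrow> 'v1 \<Rightarrow> 'v2 \<Rightarrow> 'x pmf"
    and n m :: nat and R R1 R2 :: real
  assumes R: "R \<ge> 0" "R1 \<ge> 0" "R2 \<ge> 0"
  defines J_def: "J \<equiv> block_law n m pS pY pV1 pV2 pU pX"
  shows "\<exists>c. is_code n R R1 R2 c \<and> ennreal (error_prob pS pY n R c) \<le>
     (\<integral>\<^sup>+(s1, s2, v1, v2, u, x, y). mismatch (1 / real (num_indices n R1)) (memoryless n (pad m pV1) s1)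
         (memoryless n (pad m (\<lambda>(y, s2, v2). dV1 y s2 v2)) (\<lambda>i. (y i, s2 i, v2 i))) v1 \<partial>J) +
     (\<integral>\<^sup>+(s1, s2, v1, v2, u, x, y). mismatch (1 / real (num_indices n R2)) (memoryless n (pad m pV2) s2)
         (memoryless n (pad m eV2) s1) v2 \<partial>J) +
     (\<integral>\<^sup>+(s1, s2, v1, v2, u, x, y). mismatch (real (num_indices n R))
         (memoryless n (pad m (\<lambda>(s1, v1, v2). pU s1 v1 v2)) (\<lambda>i. (s1 i, v1 i, v2 i)))
         (memoryless n (pad m (\<lambda>(y, s2, v1, v2). dU y s2 v1 v2)) (\<lambda>i. (y i, s2 i, v1 i, v2 i))) u \<partial>J)"
    (is "\<exists>c. _ \<and> _ \<le> ?T")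
proof -
  let ?M = "num_indices n R" and ?B1 = "num_indices n R1" and ?B2 = "num_indices n R2"
  let ?W = "\<lambda>x s1 s2. memoryless n (\<lambda>_ (x, s1, s2). pY x s1 s2) (\<lambda>i. (x i, s1 i, s2 i))"
  let ?KX = "\<lambda>u s1 v1 v2. memoryless n (pad m (\<lambda>(u, s1, v1, v2). pX u s1 v1 v2)) (\<lambda>i. (u i, s1 i, v1 i, v2 i))"
  have M: "?M \<ge> 1" using num_indices_bounds(1)[OF R(1)] .
  note fk = finite_kernel_memoryless
  have fin: "finite_kernel (memoryless n (pad m pV1))" "finite_kernel (memoryless n (pad m pV2))"
      "finite_kernel (memoryless n (pad m eV2))"
      "finite_kernel (\<lambda>(s1, v1, v2). memoryless n (pad m (\<lambda>(s1, v1, v2). pU s1 v1 v2)) (\<lambda>i. (s1 i, v1 i, v2 i)))"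
      "finite_kernel (\<lambda>(u, s1, v1, v2). ?KX u s1 v1 v2)"
      "finite_kernel (\<lambda>(y, s2, v2). memoryless n (pad m (\<lambda>(y, s2, v2). dV1 y s2 v2)) (\<lambda>i. (y i, s2 i, v2 i)))"
      "finite_kernel (\<lambda>(y, s2, v1, v2). memoryless n (pad m (\<lambda>(y, s2, v1, v2). dU y s2 v1 v2)) (\<lambda>i. (y i, s2 i, v1 i, v2 i)))"
    unfolding split_beta by (rule fk)+
  obtain e :: "nat \<Rightarrow> (nat \<Rightarrow> 's1) \<Rightarrow> nat \<Rightarrow> nat \<Rightarrow> 'x" and d :: "(nat \<Rightarrow> 'y) \<Rightarrow> (nat \<Rightarrow> 's2) \<Rightarrow> nat \<Rightarrow> nat"
    and k1 :: "(nat \<Rightarrow> 's1) \<Rightarrow> nat" and k2 :: "(nat \<Rightarrow> 's2) \<Rightarrow> nat"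
    where k1: "\<And>s1. k1 s1 \<in> {1..?B1}" and k2: "\<And>s2. k2 s2 \<in> {1..?B2}"
      and e: "\<And>w s1 m. w \<in> {1..?M} \<Longrightarrow> m \<in> {1..?B2} \<Longrightarrow> \<exists>u v1 v2. e w s1 m \<in> set_pmf (?KX u s1 v1 v2)"
      and d: "\<And>y s2 m. m \<in> {1..?B1} \<Longrightarrow> d y s2 m \<in> {1..?M}"
      and le: "(\<Sum>w=1..?M. \<integral>\<^sup>+s. \<integral>\<^sup>+y. of_bool (d y (snd s) (k1 (fst s)) \<noteq> w)
        \<partial>measure_pmf (?W (e w (fst s) (k2 (snd s))) (fst s) (snd s)) \<partial>measure_pmf (iid_states n pS)) \<le> of_nat ?M * ?T"
    unfolding J_def block_law_def
    by (rule one_shot_code[OF M num_indices_bounds(1)[OF R(2)] num_indices_bounds(1)[OF R(3)] fin,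
          where PS = "iid_states n pS" and W = ?W]) blast
  define c :: "('s1, 's2, 'x, 'y) channel_code" where "c = \<lparr>desc1 = k1, desc2 = k2, enc = e, dec = d\<rparr>"
  \<comment> \<open>Supports of \<open>memoryless\<close> laws contain only extensional sequences,
    so the support condition on \<open>e\<close> suffices.\<close>
  have e_seq: "e w s1 m \<in> seqs n" if "w \<in> {1..?M}" "m \<in> {1..?B2}" for w s1 m
    using e[OF that, of s1]
    by (auto simp: memoryless_def set_Pi_pmf PiE_dflt_def PiE_iff extensional_def)
  have code: "is_code n R R1 R2 c"
    unfolding is_code_def using k1 k2 e_seq d by (auto simp: c_def Pi_iff)
  have err: "ennreal (measure_pmf.prob (decoded_law pS pY n c w) {w'. w' \<noteq> w}) =
      (\<integral>\<^sup>+s. \<integral>\<^sup>+y. of_bool (d y (snd s) (k1 (fst s)) \<noteq> w)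
        \<partial>measure_pmf (?W (e w (fst s) (k2 (snd s))) (fst s) (snd s)) \<partial>measure_pmf (iid_states n pS))" for w
  proof -
    have "ennreal (measure_pmf.prob (decoded_law pS pY n c w) {w'. w' \<noteq> w}) =
        emeasure (decoded_law pS pY n c w) {w'. w' \<noteq> w}"
      by (simp add: measure_pmf.emeasure_eq_measure)
    also have "\<dots> = (\<integral>\<^sup>+w'. of_bool (w' \<noteq> w) \<partial>decoded_law pS pY n c w)"
    proof -
      have "emeasure (decoded_law pS pY n c w) {w'. w' \<noteq> w} =
          (\<integral>\<^sup>+w'. indicator {w'. w' \<noteq> w} w' \<partial>decoded_law pS pY n c w)"
        by (rule nn_integral_indicator[symmetric]) simp
      also have "\<dots> = (\<integral>\<^sup>+w'. of_bool (w' \<noteq> w) \<partial>decoded_law pS pY n c w)"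
        by (intro nn_integral_cong) (simp add: indicator_def)
      finally show ?thesis .
    qed
    also have "\<dots> = (\<integral>\<^sup>+s. \<integral>\<^sup>+y. of_bool (d y (snd s) (k1 (fst s)) \<noteq> w)
        \<partial>measure_pmf (?W (e w (fst s) (k2 (snd s))) (fst s) (snd s)) \<partial>measure_pmf (iid_states n pS))"
      by (simp add: decoded_law_def Let_def iid_states_def c_def memoryless_def)
    finally show ?thesis .
  qed
  have "ennreal (error_prob pS pY n R c) =
      (\<Sum>w=1..?M. ennreal (measure_pmf.prob (decoded_law pS pY n c w) {w'. w' \<noteq> w})) / of_nat ?M"
    using M unfolding error_prob_def
    by (subst divide_ennreal[symmetric]) (auto simp: sum_nonneg ennreal_of_nat_eq_real_of_nat)
  also have "\<dots> \<le> (of_nat ?M * ?T) / of_nat ?M"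
    using le unfolding err by (rule divide_right_mono_ennreal)
  also have "\<dots> = ?T"
    using M by (simp add: mult.commute[of "of_nat ?M :: ennreal"] mult_divide_eq_ennreal)
  finally show ?thesis using code by blast
qed

section \<open>From single-letter exponents to achievable rates\<close>

lemma set_pmf_joint_law:
  "(s1, s2, v1, v2, u, x, y) \<in> set_pmf (joint_law pS pY pV1 pV2 pU pX) \<longleftrightarrow>
     (s1, s2) \<in> set_pmf pS \<and> v1 \<in> set_pmf (pV1 s1) \<and> v2 \<in> set_pmf (pV2 s2) \<and> u \<in> set_pmf (pU s1 v1 v2) \<and>
     x \<in> set_pmf (pX u s1 v1 v2) \<and> y \<in> set_pmf (pY x s1 s2)"
  unfolding joint_law_def by (auto simp: split_beta) force

text \<open>\<open>D'\<close> must exceed \<open>D\<close> strictly for a tilt to exist, yet cost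
  less than \<open>R\<close> on a fraction \<gamma> of the letters. For positive \<gamma> the choice
  \<open>2 * R / (1 + \<gamma>)\<close> is the harmonic mean of \<open>R\<close> and
  \<open>R / \<gamma>\<close>.\<close>

lemma description_exponent:
  fixes R D :: real
  assumes "R > 0" "D \<le> R" "\<gamma> < 1"
  obtains D' where "D < D'" "0 \<le> D'" "\<gamma> * D' < R"
proof (cases "\<gamma> \<le> 0")
  case True
  then have "\<gamma> * (2 * R) \<le> 0" using assms by (simp add: mult_nonpos_nonneg)
  with assms show ?thesis by (intro that[of "2 * R"]) linarith+
next
  case False
  define D' where "D' = R * (2 / (1 + \<gamma>))"
  have "2 / (1 + \<gamma>) > 1" using False assms by (simp add: field_simps)
  from mult_strict_left_mono[OF this assms(1)] have "D' > R" by (simp add: D'_def)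
  moreover have "\<gamma> * D' < R"
  proof -
    have "\<gamma> * (2 / (1 + \<gamma>)) < 1" using False assms by (simp add: field_simps)
    from mult_strict_left_mono[OF this assms(1)] show ?thesis by (simp add: D'_def mult.left_commute)
  qed
  ultimately show ?thesis using assms by (intro that[of D']) auto
qed

text \<open>The summand \<open>t\<close> in the exponent pays for rounding the number of bins
  down.\<close>

lemma description_term_bound:
  assumes "R \<ge> 0" "D \<ge> 0" "0 < t" "real m \<le> \<gamma> * real n"
  shows "(1 / real (num_indices n R)) powr t * 2 powr (t * D * real m) \<le> 2 powr (t - t * (R - \<gamma> * D) * real n)"
proof -
  let ?B = "num_indices n R"
  have B: "real ?B \<ge> 1" "2 powr (real n * R) \<le> 2 * real ?B"
    using num_indices_bounds[OF assms(1), of n] by auto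
  have "1 / real ?B \<le> 2 powr (1 - real n * R)"
    using B by (simp add: powr_diff field_simps)
  then have "(1 / real ?B) powr t \<le> (2 powr (1 - real n * R)) powr t"
    using B assms by (intro powr_mono2) auto
  also have "\<dots> = 2 powr (t * (1 - real n * R))" by (simp add: powr_powr mult.commute)
  finally have "(1 / real ?B) powr t * 2 powr (t * D * real m) \<le> 2 powr (t * (1 - real n * R)) * 2 powr (t * D * real m)"
    by (rule mult_right_mono) simp
  also have "\<dots> = 2 powr (t * (1 - real n * R) + t * D * real m)" by (simp add: powr_add)
  also have "\<dots> \<le> 2 powr (t - t * (R - \<gamma> * D) * real n)"
  proof (rule powr_mono)
    have "t * D * real m \<le> t * D * (\<gamma> * real n)" using assms by (intro mult_left_mono) auto
    then show "t * (1 - real n * R) + t * D * real m \<le> t - t * (R - \<gamma> * D) * real n"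
      by (simp add: algebra_simps)
  qed simp
  finally show ?thesis .
qed

lemma message_term_bound:
  assumes "R \<ge> 0" "D \<ge> 0" "0 < t" "\<gamma> * real n - 1 \<le> real m"
  shows "real (num_indices n R) powr t * 2 powr (t * (- D) * real m) \<le> 2 powr (t * D - t * (\<gamma> * D - R) * real n)"
proof -
  have "real (num_indices n R) powr t \<le> (2 powr (real n * R)) powr t"
    using num_indices_bounds[OF assms(1), of n] assms by (intro powr_mono2) auto
  also have "\<dots> = 2 powr (t * (real n * R))" by (simp add: powr_powr mult.commute)
  finally have "real (num_indices n R) powr t * 2 powr (t * (- D) * real m) \<le> 2 powr (t * (real n * R)) * 2 powr (t * (- D) * real m)"
    by (rule mult_right_mono) simp
  also have "\<dots> = 2 powr (t * (real n * R) + t * (- D) * real m)" by (simp only: powr_add)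
  also have "\<dots> \<le> 2 powr (t * D - t * (\<gamma> * D - R) * real n)"
  proof (rule powr_mono)
    have "t * D * (\<gamma> * real n - 1) \<le> t * D * real m" using assms by (intro mult_left_mono) auto
    then show "t * (real n * R) + t * (- D) * real m \<le> t * D - t * (\<gamma> * D - R) * real n"
      by (simp add: algebra_simps)
  qed simp
  finally show ?thesis .
qed

lemma error_prob_nonneg: "error_prob pS pY n R c \<ge> 0"
  unfolding error_prob_def by (intro divide_nonneg_nonneg sum_nonneg) auto

text \<open>At description rate zero no exponent can be gained, so the alternative is that both
  parties run identical races. For \<open>V2\<close> they need to agree on possible state pairs
  only; for \<open>V1\<close> the alternative asks for agreement at all arguments, which a constant
  \<open>V1\<close> satisfies.\<close>

lemma achievable_if_exponents:
  fixes pS :: "('s1::finite \<times> 's2::finite) pmf" and pY :: "'x::finite \<Rightarrow> 's1 \<Rightarrow> 's2 \<Rightarrow> 'y::finite pmf"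
    and pV1 :: "'s1 \<Rightarrow> 'v1::finite pmf" and pV2 :: "'s2 \<Rightarrow> 'v2::finite pmf"
    and pU :: "'s1 \<Rightarrow> 'v1 \<Rightarrow> 'v2 \<Rightarrow> 'u::finite pmf" and pX :: "'u \<Rightarrow> 's1 \<Rightarrow> 'v1 \<Rightarrow> 'v2 \<Rightarrow> 'x pmf"
    and dV1 :: "'y \<Rightarrow> 's2 \<Rightarrow> 'v2 \<Rightarrow> 'v1 pmf" and eV2 :: "'s1 \<Rightarrow> 'v2 pmf" and dU :: "'y \<Rightarrow> 's2 \<Rightarrow> 'v1 \<Rightarrow> 'v2 \<Rightarrow> 'u pmf"
    and R R1 R2 :: real
  defines J_def: "J \<equiv> joint_law pS pY pV1 pV2 pU pX"
  assumes pos: "\<And>s1 s2 v1 v2 u x y. (s1, s2, v1, v2, u, x, y) \<in> set_pmf J \<Longrightarrow>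
      pmf (dV1 y s2 v2) v1 > 0 \<and> pmf (eV2 s1) v2 > 0 \<and> pmf (dU y s2 v1 v2) u > 0"
    and h1: "(R1 = 0 \<and> (\<forall>s1 y s2 v2. pV1 s1 = dV1 y s2 v2)) \<or>
      (R1 > 0 \<and> measure_pmf.expectation J (\<lambda>(s1, s2, v1, v2, u, x, y). log 2 (pmf (pV1 s1) v1 / pmf (dV1 y s2 v2) v1)) \<le> R1)"
    and h2: "(R2 = 0 \<and> (\<forall>(s1, s2)\<in>set_pmf pS. pV2 s2 = eV2 s1)) \<or>
      (R2 > 0 \<and> measure_pmf.expectation J (\<lambda>(s1, s2, v1, v2, u, x, y). log 2 (pmf (pV2 s2) v2 / pmf (eV2 s1) v2)) \<le> R2)"
    and R: "R \<ge> 0"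
    and h3: "R < measure_pmf.expectation J (\<lambda>(s1, s2, v1, v2, u, x, y). log 2 (pmf (dU y s2 v1 v2) u / pmf (pU s1 v1 v2) u))"
  shows "achievable pS pY R R1 R2"
proof -
  define D3 where "D3 = measure_pmf.expectation J (\<lambda>(s1, s2, v1, v2, u, x, y). log 2 (pmf (dU y s2 v1 v2) u / pmf (pU s1 v1 v2) u))"
  have D3: "R < D3" using h3 by (simp add: D3_def)
  obtain D3' where D3': "R < D3'" "D3' < D3" using dense[OF D3] by blast
  \<comment> \<open>The midpoint of \<open>R / D3'\<close> and one, so that
    \<open>\<gamma> * D3'\<close> is the midpoint of \<open>R\<close> and \<open>D3'\<close>. The
    gap between \<open>D3'\<close> and \<open>D3\<close> is left for the tilt.\<close>
  define \<gamma> where "\<gamma> = (R / D3' + 1) / 2"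
  have \<gamma>: "0 < \<gamma>" "\<gamma> < 1" "R < \<gamma> * D3'"
    using D3' R by (auto simp: \<gamma>_def field_simps)
  define m where "m n = nat \<lfloor>\<gamma> * real n\<rfloor>" for n
  have m: "real (m n) \<le> \<gamma> * real n" "\<gamma> * real n - 1 \<le> real (m n)" "m n \<le> n" for n
  proof -
    have nn: "\<gamma> * real n \<ge> 0" using \<gamma> by simp
    then have eq: "real (m n) = of_int \<lfloor>\<gamma> * real n\<rfloor>" by (simp add: m_def)
    show 1: "real (m n) \<le> \<gamma> * real n" unfolding eq by simp
    show "\<gamma> * real n - 1 \<le> real (m n)" unfolding eq by linarith
    have "\<gamma> * real n \<le> 1 * real n" using \<gamma> by (intro mult_right_mono) auto
    with 1 show "m n \<le> n" by simp
  qed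
  let ?Jn = "\<lambda>n. block_law n (m n) pS pY pV1 pV2 pU pX"
  define T1 where "T1 n = (\<integral>\<^sup>+(s1, s2, v1, v2, u, x, y). mismatch (1 / real (num_indices n R1)) (memoryless n (pad (m n) pV1) s1)
         (memoryless n (pad (m n) (\<lambda>(y, s2, v2). dV1 y s2 v2)) (\<lambda>i. (y i, s2 i, v2 i))) v1 \<partial>?Jn n)" for n
  define T2 where "T2 n = (\<integral>\<^sup>+(s1, s2, v1, v2, u, x, y). mismatch (1 / real (num_indices n R2)) (memoryless n (pad (m n) pV2) s2)
         (memoryless n (pad (m n) eV2) s1) v2 \<partial>?Jn n)" for n
  define T3 where "T3 n = (\<integral>\<^sup>+(s1, s2, v1, v2, u, x, y). mismatch (real (num_indices n R))
         (memoryless n (pad (m n) (\<lambda>(s1, v1, v2). pU s1 v1 v2)) (\<lambda>i. (s1 i, v1 i, v2 i)))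
         (memoryless n (pad (m n) (\<lambda>(y, s2, v1, v2). dU y s2 v1 v2)) (\<lambda>i. (y i, s2 i, v1 i, v2 i))) u \<partial>?Jn n)" for n
  have R1: "R1 \<ge> 0" and R2: "R2 \<ge> 0" using h1 h2 by auto
  have num: "1 / real (num_indices n r) > 0" "real (num_indices n r) > 0" if "r \<ge> 0" for n r
    using num_indices_bounds(1)[OF that, of n] by auto

  have "\<exists>b. b \<longlonglongrightarrow> 0 \<and> (\<forall>n. b n \<ge> 0 \<and> T1 n \<le> ennreal (b n))"
  proof (cases "R1 = 0")
    case True
    with h1 have eq: "pV1 s1 = dV1 y s2 v2" for s1 y s2 v2 by auto
    have "memoryless n (pad k pV1) s1 = memoryless n (pad k (\<lambda>(y, s2, v2). dV1 y s2 v2)) (\<lambda>i. (y i, s2 i, v2 i))" for n k s1 y s2 v2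
      by (rule memoryless_cong) (simp add: pad_def eq)
    then have "T1 n = 0" for n
      unfolding T1_def using True by (simp add: mismatch_def split_beta')
    then show ?thesis by (intro exI[of _ "\<lambda>_. 0"]) simp
  next
    case False
    let ?P = "\<lambda>(s1, s2, v1, v2, u, x, y). pV1 s1" and ?Q = "\<lambda>(s1, s2, v1, v2, u, x, y). dV1 y s2 v2"
      and ?val = "\<lambda>(s1, s2, v1, v2, u, x, y). v1"
    obtain D where D: "measure_pmf.expectation J (\<lambda>(s1, s2, v1, v2, u, x, y). log 2 (pmf (pV1 s1) v1 / pmf (dV1 y s2 v2) v1)) < D"
      "0 \<le> D" "\<gamma> * D < R1"
      by (rule description_exponent[of R1 _ \<gamma>]) (use False h1 \<gamma> in auto)
    obtain t where t: "0 < t" and le: "\<And>n m c. m \<le> n \<Longrightarrow> c > 0 \<Longrightarrow>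
      (\<integral>\<^sup>+(s1, s2, v1, v2, u, x, y). mismatch c
        (memoryless n (pad m ?P) (\<lambda>i. (s1 i, s2 i, v1 i, v2 i, u i, x i, y i)))
        (memoryless n (pad m ?Q) (\<lambda>i. (s1 i, s2 i, v1 i, v2 i, u i, x i, y i)))
        (\<lambda>i. ?val (s1 i, s2 i, v1 i, v2 i, u i, x i, y i)) \<partial>block_law n m pS pY pV1 pV2 pU pX)
      \<le> ennreal (c powr t * 2 powr (t * D * real m))"
    proof (rule block_mismatch_exponent[of pS pY pV1 pV2 pU pX ?P ?val ?Q D])
      show "pmf (?P \<omega>) (?val \<omega>) > 0 \<and> pmf (?Q \<omega>) (?val \<omega>) > 0"
        if "\<omega> \<in> set_pmf (joint_law pS pY pV1 pV2 pU pX)" for \<omega>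
        using that pos unfolding J_def by (cases \<omega>) (auto simp: set_pmf_joint_law pmf_positive_iff)
    qed (use D(1) in \<open>auto simp: J_def split_beta'\<close>)
    have "T1 n \<le> ennreal (2 powr (t - t * (R1 - \<gamma> * D) * real n))" for n
    proof -
      have "T1 n \<le> ennreal ((1 / real (num_indices n R1)) powr t * 2 powr (t * D * real (m n)))"
        using le[OF m(3)[of n] num(1)[OF R1, of n]]
        by (simp add: T1_def memoryless_def pad_def cong: if_cong)
      also have "\<dots> \<le> ennreal (2 powr (t - t * (R1 - \<gamma> * D) * real n))"
        using description_term_bound[OF R1 D(2) t m(1)] by (rule ennreal_leI)
      finally show ?thesis .
    qed
    moreover have "(\<lambda>n. 2 powr (t - t * (R1 - \<gamma> * D) * real n)) \<longlonglongrightarrow> 0"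
      using t D by (intro two_powr_linear_tendsto_0) simp
    ultimately show ?thesis by (intro exI[of _ "\<lambda>n. 2 powr (t - t * (R1 - \<gamma> * D) * real n)"]) simp
  qed
  then obtain b1 where b1: "b1 \<longlonglongrightarrow> 0" "\<And>n. b1 n \<ge> 0" "\<And>n. T1 n \<le> ennreal (b1 n)" by blast

  have "\<exists>b. b \<longlonglongrightarrow> 0 \<and> (\<forall>n. b n \<ge> 0 \<and> T2 n \<le> ennreal (b n))"
  proof (cases "R2 = 0")
    case True
    with h2 have eq: "pV2 s2 = eV2 s1" if "(s1, s2) \<in> set_pmf pS" for s1 s2 using that by auto
    \<comment> \<open>Agreement is known for state pairs of positive probability, so the integrand
      vanishes on the support of the block law rather than identically.\<close>
    have "T2 n \<le> (\<integral>\<^sup>+(s1, s2, v1, v2, u, x, y). 0 \<partial>?Jn n)" for n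
      unfolding T2_def
    proof (rule nn_integral_pmf_mono)
      fix \<omega> assume "\<omega> \<in> set_pmf (?Jn n)"
      moreover obtain s1 s2 v1 v2 u x y where \<omega>: "\<omega> = (s1, s2, v1, v2, u, x, y)" by (cases \<omega>)
      ultimately have "(s1, s2) \<in> set_pmf (iid_states n pS)"
        by (simp add: block_law_def set_pmf_joint_law)
      then have "(s1 i, s2 i) \<in> set_pmf pS" if "i < n" for i
        using that by (auto simp: iid_states_def set_Pi_pmf PiE_dflt_def)
      then have "memoryless n (pad (m n) pV2) s2 = memoryless n (pad (m n) eV2) s1"
        by (intro memoryless_cong) (simp add: pad_def eq)
      then show "(case \<omega> of (s1, s2, v1, v2, u, x, y) \<Rightarrow> mismatch (1 / real (num_indices n R2)) (memoryless n (pad (m n) pV2) s2)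
         (memoryless n (pad (m n) eV2) s1) v2) \<le> (case \<omega> of (s1, s2, v1, v2, u, x, y) \<Rightarrow> 0)"
        using True by (simp add: \<omega> mismatch_def)
    qed
    then have "T2 n = 0" for n by (simp add: split_beta')
    then show ?thesis by (intro exI[of _ "\<lambda>_. 0"]) simp
  next
    case False
    let ?P = "\<lambda>(s1, s2, v1, v2, u, x, y). pV2 s2" and ?Q = "\<lambda>(s1, s2, v1, v2, u, x, y). eV2 s1"
      and ?val = "\<lambda>(s1, s2, v1, v2, u, x, y). v2"
    obtain D where D: "measure_pmf.expectation J (\<lambda>(s1, s2, v1, v2, u, x, y). log 2 (pmf (pV2 s2) v2 / pmf (eV2 s1) v2)) < D"
      "0 \<le> D" "\<gamma> * D < R2"
      by (rule description_exponent[of R2 _ \<gamma>]) (use False h2 \<gamma> in auto)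
    obtain t where t: "0 < t" and le: "\<And>n m c. m \<le> n \<Longrightarrow> c > 0 \<Longrightarrow>
      (\<integral>\<^sup>+(s1, s2, v1, v2, u, x, y). mismatch c
        (memoryless n (pad m ?P) (\<lambda>i. (s1 i, s2 i, v1 i, v2 i, u i, x i, y i)))
        (memoryless n (pad m ?Q) (\<lambda>i. (s1 i, s2 i, v1 i, v2 i, u i, x i, y i)))
        (\<lambda>i. ?val (s1 i, s2 i, v1 i, v2 i, u i, x i, y i)) \<partial>block_law n m pS pY pV1 pV2 pU pX)
      \<le> ennreal (c powr t * 2 powr (t * D * real m))"
    proof (rule block_mismatch_exponent[of pS pY pV1 pV2 pU pX ?P ?val ?Q D])
      show "pmf (?P \<omega>) (?val \<omega>) > 0 \<and> pmf (?Q \<omega>) (?val \<omega>) > 0"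
        if "\<omega> \<in> set_pmf (joint_law pS pY pV1 pV2 pU pX)" for \<omega>
        using that pos unfolding J_def by (cases \<omega>) (auto simp: set_pmf_joint_law pmf_positive_iff)
    qed (use D(1) in \<open>auto simp: J_def split_beta'\<close>)
    have "T2 n \<le> ennreal (2 powr (t - t * (R2 - \<gamma> * D) * real n))" for n
    proof -
      have "T2 n \<le> ennreal ((1 / real (num_indices n R2)) powr t * 2 powr (t * D * real (m n)))"
        using le[OF m(3)[of n] num(1)[OF R2, of n]]
        by (simp add: T2_def memoryless_def pad_def cong: if_cong)
      also have "\<dots> \<le> ennreal (2 powr (t - t * (R2 - \<gamma> * D) * real n))"
        using description_term_bound[OF R2 D(2) t m(1)] by (rule ennreal_leI)
      finally show ?thesis .
    qed
    moreover have "(\<lambda>n. 2 powr (t - t * (R2 - \<gamma> * D) * real n)) \<longlonglongrightarrow> 0"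
      using t D by (intro two_powr_linear_tendsto_0) simp
    ultimately show ?thesis by (intro exI[of _ "\<lambda>n. 2 powr (t - t * (R2 - \<gamma> * D) * real n)"]) simp
  qed
  then obtain b2 where b2: "b2 \<longlonglongrightarrow> 0" "\<And>n. b2 n \<ge> 0" "\<And>n. T2 n \<le> ennreal (b2 n)" by blast

  have "\<exists>b. b \<longlonglongrightarrow> 0 \<and> (\<forall>n. b n \<ge> 0 \<and> T3 n \<le> ennreal (b n))"
  proof -
    let ?P = "\<lambda>(s1, s2, v1, v2, u, x, y). pU s1 v1 v2" and ?Q = "\<lambda>(s1, s2, v1, v2, u, x, y). dU y s2 v1 v2"
      and ?val = "\<lambda>(s1, s2, v1, v2, u, x, y). u"
    have pos3: "pmf (?P \<omega>) (?val \<omega>) > 0 \<and> pmf (?Q \<omega>) (?val \<omega>) > 0" if "\<omega> \<in> set_pmf J" for \<omega>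
      using that pos unfolding J_def by (cases \<omega>) (auto simp: set_pmf_joint_law pmf_positive_iff)
    \<comment> \<open>Negative, as \<open>D3 > R \<ge> 0\<close>: on average the decoder's law
      favours the true \<open>u\<close>, which pays for the factor contributed by the number of
      messages.\<close>
    have "measure_pmf.expectation J (\<lambda>\<omega>. log 2 (pmf (?P \<omega>) (?val \<omega>) / pmf (?Q \<omega>) (?val \<omega>))) = - D3"
    proof -
      have "measure_pmf.expectation J (\<lambda>\<omega>. log 2 (pmf (?P \<omega>) (?val \<omega>) / pmf (?Q \<omega>) (?val \<omega>))) =
        measure_pmf.expectation J (\<lambda>\<omega>. - log 2 (pmf (?Q \<omega>) (?val \<omega>) / pmf (?P \<omega>) (?val \<omega>)))"
        by (intro integral_cong_AE) (use pos3 in \<open>auto simp: AE_measure_pmf_iff log_divide_pos\<close>)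
      then show ?thesis by (simp add: D3_def split_beta')
    qed
    then have less: "measure_pmf.expectation J (\<lambda>\<omega>. log 2 (pmf (?P \<omega>) (?val \<omega>) / pmf (?Q \<omega>) (?val \<omega>))) < - D3'"
      using D3' by simp
    obtain t where t: "0 < t" and le: "\<And>n m c. m \<le> n \<Longrightarrow> c > 0 \<Longrightarrow>
      (\<integral>\<^sup>+(s1, s2, v1, v2, u, x, y). mismatch c
        (memoryless n (pad m ?P) (\<lambda>i. (s1 i, s2 i, v1 i, v2 i, u i, x i, y i)))
        (memoryless n (pad m ?Q) (\<lambda>i. (s1 i, s2 i, v1 i, v2 i, u i, x i, y i)))
        (\<lambda>i. ?val (s1 i, s2 i, v1 i, v2 i, u i, x i, y i)) \<partial>block_law n m pS pY pV1 pV2 pU pX)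
      \<le> ennreal (c powr t * 2 powr (t * (- D3') * real m))"
      by (rule block_mismatch_exponent[of pS pY pV1 pV2 pU pX ?P ?val ?Q "- D3'"])
        (use pos3 less in \<open>auto simp: J_def\<close>)
    have D3'_nn: "D3' \<ge> 0" using D3' R by simp
    have "T3 n \<le> ennreal (2 powr (t * D3' - t * (\<gamma> * D3' - R) * real n))" for n
    proof -
      have "T3 n \<le> ennreal (real (num_indices n R) powr t * 2 powr (t * (- D3') * real (m n)))"
        using le[OF m(3)[of n] num(2)[OF R, of n]]
        by (simp add: T3_def memoryless_def pad_def cong: if_cong)
      also have "\<dots> \<le> ennreal (2 powr (t * D3' - t * (\<gamma> * D3' - R) * real n))"
        using message_term_bound[OF R D3'_nn t m(2)] by (rule ennreal_leI)
      finally show ?thesis .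
    qed
    moreover have "(\<lambda>n. 2 powr (t * D3' - t * (\<gamma> * D3' - R) * real n)) \<longlonglongrightarrow> 0"
      using t \<gamma> by (intro two_powr_linear_tendsto_0) simp
    ultimately show ?thesis by (intro exI[of _ "\<lambda>n. 2 powr (t * D3' - t * (\<gamma> * D3' - R) * real n)"]) simp
  qed
  then obtain b3 where b3: "b3 \<longlonglongrightarrow> 0" "\<And>n. b3 n \<ge> 0" "\<And>n. T3 n \<le> ennreal (b3 n)" by blast

  have "\<exists>c. is_code n R R1 R2 c \<and> error_prob pS pY n R c \<le> b1 n + b2 n + b3 n" for n
  proof -
    have "\<exists>c. is_code n R R1 R2 c \<and> ennreal (error_prob pS pY n R c) \<le> T1 n + T2 n + T3 n"
      unfolding T1_def T2_def T3_def by (rule block_code[OF R R1 R2])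
    then obtain c where c: "is_code n R R1 R2 c" and "ennreal (error_prob pS pY n R c) \<le> T1 n + T2 n + T3 n"
      by blast
    note this(2)
    also have "T1 n + T2 n + T3 n \<le> ennreal (b1 n) + ennreal (b2 n) + ennreal (b3 n)"
      by (intro add_mono b1 b2 b3)
    also have "\<dots> = ennreal (b1 n + b2 n + b3 n)" using b1 b2 b3 by simp
    finally have "error_prob pS pY n R c \<le> b1 n + b2 n + b3 n"
      using b1 b2 b3 by (subst (asm) ennreal_le_iff) auto
    with c show ?thesis by blast
  qed
  then have "\<exists>c. \<forall>n. is_code n R R1 R2 (c n) \<and> error_prob pS pY n R (c n) \<le> b1 n + b2 n + b3 n"
    by (intro choice allI)
  then obtain c where c: "\<And>n. is_code n R R1 R2 (c n)" "\<And>n. error_prob pS pY n R (c n) \<le> b1 n + b2 n + b3 n"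
    by blast
  have lim: "(\<lambda>n. b1 n + b2 n + b3 n) \<longlonglongrightarrow> 0"
    using tendsto_add[OF tendsto_add[OF b1(1) b2(1)] b3(1)] by simp
  have "(\<lambda>n. error_prob pS pY n R (c n)) \<longlonglongrightarrow> 0"
  proof (rule tendsto_sandwich[OF _ _ tendsto_const lim])
    show "\<forall>\<^sub>F n in sequentially. 0 \<le> error_prob pS pY n R (c n)" by (simp add: error_prob_nonneg)
    show "\<forall>\<^sub>F n in sequentially. error_prob pS pY n R (c n) \<le> b1 n + b2 n + b3 n" using c(2) by simp
  qed
  with c(1) show ?thesis unfolding achievable_def by blast
qed

section \<open>Zero description rates\<close>

lemma pmf_bind_map_Pair:
  "pmf (bind_pmf p (\<lambda>a. map_pmf (Pair a) (k a))) (a, b) = pmf p a * pmf (k a) b"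
proof -
  have "pmf (map_pmf (Pair a') (k a')) (a, b) = indicator {a} a' * pmf (k a) b" for a'
  proof (cases "a' = a")
    case True
    then show ?thesis by (simp add: pmf_map_inj' inj_on_def)
  next
    case False
    then have "Pair a' -` {(a, b)} = {}" by auto
    with False show ?thesis by (simp add: pmf_map)
  qed
  then show ?thesis by (simp add: pmf_bind measure_pmf_single)
qed

text \<open>Agreement on the support of \<open>p\<close> already gives \<open>q\<close> total mass
  one there, so nothing is left elsewhere.\<close>

lemma pmf_eq_if_agree_on_support:
  fixes p q :: "'a::finite pmf"
  assumes "\<And>v. v \<in> set_pmf p \<Longrightarrow> pmf q v = pmf p v"
  shows "p = q"
proof (rule pmf_eqI)
  fix v
  have "(\<Sum>v\<in>UNIV. pmf q v) = 1" "(\<Sum>v\<in>set_pmf p. pmf p v) = 1"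
    by (rule sum_pmf_eq_1; simp)+
  moreover have "(\<Sum>v\<in>set_pmf p. pmf q v) = (\<Sum>v\<in>set_pmf p. pmf p v)"
    using assms by (intro sum.cong) auto
  moreover have "(\<Sum>v\<in>UNIV. pmf q v) = (\<Sum>v\<in>- set_pmf p. pmf q v) + (\<Sum>v\<in>set_pmf p. pmf q v)"
    by (subst sum.subset_diff[of "set_pmf p"]) (auto simp: Compl_eq_Diff_UNIV)
  ultimately have "(\<Sum>v\<in>- set_pmf p. pmf q v) = 0" by simp
  then have "\<forall>v\<in>- set_pmf p. pmf q v = 0" by (subst (asm) sum_nonneg_eq_0_iff) auto
  then show "pmf p v = pmf q v"
    using assms by (cases "v \<in> set_pmf p") (auto simp: set_pmf_iff)
qed

text \<open>The expectation is an average of divergences of \<open>eV2 s1\<close> from \<open>pV2 s2\<close>, so this is the equality case of Gibbs' inequality.\<close>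

lemma kernels_eq_if_expectation_log_nonpos:
  fixes pS :: "('s1::finite \<times> 's2::finite) pmf" and pY :: "'x::finite \<Rightarrow> 's1 \<Rightarrow> 's2 \<Rightarrow> 'y::finite pmf"
    and pV1 :: "'s1 \<Rightarrow> 'v1::finite pmf" and pV2 :: "'s2 \<Rightarrow> 'v2::finite pmf"
    and pU :: "'s1 \<Rightarrow> 'v1 \<Rightarrow> 'v2 \<Rightarrow> 'u::finite pmf" and pX :: "'u \<Rightarrow> 's1 \<Rightarrow> 'v1 \<Rightarrow> 'v2 \<Rightarrow> 'x pmf"
    and eV2 :: "'s1 \<Rightarrow> 'v2 pmf"
  defines J_def: "J \<equiv> joint_law pS pY pV1 pV2 pU pX"
  assumes pos: "\<And>s1 s2 v1 v2 u x y. (s1, s2, v1, v2, u, x, y) \<in> set_pmf J \<Longrightarrow> pmf (eV2 s1) v2 > 0"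
    and le: "measure_pmf.expectation J (\<lambda>(s1, s2, v1, v2, u, x, y). log 2 (pmf (pV2 s2) v2 / pmf (eV2 s1) v2)) \<le> 0"
    and s: "(s1, s2) \<in> set_pmf pS"
  shows "pV2 s2 = eV2 s1"
proof (rule pmf_eq_if_agree_on_support)
  fix v2 assume v2: "v2 \<in> set_pmf (pV2 s2)"
  define p where "p \<omega> = (case \<omega> of (s1, s2, v1, v2, u, x, y) \<Rightarrow> pmf (pV2 s2) v2)" for \<omega> :: "'s1 \<times> 's2 \<times> 'v1 \<times> 'v2 \<times> 'u \<times> 'x \<times> 'y"
  define q where "q \<omega> = (case \<omega> of (s1, s2, v1, v2, u, x, y) \<Rightarrow> pmf (eV2 s1) v2)" for \<omega> :: "'s1 \<times> 's2 \<times> 'v1 \<times> 'v2 \<times> 'u \<times> 'x \<times> 'y"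
  \<comment> \<open>The gap in \<open>ln x \<le> x - 1\<close> at \<open>x = q / p\<close>,
    nonnegative and zero only for \<open>x = 1\<close>. Its expectation is at most zero:
    \<open>E (q / p) \<le> 1\<close>, because only the support of the sender's law is summed, and
    \<open>E (ln (q / p)) \<ge> 0\<close> by assumption.\<close>
  define f where "f \<omega> = q \<omega> / p \<omega> - 1 - ln (q \<omega> / p \<omega>)" for \<omega>
  have int: "integrable (measure_pmf J) g" for g :: "_ \<Rightarrow> real"
    by (rule integrable_measure_pmf_finite) simp
  have pq_pos: "p \<omega> > 0 \<and> q \<omega> > 0" if "\<omega> \<in> set_pmf J" for \<omega>
    using that pos unfolding p_def q_def J_def
    by (cases \<omega>) (auto simp: set_pmf_joint_law pmf_positive_iff)
  have f_nonneg: "f \<omega> \<ge> 0" if "\<omega> \<in> set_pmf J" for \<omega>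
    using ln_le_minus_one[of "q \<omega> / p \<omega>"] pq_pos[OF that] by (simp add: f_def)
  have "(\<integral>\<^sup>+\<omega>. ennreal (q \<omega> / p \<omega>) \<partial>J) \<le> 1"
  proof -
    have inner: "(\<integral>\<^sup>+v. ennreal (pmf b v / pmf a v) \<partial>measure_pmf a) \<le> 1" for a b :: "'v2 pmf"
    proof -
      have "(\<integral>\<^sup>+v. ennreal (pmf b v / pmf a v) \<partial>measure_pmf a) = (\<Sum>v\<in>set_pmf a. ennreal (pmf b v))"
        by (subst nn_integral_measure_pmf_finite)
          (auto simp: ennreal_mult[symmetric] set_pmf_iff intro!: sum.cong)
      also have "\<dots> = ennreal (\<Sum>v\<in>set_pmf a. pmf b v)" by simp
      finally have eq: "(\<integral>\<^sup>+v. ennreal (pmf b v / pmf a v) \<partial>measure_pmf a) = ennreal (\<Sum>v\<in>set_pmf a. pmf b v)" .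
      have "(\<Sum>v\<in>set_pmf a. pmf b v) \<le> (\<Sum>v\<in>UNIV. pmf b v)"
        by (rule sum_mono2) auto
      also have "(\<Sum>v\<in>UNIV. pmf b v) = 1" by (rule sum_pmf_eq_1) auto
      finally show ?thesis unfolding eq by simp
    qed
    have "(\<integral>\<^sup>+\<omega>. ennreal (q \<omega> / p \<omega>) \<partial>J) =
        (\<integral>\<^sup>+s. \<integral>\<^sup>+v2. ennreal (pmf (eV2 (fst s)) v2 / pmf (pV2 (snd s)) v2) \<partial>pV2 (snd s) \<partial>pS)"
      by (simp add: J_def joint_law_def split_beta p_def q_def)
    also have "\<dots> \<le> 1" by (intro nn_integral_pmf_le_const inner)
    finally show ?thesis .
  qed
  moreover have "(\<integral>\<^sup>+\<omega>. ennreal (q \<omega> / p \<omega>) \<partial>J) = ennreal (measure_pmf.expectation J (\<lambda>\<omega>. q \<omega> / p \<omega>))"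
    using pq_pos by (intro nn_integral_eq_integral int) (auto simp: AE_measure_pmf_iff less_imp_le)
  ultimately have "measure_pmf.expectation J (\<lambda>\<omega>. q \<omega> / p \<omega>) \<le> 1" by simp
  moreover have "measure_pmf.expectation J (\<lambda>\<omega>. ln (q \<omega> / p \<omega>)) =
      measure_pmf.expectation J (\<lambda>\<omega>. - ln 2 * log 2 (p \<omega> / q \<omega>))"
    using pq_pos by (intro integral_cong_AE) (auto simp: AE_measure_pmf_iff log_def ln_div)
  moreover have "measure_pmf.expectation J (\<lambda>\<omega>. - ln 2 * log 2 (p \<omega> / q \<omega>)) =
      - ln 2 * measure_pmf.expectation J (\<lambda>\<omega>. log 2 (p \<omega> / q \<omega>))"
    by (rule integral_mult_right_zero)
  moreover have "measure_pmf.expectation J (\<lambda>\<omega>. log 2 (p \<omega> / q \<omega>)) \<le> 0"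
    using le by (simp add: p_def q_def split_beta')
  then have "- ln 2 * measure_pmf.expectation J (\<lambda>\<omega>. log 2 (p \<omega> / q \<omega>)) \<ge> 0"
    by (simp add: mult_nonneg_nonpos)
  moreover have "measure_pmf.expectation J f = measure_pmf.expectation J (\<lambda>\<omega>. q \<omega> / p \<omega>) - 1
      - measure_pmf.expectation J (\<lambda>\<omega>. ln (q \<omega> / p \<omega>))"
    unfolding f_def by (simp add: int Bochner_Integration.integral_diff)
  ultimately have "measure_pmf.expectation J f \<le> 0" by linarith
  moreover have "measure_pmf.expectation J f \<ge> 0"
    using f_nonneg by (intro integral_nonneg_AE) (auto simp: AE_measure_pmf_iff)
  ultimately have "AE \<omega> in J. f \<omega> = 0"
    using f_nonneg by (subst integral_nonneg_eq_0_iff_AE[symmetric]) (auto simp: AE_measure_pmf_iff int)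
  then have f0: "f \<omega> = 0" if "\<omega> \<in> set_pmf J" for \<omega> using that by (auto simp: AE_measure_pmf_iff)
  \<comment> \<open>Any \<open>v2\<close> in the support of \<open>pV2 s2\<close> extends to a full
    letter of positive probability, at which \<open>f\<close> is known to vanish.\<close>
  obtain v1 u x y where "(s1, s2, v1, v2, u, x, y) \<in> set_pmf J"
  proof -
    obtain v1 where v1: "v1 \<in> set_pmf (pV1 s1)" using set_pmf_not_empty by fast
    obtain u where u: "u \<in> set_pmf (pU s1 v1 v2)" using set_pmf_not_empty by fast
    obtain x where x: "x \<in> set_pmf (pX u s1 v1 v2)" using set_pmf_not_empty by fast
    obtain y where y: "y \<in> set_pmf (pY x s1 s2)" using set_pmf_not_empty by fast
    show ?thesis using that[of v1 u x y] s v1 v2 u x y by (simp add: J_def set_pmf_joint_law)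
  qed
  from f0[OF this] pq_pos[OF this] have "q (s1, s2, v1, v2, u, x, y) / p (s1, s2, v1, v2, u, x, y) = 1"
    unfolding f_def by (intro ln_eq_minus_one) auto
  then show "pmf (eV2 s1) v2 = pmf (pV2 s2) v2" by (simp add: p_def q_def)
qed

text \<open>The new input kernel reads \<open>v1\<close> from the pair, so input and output are
  unchanged. Drawing \<open>v1\<close> after \<open>v2\<close> is legitimate because its law depends
  on \<open>s1\<close> alone.\<close>

lemma joint_law_absorb_V1:
  "joint_law pS pY (\<lambda>_. return_pmf ()) pV2 (\<lambda>s1 _ v2. bind_pmf (pV1 s1) (\<lambda>v1. map_pmf (Pair v1) (pU s1 v1 v2)))
     (\<lambda>vu s1 _ v2. pX (snd vu) s1 (fst vu) v2) =
   map_pmf (\<lambda>(s1, s2, v1, v2, u, x, y). (s1, s2, (), v2, (v1, u), x, y)) (joint_law pS pY pV1 pV2 pU pX)"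
  unfolding joint_law_def
  by (auto simp: map_bind_pmf bind_map_pmf bind_assoc_pmf bind_return_pmf split_beta bind_commute_pmf[of "pV2 _"]
      intro!: bind_pmf_cong)

text \<open>The two zero rates behave differently. Given the states, \<open>v2\<close> has law
  \<open>pV2 s2\<close>, so its expectation is an average divergence and a bound of zero forces
  equality. The comparison law of \<open>v1\<close> also sees \<open>y\<close>, which may depend on
  \<open>v1\<close>; that expectation can be negative and forces no equality, so \<open>V1\<close>
  is absorbed instead.\<close>

lemma achievable_if_expectations:
  fixes pS :: "('s1::finite \<times> 's2::finite) pmf" and pY :: "'x::finite \<Rightarrow> 's1 \<Rightarrow> 's2 \<Rightarrow> 'y::finite pmf"
    and pV1 :: "'s1 \<Rightarrow> 'v1::finite pmf" and pV2 :: "'s2 \<Rightarrow> 'v2::finite pmf"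
    and pU :: "'s1 \<Rightarrow> 'v1 \<Rightarrow> 'v2 \<Rightarrow> 'u::finite pmf" and pX :: "'u \<Rightarrow> 's1 \<Rightarrow> 'v1 \<Rightarrow> 'v2 \<Rightarrow> 'x pmf"
    and dV1 :: "'y \<Rightarrow> 's2 \<Rightarrow> 'v2 \<Rightarrow> 'v1 pmf" and eV2 :: "'s1 \<Rightarrow> 'v2 pmf" and dU :: "'y \<Rightarrow> 's2 \<Rightarrow> 'v1 \<Rightarrow> 'v2 \<Rightarrow> 'u pmf"
    and R R1 R2 :: real
  defines J_def: "J \<equiv> joint_law pS pY pV1 pV2 pU pX"
  assumes pos: "\<And>s1 s2 v1 v2 u x y. (s1, s2, v1, v2, u, x, y) \<in> set_pmf J \<Longrightarrow>
      pmf (dV1 y s2 v2) v1 > 0 \<and> pmf (eV2 s1) v2 > 0 \<and> pmf (dU y s2 v1 v2) u > 0"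
    and R1: "R1 \<ge> 0" and R2: "R2 \<ge> 0" and R: "R \<ge> 0"
    and h1: "measure_pmf.expectation J (\<lambda>(s1, s2, v1, v2, u, x, y). log 2 (pmf (pV1 s1) v1 / pmf (dV1 y s2 v2) v1)) \<le> R1"
    and h2: "measure_pmf.expectation J (\<lambda>(s1, s2, v1, v2, u, x, y). log 2 (pmf (pV2 s2) v2 / pmf (eV2 s1) v2)) \<le> R2"
    and h3: "R < measure_pmf.expectation J (\<lambda>(s1, s2, v1, v2, u, x, y). log 2 (pmf (dU y s2 v1 v2) u / pmf (pU s1 v1 v2) u))"
  shows "achievable pS pY R R1 R2"
proof -
  have eq2: "R2 = 0 \<Longrightarrow> \<forall>(s1, s2)\<in>set_pmf pS. pV2 s2 = eV2 s1"
    using kernels_eq_if_expectation_log_nonpos[of pS pY pV1 pV2 pU pX eV2] pos h2 unfolding J_def by blast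
  show ?thesis
  proof (cases "R1 = 0")
    case False
    show ?thesis
      by (rule achievable_if_exponents[of pS pY pV1 pV2 pU pX dV1 eV2 dU R1 R2 R])
        (use False R1 R2 R pos h1 h2 h3 eq2 in \<open>auto simp: J_def less_le\<close>)
  next
    case True
    define pU' where "pU' = (\<lambda>s1 (_::unit) v2. bind_pmf (pV1 s1) (\<lambda>v1. map_pmf (Pair v1) (pU s1 v1 v2)))"
    define dU' where "dU' = (\<lambda>y s2 (_::unit) v2. bind_pmf (dV1 y s2 v2) (\<lambda>v1. map_pmf (Pair v1) (dU y s2 v1 v2)))"
    define J' where "J' = joint_law pS pY (\<lambda>_. return_pmf ()) pV2 pU' (\<lambda>vu s1 _ v2. pX (snd vu) s1 (fst vu) v2)"
    let ?absorb = "\<lambda>(s1, s2, v1, v2, u, x, y). (s1, s2, (), v2, (v1, u), x, y)"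
    have J': "J' = map_pmf ?absorb J"
      unfolding J'_def J_def pU'_def by (rule joint_law_absorb_V1)
    have pmf_dU': "pmf (dU' y s2 a v2) (v1, u) = pmf (dV1 y s2 v2) v1 * pmf (dU y s2 v1 v2) u" for y s2 a v1 v2 u
      by (simp add: dU'_def pmf_bind_map_Pair)
    have pmf_pU': "pmf (pU' s1 a v2) (v1, u) = pmf (pV1 s1) v1 * pmf (pU s1 v1 v2) u" for s1 a v1 v2 u
      by (simp add: pU'_def pmf_bind_map_Pair)
    have int: "integrable (measure_pmf J) g" for g :: "_ \<Rightarrow> real"
      by (rule integrable_measure_pmf_finite) simp
    show ?thesis
    proof (rule achievable_if_exponents[of pS pY "\<lambda>_. return_pmf ()" pV2 pU' "\<lambda>vu s1 _ v2. pX (snd vu) s1 (fst vu) v2"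
          "\<lambda>_ _ _. return_pmf ()" eV2 dU' R1 R2 R, folded J'_def])
      show "pmf (return_pmf ()) v1 > 0 \<and> pmf (eV2 s1) v2 > 0 \<and> pmf (dU' y s2 v1 v2) u > 0"
        if "(s1, s2, v1, v2, u, x, y) \<in> set_pmf J'" for s1 s2 v1 v2 u x y
        using that pos unfolding J' by (auto simp: pmf_dU')
      show "R1 = 0 \<and> (\<forall>s1 y s2 v2. return_pmf () = return_pmf ()) \<or> 0 < R1 \<and>
          measure_pmf.expectation J' (\<lambda>(s1, s2, v1, v2, u, x, y). log 2 (pmf (return_pmf ()) v1 / pmf (return_pmf ()) v1)) \<le> R1"
        using True by simp
      show "R2 = 0 \<and> (\<forall>(s1, s2)\<in>set_pmf pS. pV2 s2 = eV2 s1) \<or> 0 < R2 \<and>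
          measure_pmf.expectation J' (\<lambda>(s1, s2, v1, v2, u, x, y). log 2 (pmf (pV2 s2) v2 / pmf (eV2 s1) v2)) \<le> R2"
        using eq2 h2 R2 unfolding J' by (auto simp: split_beta' less_le)
      show "0 \<le> R" by fact
      \<comment> \<open>Both laws of the pair factorise, so the new log ratio is the old one minus
        that of \<open>V1\<close>, whose expectation is at most \<open>R1 = 0\<close>.\<close>
      have "measure_pmf.expectation J (\<lambda>(s1, s2, v1, v2, u, x, y). log 2 (pmf (dU y s2 v1 v2) u / pmf (pU s1 v1 v2) u)) \<le>
        measure_pmf.expectation J (\<lambda>(s1, s2, v1, v2, u, x, y). log 2 (pmf (dU y s2 v1 v2) u / pmf (pU s1 v1 v2) u))
        - measure_pmf.expectation J (\<lambda>(s1, s2, v1, v2, u, x, y). log 2 (pmf (pV1 s1) v1 / pmf (dV1 y s2 v2) v1))"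
        using h1 True by simp
      also have "\<dots> = measure_pmf.expectation J (\<lambda>(s1, s2, v1, v2, u, x, y).
          log 2 (pmf (dU y s2 v1 v2) u / pmf (pU s1 v1 v2) u) - log 2 (pmf (pV1 s1) v1 / pmf (dV1 y s2 v2) v1))"
        by (subst Bochner_Integration.integral_diff[symmetric, OF int int]) (simp add: split_beta')
      also have "\<dots> = measure_pmf.expectation J (\<lambda>(s1, s2, v1, v2, u, x, y).
          log 2 (pmf (dU' y s2 () v2) (v1, u) / pmf (pU' s1 () v2) (v1, u)))"
      proof (rule integral_cong_AE)
        have "log 2 (pmf (dU y s2 v1 v2) u / pmf (pU s1 v1 v2) u) - log 2 (pmf (pV1 s1) v1 / pmf (dV1 y s2 v2) v1) =
            log 2 (pmf (dU' y s2 () v2) (v1, u) / pmf (pU' s1 () v2) (v1, u))"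
          if "(s1, s2, v1, v2, u, x, y) \<in> set_pmf J" for s1 s2 v1 v2 u x y
        proof -
          have "pmf (dV1 y s2 v2) v1 > 0" "pmf (dU y s2 v1 v2) u > 0" "pmf (pV1 s1) v1 > 0" "pmf (pU s1 v1 v2) u > 0"
            using that pos by (auto simp: J_def set_pmf_joint_law pmf_positive_iff)
          then show ?thesis by (simp add: pmf_dU' pmf_pU' log_divide_pos log_mult_pos)
        qed
        then show "AE \<omega> in measure_pmf J. (case \<omega> of (s1, s2, v1, v2, u, x, y) \<Rightarrow>
            log 2 (pmf (dU y s2 v1 v2) u / pmf (pU s1 v1 v2) u) - log 2 (pmf (pV1 s1) v1 / pmf (dV1 y s2 v2) v1)) =
          (case \<omega> of (s1, s2, v1, v2, u, x, y) \<Rightarrow> log 2 (pmf (dU' y s2 () v2) (v1, u) / pmf (pU' s1 () v2) (v1, u)))"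
          by (auto simp: AE_measure_pmf_iff)
      qed auto
      also have "\<dots> = measure_pmf.expectation J' (\<lambda>(s1, s2, v1, v2, u, x, y). log 2 (pmf (dU' y s2 v1 v2) u / pmf (pU' s1 v1 v2) u))"
        unfolding J' by (simp add: split_beta')
      finally show "R < \<dots>" using h3 by simp
    qed
  qed
qed

section \<open>Mutual information and the capacity bound\<close>

text \<open>The conditional probability of the value of \<open>A\<close> given that of
  \<open>B\<close>, as a random variable. Information quantities become expectations of logarithms
  of quotients of such variables.\<close>

definition cond_prob_at :: "'w pmf \<Rightarrow> ('w \<Rightarrow> 'a) \<Rightarrow> ('w \<Rightarrow> 'b) \<Rightarrow> 'w \<Rightarrow> real" where
  "cond_prob_at J A B \<omega> = pmf (map_pmf (\<lambda>\<omega>. (A \<omega>, B \<omega>)) J) (A \<omega>, B \<omega>) / pmf (map_pmf B J) (B \<omega>)"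

lemma pmf_map_at_pos:
  assumes "\<omega> \<in> set_pmf J"
  shows "pmf (map_pmf f J) (f \<omega>) > 0"
  using assms by (auto simp: pmf_positive_iff)

lemma cond_prob_at_pos:
  assumes "\<omega> \<in> set_pmf J"
  shows "cond_prob_at J A B \<omega> > 0"
  unfolding cond_prob_at_def
  using pmf_map_at_pos[OF assms, of B] pmf_map_at_pos[OF assms, of "\<lambda>\<omega>. (A \<omega>, B \<omega>)"] by simp

lemma simple_distributed_pmf:
  fixes J :: "'w::finite pmf"
  shows "simple_distributed (measure_pmf J) A (pmf (map_pmf A J))"
proof (rule prob_space.simple_distributedI[OF prob_space_measure_pmf])
  show "simple_function (measure_pmf J) A" by (simp add: simple_function_def)
qed (auto simp: pmf_map)

lemma sum_range_eq_expectation: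
  fixes J :: "'w::finite pmf"
  shows "(\<Sum>z\<in>range A. pmf (map_pmf A J) z * g z) = measure_pmf.expectation J (\<lambda>\<omega>. g (A \<omega>) :: real)"
proof -
  have "measure_pmf.expectation (map_pmf A J) g = (\<Sum>z\<in>range A. pmf (map_pmf A J) z * g z)"
    by (subst integral_measure_pmf_real[of "range A"]) (auto simp: mult.commute)
  then show ?thesis by simp
qed

lemma mut_info_eq_expectation:
  fixes J :: "'w::finite pmf"
  shows "mut_info J A B = measure_pmf.expectation J (\<lambda>\<omega>. log 2 (cond_prob_at J A B \<omega> / pmf (map_pmf A J) (A \<omega>)))"
proof -
  interpret information_space "measure_pmf J" 2
    by (intro information_space.intro prob_space_measure_pmf information_space_axioms.intro) simp
  have "mut_info J A B = (\<Sum>z\<in>range (\<lambda>\<omega>. (A \<omega>, B \<omega>)). pmf (map_pmf (\<lambda>\<omega>. (A \<omega>, B \<omega>)) J) z *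
      log 2 (pmf (map_pmf (\<lambda>\<omega>. (A \<omega>, B \<omega>)) J) z / (pmf (map_pmf A J) (fst z) * pmf (map_pmf B J) (snd z))))"
    using mutual_information_simple_distributed[OF simple_distributed_pmf[of J A] simple_distributed_pmf[of J B]
        simple_distributed_pmf[of J "\<lambda>\<omega>. (A \<omega>, B \<omega>)"]]
    by (simp add: mut_info_def split_beta')
  also have "\<dots> = measure_pmf.expectation J (\<lambda>\<omega>. log 2 (cond_prob_at J A B \<omega> / pmf (map_pmf A J) (A \<omega>)))"
    unfolding sum_range_eq_expectation by (simp add: cond_prob_at_def mult.commute)
  finally show ?thesis .
qed

lemma cond_mut_info_eq_expectation:
  fixes J :: "'w::finite pmf"
  shows "cond_mut_info J A B C =
    measure_pmf.expectation J (\<lambda>\<omega>. log 2 (cond_prob_at J A (\<lambda>\<omega>. (B \<omega>, C \<omega>)) \<omega> / cond_prob_at J A C \<omega>))"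
proof -
  interpret information_space "measure_pmf J" 2
    by (intro information_space.intro prob_space_measure_pmf information_space_axioms.intro) simp
  have "cond_mut_info J A B C = (\<Sum>z\<in>range (\<lambda>\<omega>. (A \<omega>, B \<omega>, C \<omega>)). pmf (map_pmf (\<lambda>\<omega>. (A \<omega>, B \<omega>, C \<omega>)) J) z *
      log 2 (pmf (map_pmf (\<lambda>\<omega>. (A \<omega>, B \<omega>, C \<omega>)) J) z / (pmf (map_pmf (\<lambda>\<omega>. (A \<omega>, C \<omega>)) J) (fst z, snd (snd z)) *
        (pmf (map_pmf (\<lambda>\<omega>. (B \<omega>, C \<omega>)) J) (snd z) / pmf (map_pmf C J) (snd (snd z))))))"
    using conditional_mutual_information_eq[OF simple_distributed_pmf[of J C] simple_distributed_pmf[of J "\<lambda>\<omega>. (B \<omega>, C \<omega>)"]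
        simple_distributed_pmf[of J "\<lambda>\<omega>. (A \<omega>, C \<omega>)"] simple_distributed_pmf[of J "\<lambda>\<omega>. (A \<omega>, B \<omega>, C \<omega>)"]]
    by (simp add: cond_mut_info_def split_beta')
  also have "\<dots> = measure_pmf.expectation J
      (\<lambda>\<omega>. log 2 (cond_prob_at J A (\<lambda>\<omega>. (B \<omega>, C \<omega>)) \<omega> / cond_prob_at J A C \<omega>))"
    unfolding sum_range_eq_expectation by (simp add: cond_prob_at_def mult.commute)
  finally show ?thesis .
qed

text \<open>In a difference of two informations about the same variable its prior,
  \<open>p(a)\<close> or \<open>p(a|d)\<close>, cancels. What remains is the quotient of two
  conditional laws, the likelihood ratio that governs a race.\<close>

lemma expectation_log_ratio_diff:
  fixes J :: "'w::finite pmf" and a b c :: "'w \<Rightarrow> real"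
  assumes "\<And>\<omega>. \<omega> \<in> set_pmf J \<Longrightarrow> a \<omega> > 0 \<and> b \<omega> > 0 \<and> c \<omega> > 0"
  shows "measure_pmf.expectation J (\<lambda>\<omega>. log 2 (a \<omega> / c \<omega>)) - measure_pmf.expectation J (\<lambda>\<omega>. log 2 (b \<omega> / c \<omega>))
    = measure_pmf.expectation J (\<lambda>\<omega>. log 2 (a \<omega> / b \<omega>))"
proof -
  have int: "integrable (measure_pmf J) g" for g :: "_ \<Rightarrow> real"
    by (rule integrable_measure_pmf_finite) simp
  show ?thesis
    by (subst Bochner_Integration.integral_diff[symmetric, OF int int], rule integral_cong_AE)
      (use assms in \<open>auto simp: AE_measure_pmf_iff log_divide_pos\<close>)
qed

lemma mut_info_diff:
  fixes J :: "'w::finite pmf"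
  shows "mut_info J A B - mut_info J A C =
    measure_pmf.expectation J (\<lambda>\<omega>. log 2 (cond_prob_at J A B \<omega> / cond_prob_at J A C \<omega>))"
  unfolding mut_info_eq_expectation
  by (rule expectation_log_ratio_diff) (simp add: cond_prob_at_pos pmf_map_at_pos)

lemma cond_mut_info_diff:
  fixes J :: "'w::finite pmf"
  shows "cond_mut_info J A B D - cond_mut_info J A C D =
    measure_pmf.expectation J (\<lambda>\<omega>. log 2 (cond_prob_at J A (\<lambda>\<omega>. (B \<omega>, D \<omega>)) \<omega> / cond_prob_at J A (\<lambda>\<omega>. (C \<omega>, D \<omega>)) \<omega>))"
  unfolding cond_mut_info_eq_expectation
  by (rule expectation_log_ratio_diff) (simp add: cond_prob_at_pos)

text \<open>An observation of probability zero gets an unspecified law; the positivity conditions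
  and expectations concern supported letters only.\<close>

definition posterior :: "'w pmf \<Rightarrow> ('w \<Rightarrow> 'a) \<Rightarrow> ('w \<Rightarrow> 'b) \<Rightarrow> 'b \<Rightarrow> 'a pmf" where
  "posterior J A B b = map_pmf A (cond_pmf J {\<omega>. B \<omega> = b})"

lemma pmf_posterior:
  assumes "\<omega> \<in> set_pmf J"
  shows "pmf (posterior J A B (B \<omega>)) (A \<omega>) = cond_prob_at J A B \<omega>"
proof -
  have ne: "set_pmf J \<inter> {\<omega>'. B \<omega>' = B \<omega>} \<noteq> {}" using assms by auto
  have "pmf (posterior J A B (B \<omega>)) (A \<omega>) =
      measure_pmf.prob (cond_pmf J {\<omega>'. B \<omega>' = B \<omega>}) {\<omega>'. A \<omega>' = A \<omega>}"
    by (simp add: posterior_def pmf_map vimage_def)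
  also have "\<dots> = measure_pmf.prob J {\<omega>'. B \<omega>' = B \<omega> \<and> A \<omega>' = A \<omega>} / measure_pmf.prob J {\<omega>'. B \<omega>' = B \<omega>}"
  proof -
    have "emeasure (measure_pmf J) {\<omega>'. B \<omega>' = B \<omega>} \<noteq> 0"
      by (rule emeasure_measure_pmf_not_zero[OF ne])
    then show ?thesis
      by (simp add: cond_pmf.rep_eq[OF ne] measure_uniform_measure Collect_conj_eq)
  qed
  finally show ?thesis
    by (simp add: cond_prob_at_def pmf_map vimage_def conj_commute)
qed

text \<open>Recovers a generating kernel as a conditional probability: if \<open>A\<close> was drawn
  from \<open>k\<close> after \<open>B\<close>, the mass of the value of \<open>B\<close>
  cancels.\<close>

lemma cond_prob_at_kernel:
  assumes "map_pmf (\<lambda>\<omega>. (B \<omega>, A \<omega>)) J = bind_pmf (map_pmf B J) (\<lambda>b. map_pmf (Pair b) (k b))"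
    and "\<omega> \<in> set_pmf J"
  shows "cond_prob_at J A B \<omega> = pmf (k (B \<omega>)) (A \<omega>)"
proof -
  have "map_pmf (\<lambda>\<omega>. (A \<omega>, B \<omega>)) J = map_pmf prod.swap (map_pmf (\<lambda>\<omega>. (B \<omega>, A \<omega>)) J)"
    by (simp add: pmf.map_comp o_def)
  then have "pmf (map_pmf (\<lambda>\<omega>. (A \<omega>, B \<omega>)) J) (A \<omega>, B \<omega>) = pmf (map_pmf (\<lambda>\<omega>. (B \<omega>, A \<omega>)) J) (B \<omega>, A \<omega>)"
    using pmf_map_inj'[of prod.swap "map_pmf (\<lambda>\<omega>. (B \<omega>, A \<omega>)) J" "(B \<omega>, A \<omega>)"] by simp
  also have "\<dots> = pmf (map_pmf B J) (B \<omega>) * pmf (k (B \<omega>)) (A \<omega>)"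
    unfolding assms(1) by (rule pmf_bind_map_Pair)
  finally show ?thesis
    using pmf_map_at_pos[OF assms(2), of B] by (simp add: cond_prob_at_def)
qed

section \<open>Achievability of the rates below the bound\<close>

lemma achievable_0:
  assumes "R1 \<ge> 0" "R2 \<ge> 0"
  shows "achievable pS pY 0 R1 R2"
proof -
  define c :: "nat \<Rightarrow> ('a, 'b, 'c, 'd) channel_code" where
    "c n = \<lparr>desc1 = \<lambda>_. 1, desc2 = \<lambda>_. 1, enc = \<lambda>_ _ _. restrict undefined {..<n}, dec = \<lambda>_ _ _. 1\<rparr>" for n
  have "is_code n 0 R1 R2 (c n)" for n
    using num_indices_bounds(1)[OF assms(1), of n] num_indices_bounds(1)[OF assms(2), of n]
    by (auto simp: is_code_def c_def)
  moreover have "error_prob pS pY n 0 (c n) = 0" for n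
  proof -
    have "decoded_law pS pY n (c n) w = return_pmf 1" for w
      by (simp add: decoded_law_def c_def Let_def)
    then show ?thesis by (simp add: error_prob_def)
  qed
  ultimately show ?thesis unfolding achievable_def by (intro exI[of _ c]) simp
qed

lemma achievable_below_rate_bound:
  fixes pS :: "('s1::finite \<times> 's2::finite) pmf" and pY :: "'x::finite \<Rightarrow> 's1 \<Rightarrow> 's2 \<Rightarrow> 'y::finite pmf"
    and J :: "('s1 \<times> 's2 \<times> 'v1::finite \<times> 'v2::finite \<times> 'u::finite \<times> 'x \<times> 'y) pmf"
  assumes "R1 \<ge> 0" "R2 \<ge> 0" and J: "J \<in> feasible_laws pS pY R1 R2"
    and R: "0 \<le> R" "R < rate_bound J"
  shows "achievable pS pY R R1 R2"
proof -
  obtain pV1 pV2 pU pX where J_eq: "J = joint_law pS pY pV1 pV2 pU pX"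
    and c1: "mut_info J V1 S1 - mut_info J V1 (\<lambda>\<omega>. (Y \<omega>, S2 \<omega>, V2 \<omega>)) \<le> R1"
    and c2: "mut_info J V2 S2 - mut_info J V2 S1 \<le> R2"
    using J by (auto simp: feasible_laws_def)
  \<comment> \<open>In each identity the variables drawn afterwards, and those drawn independently
    given the states, integrate out, which leaves the kernel of the variable in question.\<close>
  have k1: "cond_prob_at J V1 S1 \<omega> = pmf (pV1 (S1 \<omega>)) (V1 \<omega>)" if "\<omega> \<in> set_pmf J" for \<omega>
    by (rule cond_prob_at_kernel[OF _ that])
      (simp add: J_eq joint_law_def map_bind_pmf bind_map_pmf bind_assoc_pmf bind_return_pmf split_beta' map_pmf_def)
  have k2: "cond_prob_at J V2 S2 \<omega> = pmf (pV2 (S2 \<omega>)) (V2 \<omega>)" if "\<omega> \<in> set_pmf J" for \<omega>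
    by (rule cond_prob_at_kernel[OF _ that])
      (simp add: J_eq joint_law_def map_bind_pmf bind_map_pmf bind_assoc_pmf bind_return_pmf split_beta' map_pmf_def)
  have k3: "cond_prob_at J U (\<lambda>\<omega>. (S1 \<omega>, V1 \<omega>, V2 \<omega>)) \<omega> =
      pmf ((\<lambda>(s1, v1, v2). pU s1 v1 v2) (S1 \<omega>, V1 \<omega>, V2 \<omega>)) (U \<omega>)" if "\<omega> \<in> set_pmf J" for \<omega>
    by (rule cond_prob_at_kernel[OF _ that])
      (simp add: J_eq joint_law_def map_bind_pmf bind_map_pmf bind_assoc_pmf bind_return_pmf split_beta' map_pmf_def)
  \<comment> \<open>Posteriors of \<open>J\<close> as guess laws: by \<open>k1\<close>,
    \<open>k2\<close> and \<open>k3\<close> the three expected log ratios become the information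
    differences of the constraints and of \<open>rate_bound\<close>.\<close>
  define dV1 where "dV1 y s2 v2 = posterior J V1 (\<lambda>\<omega>. (Y \<omega>, S2 \<omega>, V2 \<omega>)) (y, s2, v2)" for y s2 v2
  define eV2 where "eV2 = posterior J V2 S1"
  define dU where "dU y s2 v1 v2 = posterior J U (\<lambda>\<omega>. ((Y \<omega>, S2 \<omega>), (V1 \<omega>, V2 \<omega>))) ((y, s2), (v1, v2))" for y s2 v1 v2
  have post: "pmf (dV1 (Y \<omega>) (S2 \<omega>) (V2 \<omega>)) (V1 \<omega>) = cond_prob_at J V1 (\<lambda>\<omega>. (Y \<omega>, S2 \<omega>, V2 \<omega>)) \<omega>"
      "pmf (eV2 (S1 \<omega>)) (V2 \<omega>) = cond_prob_at J V2 S1 \<omega>"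
      "pmf (dU (Y \<omega>) (S2 \<omega>) (V1 \<omega>) (V2 \<omega>)) (U \<omega>) = cond_prob_at J U (\<lambda>\<omega>. ((Y \<omega>, S2 \<omega>), (V1 \<omega>, V2 \<omega>))) \<omega>"
    if "\<omega> \<in> set_pmf J" for \<omega>
    unfolding dV1_def eV2_def dU_def by (rule pmf_posterior[OF that])+
  show ?thesis
  proof (rule achievable_if_expectations[of pS pY pV1 pV2 pU pX dV1 eV2 dU R1 R2 R, folded J_eq])
    show "pmf (dV1 y s2 v2) v1 > 0 \<and> pmf (eV2 s1) v2 > 0 \<and> pmf (dU y s2 v1 v2) u > 0"
      if "(s1, s2, v1, v2, u, x, y) \<in> set_pmf J" for s1 s2 v1 v2 u x y
      using post[OF that] by (simp add: cond_prob_at_pos[OF that])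
    have "measure_pmf.expectation J (\<lambda>(s1, s2, v1, v2, u, x, y). log 2 (pmf (pV1 s1) v1 / pmf (dV1 y s2 v2) v1)) =
        mut_info J V1 S1 - mut_info J V1 (\<lambda>\<omega>. (Y \<omega>, S2 \<omega>, V2 \<omega>))"
      unfolding mut_info_diff
    proof (intro integral_cong_AE, simp, simp, unfold AE_measure_pmf_iff, rule ballI)
      fix \<omega> assume \<omega>: "\<omega> \<in> set_pmf J"
      show "(case \<omega> of (s1, s2, v1, v2, u, x, y) \<Rightarrow> log 2 (pmf (pV1 s1) v1 / pmf (dV1 y s2 v2) v1)) =
          log 2 (cond_prob_at J V1 S1 \<omega> / cond_prob_at J V1 (\<lambda>\<omega>. (Y \<omega>, S2 \<omega>, V2 \<omega>)) \<omega>)"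
        unfolding k1[OF \<omega>] post(1)[OF \<omega>, symmetric] by (cases \<omega>) simp
    qed
    with c1 show "measure_pmf.expectation J (\<lambda>(s1, s2, v1, v2, u, x, y). log 2 (pmf (pV1 s1) v1 / pmf (dV1 y s2 v2) v1)) \<le> R1"
      by simp
    have "measure_pmf.expectation J (\<lambda>(s1, s2, v1, v2, u, x, y). log 2 (pmf (pV2 s2) v2 / pmf (eV2 s1) v2)) =
        mut_info J V2 S2 - mut_info J V2 S1"
      unfolding mut_info_diff
    proof (intro integral_cong_AE, simp, simp, unfold AE_measure_pmf_iff, rule ballI)
      fix \<omega> assume \<omega>: "\<omega> \<in> set_pmf J"
      show "(case \<omega> of (s1, s2, v1, v2, u, x, y) \<Rightarrow> log 2 (pmf (pV2 s2) v2 / pmf (eV2 s1) v2)) =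
          log 2 (cond_prob_at J V2 S2 \<omega> / cond_prob_at J V2 S1 \<omega>)"
        unfolding k2[OF \<omega>] post(2)[OF \<omega>, symmetric] by (cases \<omega>) simp
    qed
    with c2 show "measure_pmf.expectation J (\<lambda>(s1, s2, v1, v2, u, x, y). log 2 (pmf (pV2 s2) v2 / pmf (eV2 s1) v2)) \<le> R2"
      by simp
    have "measure_pmf.expectation J (\<lambda>(s1, s2, v1, v2, u, x, y). log 2 (pmf (dU y s2 v1 v2) u / pmf (pU s1 v1 v2) u)) =
        rate_bound J"
      unfolding rate_bound_def cond_mut_info_diff
    proof (intro integral_cong_AE, simp, simp, unfold AE_measure_pmf_iff, rule ballI)
      fix \<omega> assume \<omega>: "\<omega> \<in> set_pmf J"
      show "(case \<omega> of (s1, s2, v1, v2, u, x, y) \<Rightarrow> log 2 (pmf (dU y s2 v1 v2) u / pmf (pU s1 v1 v2) u)) =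
          log 2 (cond_prob_at J U (\<lambda>\<omega>. ((Y \<omega>, S2 \<omega>), (V1 \<omega>, V2 \<omega>))) \<omega> /
            cond_prob_at J U (\<lambda>\<omega>. (S1 \<omega>, (V1 \<omega>, V2 \<omega>))) \<omega>)"
        unfolding k3[OF \<omega>] post(3)[OF \<omega>, symmetric] by (cases \<omega>) simp
    qed
    with R show "R < measure_pmf.expectation J (\<lambda>(s1, s2, v1, v2, u, x, y). log 2 (pmf (dU y s2 v1 v2) u / pmf (pU s1 v1 v2) u))"
      by simp
  qed (use assms in auto)
qed

theorem fact1:
  fixes pS :: "('s1::finite \<times> 's2::finite) pmf"
    and pY :: "'x::finite \<Rightarrow> 's1 \<Rightarrow> 's2 \<Rightarrow> 'y::finite pmf"
    and R1 R2 :: real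
  assumes "R1 \<ge> 0" and "R2 \<ge> 0"
  shows "capacity pS pY R1 R2 \<ge>
    (SUP J \<in> (feasible_laws pS pY R1 R2 ::
        ('s1 \<times> 's2 \<times> 'v1::finite \<times> 'v2::finite \<times> 'u::finite \<times> 'x \<times> 'y) pmf set).
      ereal (rate_bound J))"
proof (rule SUP_least)
  fix J :: "('s1 \<times> 's2 \<times> 'v1 \<times> 'v2 \<times> 'u \<times> 'x \<times> 'y) pmf"
  assume J: "J \<in> feasible_laws pS pY R1 R2"
  have le_capacity: "ereal R \<le> capacity pS pY R1 R2" if "achievable pS pY R R1 R2" for R
    unfolding capacity_def using that by (intro Sup_upper) auto
  \<comment> \<open>Coding reaches only rates strictly below the bound, so the bound is approached
    from below.\<close>
  show "ereal (rate_bound J) \<le> capacity pS pY R1 R2"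
  proof (rule dense_le)
    fix z assume z: "z < ereal (rate_bound J)"
    show "z \<le> capacity pS pY R1 R2"
    proof (cases "z \<le> 0")
      \<comment> \<open>The bound may be zero or negative, and \<open>z\<close> may be minus
        infinity; the code with a single message covers all these values.\<close>
      case True
      also have "0 \<le> capacity pS pY R1 R2"
        using le_capacity[OF achievable_0[OF assms]] by (simp add: zero_ereal_def)
      finally show ?thesis .
    next
      case False
      with z obtain r where r: "z = ereal r" by (cases z) auto
      with False z have "0 \<le> r" "r < rate_bound J" by auto
      from le_capacity[OF achievable_below_rate_bound[OF assms J this]] show ?thesis by (simp add: r)
    qed
  qed
qed

end
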